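(* For every $\lambda,\mu\in\mathbb{C}\setminus\mathbb{Z}$, the vertex algebra $\Pi(0)$ carries the structure of an irreducible $\mathbb{Z}_{\ge0}$-graded $\hat{\mathfrak g}\oplus\mathbb{C}L(0)$-module isomorphic to $E_{\lambda,\mu}$. Its character is $$\mathrm{ch}_{E_{\lambda,\mu}}(q,z)=\mathrm{tr}\,q^{L(0)}z^{h(0)}=z^{\lambda-\mu}\delta(z^2)\prod_{n=1}^{\infty}(1-q^nz^2)^{-1}(1-q^nz^{-2})^{-1}=z^{\lambda-\mu}\delta(z^2)\prod_{n=1}^{\infty}(1-q^n)^{-2}.$$
   Context: $\delta(z^2)=\sum_{n\in\mathbb{Z}}z^{2n}$, and the products are expanded in nonnegative powers of $q$. $\mathfrak g=sl_2(\mathbb{C})$ with basis $e,f,h$, $[h,e]=2e$, $[h,f]=-2f$, $[e,f]=h$; $\hat{\mathfrak g}=\mathfrak g\otimes\mathbb{C}[t,t^{-1}]\oplus\mathbb{C}c$ is the affine Lie algebra (form normalized by $(e,f)=1,(h,h)=2$), $x(n)=x\otimes t^n$; in $\hat{\mathfrak g}\oplus\mathbb{C}L(0)$ one has $[L(0),x(n)]=-nx(n)$, $[L(0),c]=0$. $F$ is the irreducible module, generated by $\mathbf 1$ with $\Psi^\pm(r)\mathbf 1=0$ for $r>0$, of the Clifford algebra with generators $\Psi^{\pm}(r)$, $r\in\frac12+\mathbb{Z}$, and relations $\{\Psi^{\pm}(r),\Psi^{\mp}(s)\}=\delta_{r+s,0}$, $\{\Psi^{\pm}(r),\Psi^{\pm}(s)\}=0$;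 it is a vertex superalgebra generated by $\Psi^\pm(z)=\sum_n\Psi^\pm(n+\frac12)z^{-n-1}$. $F_{-1}=V_{\mathbb{Z}\beta}$, $\langle\beta,\beta\rangle=-1$, is the lattice vertex superalgebra with trivial cocycle ($Y(e^{m\beta},z)e^{n\beta}=z^{-mn}(e^{(m+n)\beta}+O(z))$), $Y(e^{\pm\beta},z)=\sum_n e^{\pm\beta}_nz^{-n-1}$; tensor products of operators act by $(A\otimes B)(x\otimes y)=Ax\otimes By$. Let $J^f(0)$ be the charge operator on $F$ ($J^f(0)\mathbf 1=0$, $[J^f(0),\Psi^\pm(r)]=\pm\Psi^\pm(r)$) and $H(0)=J^f(0)\otimes1+1\otimes\beta(0)$. The vertex algebra $\Pi(0)$ is $\mathrm{Ker}_{F\otimes F_{-1}}H(0)$. With $\omega=\omega^{(f)}\otimes\mathbf 1-\frac12\mathbf 1\otimes\beta(-1)^2\mathbf 1$, $\omega^{(f)}=\frac12(\Psi^+(-\frac32)\Psi^-(-\frac12)+\Psi^-(-\frac32)\Psi^+(-\frac12))\mathbf 1$, and $Y(\omega,z)=\sum_nL(n)z^{-n-2}$, the operator $L(0)$ gives $\Pi(0)$ a $\mathbb{Z}_{\ge0}$-gradation. $E_{\lambda,\mu}$ is the vector space $\Pi(0)$ (a subspace of $F\otimes F_{-1}$), with this $L(0)$ and with the $\hat{\mathfrak g}$-action $$e(m)=\sum_{i\in\mathbb{Z}}(\lambda-i)\Psi^{+}(i-\tfrac12)\otimes e^{\beta}_{m-i-1},\quad f(m)=\sum_{i\in\mathbb{Z}}(\mu-i)\Psi^{-}(i-\tfrac12)\otimes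 e^{-\beta}_{m-i-1},$$ $$h(m)=-2\beta(m)+(\lambda-\mu)\delta_{m,0},\quad c=-2.$$ *)

theory Defs
  imports
    "HOL-Analysis.Infinite_Products"
    "HOL-Computational_Algebra.Formal_Power_Series"
    "HOL-Library.FSet"
    "HOL-Library.Groups_Big_Fun"
    "HOL-Library.Multiset"
    "HOL-Library.Poly_Mapping"
begin

section \<open>Complex vector spaces with a basis\<close>

text \<open>The complex vector space with basis \<^typ>\<open>'a\<close> is \<^typ>\<open>'a \<Rightarrow>\<^sub>0 complex\<close>.\<close>

definition cscale :: "complex \<Rightarrow> ('a \<Rightarrow>\<^sub>0 complex) \<Rightarrow> ('a \<Rightarrow>\<^sub>0 complex)"
  where "cscale c v = Poly_Mapping.map ((*) c) v"

lemma lookup_cscale [simp]: "Poly_Mapping.lookup (cscale c v) a = c * Poly_Mapping.lookup v a"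
  by (simp add: cscale_def map.rep_eq when_def)

interpretation cvs: vector_space "cscale :: complex \<Rightarrow> ('a \<Rightarrow>\<^sub>0 complex) \<Rightarrow> _"
  by standard (rule poly_mapping_eqI; simp add: lookup_add algebra_simps)+

definition ket :: "'a \<Rightarrow> ('a \<Rightarrow>\<^sub>0 complex)"
  where "ket a = Poly_Mapping.single a 1"

definition lin_ext :: "('a \<Rightarrow> ('b \<Rightarrow>\<^sub>0 complex)) \<Rightarrow> ('a \<Rightarrow>\<^sub>0 complex) \<Rightarrow> ('b \<Rightarrow>\<^sub>0 complex)"
  where "lin_ext g v = (\<Sum>a\<in>Poly_Mapping.keys v. cscale (Poly_Mapping.lookup v a) (g a))"

definition tensor :: "('a \<Rightarrow>\<^sub>0 complex) \<Rightarrow> ('b \<Rightarrow>\<^sub>0 complex) \<Rightarrow> ('a \<times> 'b \<Rightarrow>\<^sub>0 complex)"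
  where "tensor x y = lin_ext (\<lambda>a. lin_ext (\<lambda>b. ket (a, b)) y) x"

text \<open>There is no super sign: \<open>(A \<otimes> B)(x \<otimes> y) = A x \<otimes> B y\<close>, see \<open>tensor_op_tensor\<close>.\<close>

definition tensor_op ::
    "(('a \<Rightarrow>\<^sub>0 complex) \<Rightarrow> ('a \<Rightarrow>\<^sub>0 complex)) \<Rightarrow> (('b \<Rightarrow>\<^sub>0 complex) \<Rightarrow> ('b \<Rightarrow>\<^sub>0 complex))
      \<Rightarrow> ('a \<times> 'b \<Rightarrow>\<^sub>0 complex) \<Rightarrow> ('a \<times> 'b \<Rightarrow>\<^sub>0 complex)"
  where "tensor_op A B = lin_ext (\<lambda>(a, b). tensor (A (ket a)) (B (ket b)))"

abbreviation clinear :: "(('a \<Rightarrow>\<^sub>0 complex) \<Rightarrow> ('b \<Rightarrow>\<^sub>0 complex)) \<Rightarrow> bool"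
  where "clinear \<equiv> Vector_Spaces.linear cscale cscale"

lemma lin_ext_superset:
  assumes "finite S" "Poly_Mapping.keys v \<subseteq> S"
  shows "lin_ext g v = (\<Sum>a\<in>S. cscale (Poly_Mapping.lookup v a) (g a))"
  unfolding lin_ext_def using assms
  by (intro sum.mono_neutral_left) (auto simp: in_keys_iff)

lemma linear_lin_ext: "clinear (lin_ext g)"
proof -
  have add: "lin_ext g (u + v) = lin_ext g u + lin_ext g v" for u v
  proof -
    let ?S = "Poly_Mapping.keys u \<union> Poly_Mapping.keys v"
    have "Poly_Mapping.keys (u + v) \<subseteq> ?S" by (rule Poly_Mapping.keys_add)
    then show ?thesis
      by (simp add: lin_ext_superset[of ?S] lookup_add cvs.scale_left_distrib sum.distrib)
  qed
  have "lin_ext g (cscale c v) = cscale c (lin_ext g v)" for c v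
  proof -
    have "Poly_Mapping.keys (cscale c v) \<subseteq> Poly_Mapping.keys v" by (auto simp: in_keys_iff)
    then show ?thesis
      by (simp add: lin_ext_superset[of "Poly_Mapping.keys v"] cvs.scale_sum_right)
  qed
  with add show ?thesis
    by (simp add: Vector_Spaces.linear_def module_hom_def module_hom_axioms_def
        cvs.module_axioms cvs.vector_space_axioms)
qed


lemma lin_ext_ket [simp]: "lin_ext g (ket a) = g a"
  by (simp add: lin_ext_def ket_def)

lemma lookup_ket: "Poly_Mapping.lookup (ket a) b = (if a = b then 1 else 0)"
  by (simp add: ket_def lookup_single when_def)

lemma lookup_lin_ext:
  "Poly_Mapping.lookup (lin_ext g v) b
    = (\<Sum>a\<in>Poly_Mapping.keys v. Poly_Mapping.lookup v a * Poly_Mapping.lookup (g a) b)"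
  by (simp add: lin_ext_def lookup_sum)

lemma ket_expand:
  "v = (\<Sum>a\<in>Poly_Mapping.keys v. cscale (Poly_Mapping.lookup v a) (ket a))"
  by (rule poly_mapping_eqI) (simp add: lookup_sum lookup_ket in_keys_iff if_distrib cong: if_cong)

lemma clinear_sum:
  assumes "clinear A"
  shows "A (\<Sum>i\<in>I. f i) = (\<Sum>i\<in>I. A (f i))"
  using assms unfolding Vector_Spaces.linear_def by (blast intro: module_hom.sum)

lemma clinear_cscale:
  assumes "clinear A"
  shows "A (cscale c v) = cscale c (A v)"
  using assms unfolding Vector_Spaces.linear_def by (blast intro: module_hom.scale)

lemma clinear_eq_lin_ext:
  assumes "clinear A"
  shows "A v = lin_ext (\<lambda>a. A (ket a)) v"
  by (subst ket_expand) (simp add: clinear_sum[OF assms] clinear_cscale[OF assms] lin_ext_def)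

lemma clinear_0 [simp]:
  assumes "clinear A"
  shows "A 0 = 0"
  using clinear_sum[OF assms, of "\<lambda>_. 0" "{}"] by simp

lemma clinear_add:
  assumes "clinear A"
  shows "A (u + v) = A u + A v"
  using assms unfolding Vector_Spaces.linear_def by (blast intro: module_hom.add)

lemma clinearI:
  assumes "\<And>u v. A (u + v) = A u + A v" "\<And>c v. A (cscale c v) = cscale c (A v)"
  shows "clinear A"
  using assms by (simp add: Vector_Spaces.linear_def module_hom_def module_hom_axioms_def
      cvs.module_axioms cvs.vector_space_axioms)

lemma clinear_ext:
  assumes "clinear A" "clinear B" "\<And>a. A (ket a) = B (ket a)"
  shows "A v = B v"
  unfolding clinear_eq_lin_ext[OF assms(1), of v] clinear_eq_lin_ext[OF assms(2), of v] assms(3) ..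

lemma keys_lin_ext:
  assumes "b \<in> Poly_Mapping.keys (lin_ext g v)"
  obtains a where "a \<in> Poly_Mapping.keys v" "b \<in> Poly_Mapping.keys (g a)"
  using assms unfolding in_keys_iff lookup_lin_ext
  by (elim sum.not_neutral_contains_not_neutral) (auto simp: in_keys_iff)

lemma lookup_tensor:
  "Poly_Mapping.lookup (tensor x y) (a, b) = Poly_Mapping.lookup x a * Poly_Mapping.lookup y b"
proof -
  have "Poly_Mapping.lookup (lin_ext (\<lambda>b. ket (a', b)) y) (a, b)
      = (if a' = a then Poly_Mapping.lookup y b else 0)" for a'
    by (auto simp: lookup_lin_ext lookup_ket in_keys_iff if_distrib cong: if_cong)
  note this[simp]
  show ?thesis
    unfolding tensor_def lookup_lin_ext[of _ x]
    by (simp add: in_keys_iff if_distrib cong: if_cong)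
qed

lemma tensor_op_tensor:
  assumes "clinear A" "clinear B"
  shows "tensor_op A B (tensor x y) = tensor (A x) (B y)"
proof (rule poly_mapping_eqI)
  fix p :: "'a \<times> 'b"
  obtain c d where p: "p = (c, d)" by force
  let ?S = "Poly_Mapping.keys x \<times> Poly_Mapping.keys y"
  have "Poly_Mapping.keys (tensor x y) \<subseteq> ?S"
    by (auto simp: in_keys_iff lookup_tensor)
  then have "Poly_Mapping.lookup (tensor_op A B (tensor x y)) p
      = (\<Sum>(a, b)\<in>?S. Poly_Mapping.lookup x a * Poly_Mapping.lookup y b *
          (Poly_Mapping.lookup (A (ket a)) c * Poly_Mapping.lookup (B (ket b)) d))"
    unfolding tensor_op_def
    by (subst lin_ext_superset[of ?S])
      (auto simp: lookup_sum lookup_tensor p intro!: sum.cong)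
  also have "\<dots> = (\<Sum>a\<in>Poly_Mapping.keys x. Poly_Mapping.lookup x a * Poly_Mapping.lookup (A (ket a)) c)
      * (\<Sum>b\<in>Poly_Mapping.keys y. Poly_Mapping.lookup y b * Poly_Mapping.lookup (B (ket b)) d)"
    by (simp add: sum_product sum.cartesian_product mult_ac)
  also have "\<dots> = Poly_Mapping.lookup (tensor (A x) (B y)) p"
    unfolding p lookup_tensor
    by (simp add: clinear_eq_lin_ext[OF assms(1), of x] clinear_eq_lin_ext[OF assms(2), of y]
        lookup_lin_ext)
  finally show "Poly_Mapping.lookup (tensor_op A B (tensor x y)) p
      = Poly_Mapping.lookup (tensor (A x) (B y)) p" .
qed


section \<open>Fields and normally ordered products\<close>

text \<open>
  A field \<open>a(z) = \<Sum>n. a\<^sub>n z\<^sup>-\<^sup>n\<^sup>-\<^sup>1\<close> is given by its modes \<open>a n\<close>.  The derivative has modes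
  \<open>-n a\<^sub>n\<^sub>-\<^sub>1\<close>, and \<open>normal_product s a b\<close> consists of the modes of
  \<open>:a(z)b(z): = a\<^sup>-(z) b(z) + s b(z) a\<^sup>+(z)\<close>, where \<open>a\<^sup>+(z) = \<Sum>n\<ge>0. a\<^sub>n z\<^sup>-\<^sup>n\<^sup>-\<^sup>1\<close> and \<open>s\<close> is \<open>-1\<close>
  if both fields are odd and \<open>1\<close> otherwise.  In a vertex superalgebra,
  \<open>Y(a\<^sub>-\<^sub>1 b, z) = :Y(a, z) Y(b, z):\<close> and \<open>Y(a\<^sub>-\<^sub>2 b, z) = :(\<partial>Y(a, z)) Y(b, z):\<close>.
\<close>

type_synonym 'a modes = "int \<Rightarrow> ('a \<Rightarrow>\<^sub>0 complex) \<Rightarrow> ('a \<Rightarrow>\<^sub>0 complex)"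

definition deriv_modes :: "'a modes \<Rightarrow> 'a modes"
  where "deriv_modes a n v = cscale (- of_int n) (a (n - 1) v)"

definition normal_product :: "complex \<Rightarrow> 'a modes \<Rightarrow> 'a modes \<Rightarrow> 'a modes"
  where "normal_product s a b n v =
    Sum_any (\<lambda>j. if j < 0 then a j (b (n - j - 1) v) else cscale s (b (n - j - 1) (a j v)))"

definition is_field :: "'a modes \<Rightarrow> bool"
  where "is_field a \<longleftrightarrow> (\<forall>n. clinear (a n)) \<and> (\<forall>v. \<exists>N. \<forall>n\<ge>N. a n v = 0)"

lemma is_fieldI:
  assumes "\<And>n. clinear (a n)" "\<And>b. \<exists>N. \<forall>n\<ge>N. a n (ket b) = 0"
  shows "is_field a"
  unfolding is_field_def
proof (intro conjI allI)
  fix v :: "'a \<Rightarrow>\<^sub>0 complex"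
  obtain N where N: "\<And>b n. n \<ge> N b \<Longrightarrow> a n (ket b) = 0"
    using assms(2) by metis
  let ?M = "Max (insert 0 (N ` Poly_Mapping.keys v))"
  have "a n v = 0" if "n \<ge> ?M" for n
  proof -
    have "N b \<le> n" if "b \<in> Poly_Mapping.keys v" for b
      using that \<open>n \<ge> ?M\<close> Max_ge[of "insert 0 (N ` Poly_Mapping.keys v)" "N b"] by fastforce
    then show ?thesis
      by (simp add: clinear_eq_lin_ext[OF assms(1), of _ v] lin_ext_def N)
  qed
  then show "\<exists>N. \<forall>n\<ge>N. a n v = 0" by blast
qed (rule assms(1))

lemma finite_int_bounded:
  fixes P :: "int \<Rightarrow> bool"
  assumes "\<And>j. j \<ge> N \<Longrightarrow> \<not> P j" "\<And>j. j \<le> M \<Longrightarrow> \<not> P j"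
  shows "finite {j. P j}"
  by (rule finite_subset[of _ "{M<..<N}"]) (use assms in \<open>auto simp: not_le[symmetric]\<close>)

text \<open>\<^const>\<open>Sum_any\<close> is a sum over the support, which is finite here.\<close>

lemma finite_normal_product:
  assumes "is_field a" "is_field b"
  shows "finite {j. (if j < 0 then a j (b (n - j - 1) v) else cscale s (b (n - j - 1) (a j v))) \<noteq> 0}"
proof -
  obtain N M where N: "\<And>n. n \<ge> N \<Longrightarrow> a n v = 0" and M: "\<And>n. n \<ge> M \<Longrightarrow> b n v = 0"
    using assms unfolding is_field_def by meson
  have [simp]: "a n 0 = 0" "b n 0 = 0" for n
    using assms by (simp_all add: is_field_def)
  show ?thesis
    by (rule finite_int_bounded[of "max 0 N" _ "min (-1) (n - 1 - M)"]) (auto simp: N M)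
qed


section \<open>The fermionic Fock space\<close>

text \<open>
  The mode \<open>\<Psi>\<^sup>\<plusminus>\<^sub>n = \<Psi>\<^sup>\<plusminus>(n + 1/2)\<close> is \<open>psi_plus n\<close> resp. \<open>psi_minus n\<close>; it annihilates the vacuum
  iff \<open>n \<ge> 0\<close>.  A basis vector of \<open>F\<close> is the finite set of excited labels, where
  \<open>j < 0\<close> is the label of the creation operator \<open>\<Psi>\<^sup>+\<^sub>j\<close> and \<open>j \<ge> 0\<close> is the label of
  \<open>\<Psi>\<^sup>-\<^sub>-\<^sub>j\<^sub>-\<^sub>1\<close>.  The operator conjugate to \<open>\<Psi>\<^sup>+\<^sub>j\<close> is \<open>\<Psi>\<^sup>-\<^sub>-\<^sub>j\<^sub>-\<^sub>1\<close>.
\<close>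

type_synonym fock = "int fset \<Rightarrow>\<^sub>0 complex"

definition fermion_sign :: "int \<Rightarrow> int fset \<Rightarrow> complex"
  where "fermion_sign j S = (-1) ^ card {i. i |\<in>| S \<and> i < j}"

definition fermion_create :: "int \<Rightarrow> fock \<Rightarrow> fock"
  where "fermion_create j =
    lin_ext (\<lambda>S. if j |\<in>| S then 0 else cscale (fermion_sign j S) (ket (finsert j S)))"

definition fermion_annihilate :: "int \<Rightarrow> fock \<Rightarrow> fock"
  where "fermion_annihilate j =
    lin_ext (\<lambda>S. if j |\<in>| S then cscale (fermion_sign j S) (ket (S |-| {|j|})) else 0)"

definition psi_plus :: "int fset modes"
  where "psi_plus n = (if n < 0 then fermion_create n else fermion_annihilate n)"

definition psi_minus :: "int fset modes"
  where "psi_minus n =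
    (if n < 0 then fermion_create (- n - 1) else fermion_annihilate (- n - 1))"

definition fock_vac :: fock
  where "fock_vac = ket {||}"

text \<open>The operator \<open>J\<^sup>f(0)\<close>.\<close>

definition label_charge :: "int fset \<Rightarrow> int"
  where "label_charge S = (\<Sum>j\<in>fset S. if j < 0 then 1 else - 1)"

definition fock_charge :: "fock \<Rightarrow> fock"
  where "fock_charge = lin_ext (\<lambda>S. cscale (of_int (label_charge S)) (ket S))"

text \<open>The modes of \<open>Y(\<omega>\<^sup>(\<^sup>f\<^sup>), z)\<close>; note \<open>\<Psi>\<^sup>\<plusminus>(-3/2) = \<Psi>\<^sup>\<plusminus>\<^sub>-\<^sub>2\<close>.\<close>

definition fock_omega :: "int fset modes"
  where "fock_omega n v = cscale (1/2)
    (normal_product (-1) (deriv_modes psi_plus) psi_minus n v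
      + normal_product (-1) (deriv_modes psi_minus) psi_plus n v)"

lemma fermion_sign_finsert [simp]: "fermion_sign j (finsert j S) = fermion_sign j S"
  unfolding fermion_sign_def by (rule arg_cong[where f = "\<lambda>A. (-1) ^ card A"]) auto

lemma fermion_sign_fminus [simp]: "fermion_sign j (S |-| {|j|}) = fermion_sign j S"
  unfolding fermion_sign_def by (rule arg_cong[where f = "\<lambda>A. (-1) ^ card A"]) auto

lemma lookup_fermion_create:
  "Poly_Mapping.lookup (fermion_create j v) T =
    (if j |\<in>| T then fermion_sign j T * Poly_Mapping.lookup v (T |-| {|j|}) else 0)"
proof -
  have "Poly_Mapping.lookup (fermion_create j v) T = (\<Sum>S\<in>Poly_Mapping.keys v.
      if S = T |-| {|j|} then if j |\<in>| T then fermion_sign j T * Poly_Mapping.lookup v S else 0 else 0)"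
    unfolding fermion_create_def lookup_lin_ext
    by (intro sum.cong refl) (auto simp: lookup_ket)
  then show ?thesis by (auto simp: in_keys_iff)
qed

lemma lookup_fermion_annihilate:
  "Poly_Mapping.lookup (fermion_annihilate j v) T =
    (if j |\<in>| T then 0 else fermion_sign j T * Poly_Mapping.lookup v (finsert j T))"
proof -
  have "Poly_Mapping.lookup (fermion_annihilate j v) T = (\<Sum>S\<in>Poly_Mapping.keys v.
      if S = finsert j T then if j |\<in>| T then 0 else fermion_sign j T * Poly_Mapping.lookup v S else 0)"
    unfolding fermion_annihilate_def lookup_lin_ext
    by (intro sum.cong refl) (auto simp: lookup_ket)
  then show ?thesis by (auto simp: in_keys_iff)
qed

lemma fermion_sign_finsert_neq:
  assumes "i |\<notin>| S" "i \<noteq> j"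
  shows "fermion_sign j (finsert i S) = (if i < j then - 1 else 1) * fermion_sign j S"
proof (cases "i < j")
  case True
  have "{k. k |\<in>| finsert i S \<and> k < j} = insert i {k. k |\<in>| S \<and> k < j}"
    using True by auto
  moreover have "finite {k. k |\<in>| S \<and> k < j}" "i \<notin> {k. k |\<in>| S \<and> k < j}"
    using assms by (auto intro: finite_subset[of _ "fset S"])
  ultimately show ?thesis using True by (simp add: fermion_sign_def)
next
  case False
  then have "{k. k |\<in>| finsert i S \<and> k < j} = {k. k |\<in>| S \<and> k < j}"
    using assms by auto
  then show ?thesis using False by (simp add: fermion_sign_def)
qed

lemma fermion_sign_fminus_neq:
  assumes "i |\<in>| S" "i \<noteq> j"
  shows "fermion_sign j (S |-| {|i|}) = (if i < j then - 1 else 1) * fermion_sign j S"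
  using fermion_sign_finsert_neq[of i "S |-| {|i|}" j] assms
  by (simp add: finsert_absorb)

lemma fermion_sign_sq [simp]: "fermion_sign j S * fermion_sign j S = 1"
  by (simp add: fermion_sign_def flip: power_mult_distrib)

lemma fermion_car:
  "fermion_create i (fermion_create j v) + fermion_create j (fermion_create i v) = 0"
  "fermion_annihilate i (fermion_annihilate j v) + fermion_annihilate j (fermion_annihilate i v) = 0"
  "fermion_create i (fermion_annihilate j v) + fermion_annihilate j (fermion_create i v)
    = (if i = j then v else 0)"
proof -
  show "fermion_create i (fermion_create j v) + fermion_create j (fermion_create i v) = 0"
  proof (rule poly_mapping_eqI)
    fix T
    have "T |-| {|i|} |-| {|j|} = T |-| {|j|} |-| {|i|}" by auto
    then show "Poly_Mapping.lookup (fermion_create i (fermion_create j v)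
        + fermion_create j (fermion_create i v)) T = Poly_Mapping.lookup 0 T"
      by (cases i j rule: linorder_cases)
        (simp_all add: lookup_add lookup_fermion_create fermion_sign_fminus_neq)
  qed
  show "fermion_annihilate i (fermion_annihilate j v) + fermion_annihilate j (fermion_annihilate i v) = 0"
    by (cases i j rule: linorder_cases; rule poly_mapping_eqI)
      (auto simp: lookup_add lookup_fermion_annihilate fermion_sign_finsert_neq algebra_simps
        finsert_commute)
  show "fermion_create i (fermion_annihilate j v) + fermion_annihilate j (fermion_create i v)
    = (if i = j then v else 0)"
  proof (rule poly_mapping_eqI)
    fix T
    have "finsert j (T |-| {|i|}) = finsert j T |-| {|i|}" if "i \<noteq> j" using that by auto
    moreover have "finsert i (T |-| {|i|}) = T" if "i |\<in>| T" using that by auto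
    moreover have "finsert i T |-| {|i|} = T" if "i |\<notin>| T" using that by auto
    ultimately show "Poly_Mapping.lookup (fermion_create i (fermion_annihilate j v)
        + fermion_annihilate j (fermion_create i v)) T
      = Poly_Mapping.lookup (if i = j then v else 0) T"
      by (cases i j rule: linorder_cases; cases "i |\<in>| T"; cases "j |\<in>| T")
        (simp_all add: lookup_add lookup_fermion_create lookup_fermion_annihilate
          fermion_sign_finsert_neq fermion_sign_fminus_neq flip: mult.assoc)
  qed
qed

text \<open>
  The following facts identify \<^typ>\<open>fock\<close> as the irreducible module over the Clifford algebra
  that is generated by a vacuum vector.
\<close>

lemma psi_car:
  "psi_plus m (psi_plus n v) + psi_plus n (psi_plus m v) = 0"
  "psi_minus m (psi_minus n v) + psi_minus n (psi_minus m v) = 0"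
  "psi_plus m (psi_minus n v) + psi_minus n (psi_plus m v) = (if m + n + 1 = 0 then v else 0)"
proof -
  show "psi_plus m (psi_plus n v) + psi_plus n (psi_plus m v) = 0"
    using fermion_car[of m n v] fermion_car(3)[of n m v]
    by (auto simp: psi_plus_def add.commute)
  show "psi_minus m (psi_minus n v) + psi_minus n (psi_minus m v) = 0"
    using fermion_car[of "- m - 1" "- n - 1" v] fermion_car(3)[of "- n - 1" "- m - 1" v]
    by (auto simp: psi_minus_def add.commute)
  show "psi_plus m (psi_minus n v) + psi_minus n (psi_plus m v) = (if m + n + 1 = 0 then v else 0)"
    using fermion_car[of m "- n - 1" v] fermion_car(3)[of "- n - 1" m v]
    by (auto simp: psi_plus_def psi_minus_def add.commute)
qed

lemma psi_vac:
  assumes "n \<ge> 0"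
  shows "psi_plus n fock_vac = 0" "psi_minus n fock_vac = 0"
  using assms
  by (simp_all add: psi_plus_def psi_minus_def fock_vac_def fermion_annihilate_def)

lemma fock_generated:
  assumes "cvs.subspace W" "fock_vac \<in> W"
    "\<And>n w. w \<in> W \<Longrightarrow> psi_plus n w \<in> W" "\<And>n w. w \<in> W \<Longrightarrow> psi_minus n w \<in> W"
  shows "W = UNIV"
proof -
  have create: "fermion_create j w \<in> W" if "w \<in> W" for j w
    using assms(3)[OF that, of j] assms(4)[OF that, of "- j - 1"]
    by (auto simp: psi_plus_def psi_minus_def split: if_splits)
  have "ket S \<in> W" for S
  proof (induction S)
    case empty
    then show ?case using assms(2) by (simp add: fock_vac_def)
  next
    case (insert j S)
    have "cscale (fermion_sign j S) (fermion_create j (ket S)) \<in> W"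
      using create[OF insert.IH] assms(1) by (simp add: cvs.subspace_scale)
    with insert.hyps show ?case by (simp add: fermion_create_def)
  qed
  then have "v \<in> W" for v
    by (subst ket_expand) (intro cvs.subspace_sum cvs.subspace_scale assms(1))
  then show ?thesis by blast
qed

lemma fock_irreducible:
  assumes "cvs.subspace W" "W \<noteq> {0}"
    "\<And>n w. w \<in> W \<Longrightarrow> psi_plus n w \<in> W" "\<And>n w. w \<in> W \<Longrightarrow> psi_minus n w \<in> W"
  shows "W = UNIV"
proof -
  have annihilate: "fermion_annihilate j w \<in> W" if "w \<in> W" for j w
    using assms(3)[OF that, of j] assms(4)[OF that, of "- j - 1"]
    by (auto simp: psi_plus_def psi_minus_def split: if_splits)
  have "fock_vac \<in> W" if "v \<in> W" "v \<noteq> 0" "\<forall>S\<in>Poly_Mapping.keys v. fcard S \<le> n" for n v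
    using that
  proof (induction n arbitrary: v)
    case 0
    then have keys: "Poly_Mapping.keys v \<subseteq> {{||}}" by auto
    then have v: "v = cscale (Poly_Mapping.lookup v {||}) fock_vac"
      using lin_ext_superset[OF _ keys, of ket] clinear_eq_lin_ext[of "\<lambda>v. v" v]
      by (simp add: fock_vac_def cvs.linear_ident)
    with 0 have "Poly_Mapping.lookup v {||} \<noteq> 0" by (metis cvs.scale_zero_left)
    then have "fock_vac = cscale (inverse (Poly_Mapping.lookup v {||})) v"
      by (subst (2) v) simp
    then show ?case using 0(1) assms(1) by (metis cvs.subspace_scale)
  next
    case (Suc n)
    show ?case
    proof (cases "\<forall>S\<in>Poly_Mapping.keys v. fcard S \<le> n")
      case True
      then show ?thesis using Suc by blast
    next
      case False
      then obtain S where S: "S \<in> Poly_Mapping.keys v" "fcard S \<noteq> 0" by (metis le0)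
      then obtain j where j: "j |\<in>| S" by (metis fcard_fempty fempty_iff fset_eqI)
      let ?w = "fermion_annihilate j v"
      have "Poly_Mapping.lookup ?w (S |-| {|j|}) \<noteq> 0"
        using j S(1) by (simp add: lookup_fermion_annihilate finsert_absorb in_keys_iff fermion_sign_def)
      then have "?w \<noteq> 0" by auto
      moreover have "fcard T \<le> n" if "T \<in> Poly_Mapping.keys ?w" for T
      proof -
        have "j |\<notin>| T" "finsert j T \<in> Poly_Mapping.keys v"
          using that by (auto simp: in_keys_iff lookup_fermion_annihilate split: if_splits)
        then show ?thesis using Suc.prems(3) by (fastforce simp: fcard_finsert)
      qed
      ultimately show ?thesis using Suc.IH annihilate Suc.prems(1) by blast
    qed
  qed
  moreover obtain v where "v \<in> W" "v \<noteq> 0"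
    using assms(1,2) cvs.subspace_0 by blast
  moreover have "\<forall>S\<in>Poly_Mapping.keys v. fcard S \<le> Max (fcard ` Poly_Mapping.keys v)"
    by simp
  ultimately have "fock_vac \<in> W" by blast
  with assms show ?thesis by (intro fock_generated)
qed

lemma fock_charge_vac: "fock_charge fock_vac = 0"
  by (simp add: fock_charge_def fock_vac_def label_charge_def)

lemma lookup_fock_charge:
  "Poly_Mapping.lookup (fock_charge v) S = of_int (label_charge S) * Poly_Mapping.lookup v S"
  by (auto simp: fock_charge_def lookup_lin_ext lookup_ket in_keys_iff if_distrib cong: if_cong)

lemma label_charge_finsert:
  assumes "j |\<notin>| S"
  shows "label_charge (finsert j S) = label_charge S + (if j < 0 then 1 else - 1)"
  using assms by (simp add: label_charge_def)

lemma fock_charge_commutator: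
  "fock_charge (psi_plus n v) - psi_plus n (fock_charge v) = psi_plus n v"
  "fock_charge (psi_minus n v) - psi_minus n (fock_charge v) = - psi_minus n v"
proof -
  have charge: "label_charge T = label_charge (T |-| {|j|}) + (if j < 0 then 1 else - 1)"
    if "j |\<in>| T" for j T
    using label_charge_finsert[of j "T |-| {|j|}"] that by (simp add: finsert_absorb)
  have "fock_charge (fermion_create j v) - fermion_create j (fock_charge v)
      = cscale (if j < 0 then 1 else - 1) (fermion_create j v)" for j
    by (rule poly_mapping_eqI)
      (auto simp: lookup_minus lookup_fock_charge lookup_fermion_create charge algebra_simps)
  moreover have "fock_charge (fermion_annihilate j v) - fermion_annihilate j (fock_charge v)
      = cscale (if j < 0 then - 1 else 1) (fermion_annihilate j v)" for j
    by (rule poly_mapping_eqI)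
      (auto simp: lookup_minus lookup_fock_charge lookup_fermion_annihilate label_charge_finsert
        algebra_simps)
  ultimately show
    "fock_charge (psi_plus n v) - psi_plus n (fock_charge v) = psi_plus n v"
    "fock_charge (psi_minus n v) - psi_minus n (fock_charge v) = - psi_minus n v"
    by (simp_all add: psi_plus_def psi_minus_def)
qed

lemma is_field_psi: "is_field psi_plus" "is_field psi_minus"
proof -
  have lin: "clinear (fermion_create j)" "clinear (fermion_annihilate j)" for j
    by (simp_all add: fermion_create_def fermion_annihilate_def linear_lin_ext)
  have bound: "\<exists>N\<ge>0. \<forall>j. N \<le> \<bar>j\<bar> \<longrightarrow> fermion_annihilate j (ket S) = 0" for S
  proof (intro exI[of _ "Max (insert 0 (abs ` fset S)) + 1"] conjI allI impI)
    show "0 \<le> Max (insert 0 (abs ` fset S)) + 1"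
      using Max_ge[of "insert 0 (abs ` fset S)" 0] by simp
    fix j assume *: "Max (insert 0 (abs ` fset S)) + 1 \<le> \<bar>j\<bar>"
    have "\<bar>j\<bar> \<le> Max (insert 0 (abs ` fset S))" if "j |\<in>| S"
      using that by (intro Max_ge) auto
    with * have "j |\<notin>| S" by linarith
    then show "fermion_annihilate j (ket S) = 0" by (simp add: fermion_annihilate_def)
  qed
  show "is_field psi_plus"
  proof (rule is_fieldI)
    fix S
    obtain N where "N \<ge> 0" "\<forall>j. N \<le> \<bar>j\<bar> \<longrightarrow> fermion_annihilate j (ket S) = 0"
      using bound by blast
    then show "\<exists>N. \<forall>n\<ge>N. psi_plus n (ket S) = 0"
      by (intro exI[of _ N]) (auto simp: psi_plus_def)
  qed (simp add: psi_plus_def lin)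
  show "is_field psi_minus"
  proof (rule is_fieldI)
    fix S
    obtain N where "N \<ge> 0" "\<forall>j. N \<le> \<bar>j\<bar> \<longrightarrow> fermion_annihilate j (ket S) = 0"
      using bound by blast
    then show "\<exists>N. \<forall>n\<ge>N. psi_minus n (ket S) = 0"
      by (intro exI[of _ N]) (auto simp: psi_minus_def)
  qed (simp add: psi_minus_def lin)
qed

lemma is_field_deriv:
  assumes "is_field a"
  shows "is_field (deriv_modes a)"
  unfolding is_field_def
proof (intro conjI allI)
  fix n
  have "clinear (a (n - 1))" using assms by (simp add: is_field_def)
  then show "clinear (deriv_modes a n)"
    unfolding deriv_modes_def[abs_def]
    by (simp add: Vector_Spaces.linear_def module_hom_def module_hom_axioms_def
        cvs.scale_right_distrib mult.commute)
next
  fix v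
  obtain N where "\<forall>n\<ge>N. a n v = 0" using assms unfolding is_field_def by blast
  then show "\<exists>N. \<forall>n\<ge>N. deriv_modes a n v = 0"
    by (intro exI[of _ "N + 1"]) (simp add: deriv_modes_def)
qed


section \<open>The lattice vertex superalgebra of \<open>\<int>\<beta>\<close>, \<open>\<langle>\<beta>, \<beta>\<rangle> = -1\<close>\<close>

text \<open>
  The space is \<open>S(\<beta>(-1), \<beta>(-2), \<dots>) \<otimes> \<complex>[\<int>\<beta>]\<close>, where \<open>(p, M)\<close> stands for the basis vector
  \<open>(\<Prod>k\<in>#M. \<beta>(-k-1)) e\<^sup>p\<^sup>\<beta>\<close>.
\<close>

type_synonym lattice_basis = "int \<times> nat multiset"
type_synonym lattice_space = "lattice_basis \<Rightarrow>\<^sub>0 complex"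

text \<open>The modes \<open>\<beta>(n)\<close>; for \<open>n \<ge> 0\<close> they act as \<open>\<langle>\<beta>, p\<beta>\<rangle> = -p\<close> resp. \<open>-n \<partial>/\<partial>\<beta>(-n)\<close>.\<close>

definition heis :: "lattice_basis modes"
  where "heis n = lin_ext (\<lambda>(p, M).
    if n < 0 then ket (p, add_mset (nat (- n) - 1) M)
    else if n = 0 then cscale (- of_int p) (ket (p, M))
    else cscale (- of_int n * of_nat (count M (nat n - 1))) (ket (p, M - {#nat n - 1#})))"

text \<open>The coefficient of \<open>x\<^sup>k\<close> in \<open>exp (\<Sum>j\<ge>1. A j x\<^sup>j)\<close> for commuting operators \<open>A j\<close>.\<close>

definition exp_coeff ::
    "(nat \<Rightarrow> ('a \<Rightarrow>\<^sub>0 complex) \<Rightarrow> ('a \<Rightarrow>\<^sub>0 complex)) \<Rightarrow> nat \<Rightarrow> ('a \<Rightarrow>\<^sub>0 complex) \<Rightarrow> ('a \<Rightarrow>\<^sub>0 complex)"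
  where "exp_coeff A k v =
    (\<Sum>js | sum_list js = k \<and> 0 \<notin> set js. cscale (1 / fact (length js)) (foldr A js v))"

text \<open>
  The mode \<open>e\<^sup>m\<^sup>\<beta>\<^sub>n\<close>, i.e. the coefficient of \<open>z\<^sup>-\<^sup>n\<^sup>-\<^sup>1\<close> in
  \<open>Y(e\<^sup>m\<^sup>\<beta>, z) = exp (\<Sum>k\<ge>1. m \<beta>(-k)/k z\<^sup>k) exp (- \<Sum>k\<ge>1. m \<beta>(k)/k z\<^sup>-\<^sup>k) e\<^sup>m\<^sup>\<beta> z\<^sup>m\<^sup>\<beta>\<^sup>(\<^sup>0\<^sup>)\<close>,
  where \<open>e\<^sup>m\<^sup>\<beta>\<close> shifts the charge without a sign (trivial cocycle) and
  \<open>z\<^sup>m\<^sup>\<beta>\<^sup>(\<^sup>0\<^sup>)\<close> acts on charge \<open>p\<close> as \<open>z\<^sup>-\<^sup>m\<^sup>p\<close>.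
\<close>

definition vertex_coeff :: "int \<Rightarrow> nat \<Rightarrow> nat \<Rightarrow> lattice_space \<Rightarrow> lattice_space"
  where "vertex_coeff m a b v =
    exp_coeff (\<lambda>k u. cscale (of_int m / of_nat k) (heis (- int k) u)) a
      (exp_coeff (\<lambda>k u. cscale (- of_int m / of_nat k) (heis (int k) u)) b v)"

definition lattice_mode :: "int \<Rightarrow> lattice_basis modes"
  where "lattice_mode m n = lin_ext (\<lambda>(p, M). Sum_any (\<lambda>(a, b).
    if int a - int b - m * p = - n - 1 then vertex_coeff m a b (ket (p + m, M)) else 0))"

lemma clinear_heis: "clinear (heis n)"
  by (simp add: heis_def linear_lin_ext)

lemma heis_ket:
  "heis n (ket (p, M)) =
    (if n < 0 then ket (p, add_mset (nat (- n) - 1) M)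
     else if n = 0 then cscale (- of_int p) (ket (p, M))
     else cscale (- of_int n * of_nat (count M (nat n - 1))) (ket (p, M - {#nat n - 1#})))"
  by (simp add: heis_def)

lemma heis_commutator:
  "heis m (heis n v) - heis n (heis m v) = (if m + n = 0 then cscale (- of_int m) v else 0)"
proof -
  note lin = clinear_heis
  have pos: "heis (int (Suc i)) (ket (p, M))
      = cscale (- of_nat (Suc i) * of_nat (count M i)) (ket (p, M - {#i#}))" for i p M
    by (simp add: heis_ket del: of_nat_Suc)
  have neg: "heis (- int (Suc i)) (ket (p, M)) = ket (p, add_mset i M)" for i p M
    by (simp add: heis_ket nat_add_distrib)
  have pos_neg: "heis (int (Suc i)) (heis (- int (Suc j)) (ket (p, M)))
      - heis (- int (Suc j)) (heis (int (Suc i)) (ket (p, M)))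
      = (if i = j then cscale (- of_nat (Suc i)) (ket (p, M)) else 0)" for i j p M
  proof -
    have *: "count M i = 0 \<or> add_mset j M - {#i#} = add_mset j (M - {#i#})"
      by (cases "i \<in># M") (simp_all add: not_in_iff)
    have "heis (int (Suc i)) (heis (- int (Suc j)) (ket (p, M)))
        - heis (- int (Suc j)) (heis (int (Suc i)) (ket (p, M)))
      = cscale (- of_nat (Suc i) * of_nat (count (add_mset j M) i)) (ket (p, add_mset j M - {#i#}))
        - cscale (- of_nat (Suc i) * of_nat (count M i)) (ket (p, add_mset j (M - {#i#})))"
      unfolding pos neg clinear_cscale[OF lin] ..
    also have "\<dots> = (if i = j then cscale (- of_nat (Suc i)) (ket (p, M)) else 0)"
    proof (cases "i = j")
      case True
      show ?thesis
      proof (cases "count M i = 0")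
        case True
        with \<open>i = j\<close> show ?thesis by simp
      next
        case False
        with True have "add_mset j (M - {#i#}) = M" by (simp add: count_eq_zero_iff)
        then show ?thesis using True
          by (simp add: algebra_simps flip: cvs.scale_left_diff_distrib)
      qed
    next
      case False
      then show ?thesis using * by auto
    qed
    finally show ?thesis .
  qed
  have pos_pos: "heis (int (Suc i)) (heis (int (Suc j)) (ket (p, M)))
      = heis (int (Suc j)) (heis (int (Suc i)) (ket (p, M)))" for i j p M
    unfolding pos clinear_cscale[OF lin] by (cases "i = j") (simp_all add: add_mset_commute mult_ac)
  have neg_neg: "heis (- int (Suc i)) (heis (- int (Suc j)) (ket (p, M)))
      = heis (- int (Suc j)) (heis (- int (Suc i)) (ket (p, M)))" for i j p M
    unfolding neg by (simp add: add_mset_commute)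
  have zero: "heis 0 (heis k (ket (p, M))) = heis k (heis 0 (ket (p, M)))" for k p M
    by (cases "k = 0"; cases "k < 0") (simp_all add: heis_ket clinear_cscale[OF lin] mult_ac del: cvs.scale_minus_left)
  have cases: "k = 0 \<or> (\<exists>i. k = int (Suc i)) \<or> (\<exists>i. k = - int (Suc i))" for k
    by (cases k rule: int_cases3) (auto dest: gr0_implies_Suc)
  have "heis m (heis n (ket a)) - heis n (heis m (ket a))
      = (if m + n = 0 then cscale (- of_int m) (ket a) else 0)" for a
  proof -
    obtain p M where a: "a = (p, M)" by force
    consider "m = 0" | "n = 0" | i j where "m = int (Suc i)" "n = int (Suc j)"
      | i j where "m = int (Suc i)" "n = - int (Suc j)" | i j where "m = - int (Suc i)" "n = int (Suc j)"
      | i j where "m = - int (Suc i)" "n = - int (Suc j)"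
      using cases[of m] cases[of n] by blast
    then show ?thesis
    proof cases
      case 1
      then show ?thesis using zero[of n p M] a by simp
    next
      case 2
      then show ?thesis using zero[of m p M] a by simp
    next
      case (3 i j)
      moreover have "heis m (heis n (ket a)) = heis n (heis m (ket a))"
        using pos_pos[of i j p M] unfolding a 3 .
      ultimately show ?thesis by simp
    next
      case (4 i j)
      have "m + n = 0 \<longleftrightarrow> i = j" "(of_int m :: complex) = of_nat (Suc i)"
        using 4 by linarith (simp only: 4 of_int_minus of_int_of_nat_eq)
      moreover have "heis m (heis n (ket a)) - heis n (heis m (ket a))
        = (if i = j then cscale (- of_nat (Suc i)) (ket a) else 0)"
        using pos_neg[of i j p M] unfolding a 4 .
      ultimately show ?thesis by (simp del: of_nat_Suc)
    next
      case (5 i j)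
      have "heis n (heis m (ket a)) - heis m (heis n (ket a))
        = (if j = i then cscale (- of_nat (Suc j)) (ket a) else 0)"
        using pos_neg[of j i p M] unfolding a 5 .
      then have eq: "heis m (heis n (ket a)) - heis n (heis m (ket a))
        = - (if j = i then cscale (- of_nat (Suc j)) (ket a) else 0)"
        by (simp only: flip: minus_diff_eq[of "heis n (heis m (ket a))"])
      have "m + n = 0 \<longleftrightarrow> j = i" "(of_int m :: complex) = - of_nat (Suc i)"
        using 5 by linarith (simp only: 5 of_int_minus of_int_of_nat_eq)
      with eq show ?thesis by (simp del: of_nat_Suc)
    next
      case (6 i j)
      moreover have "heis m (heis n (ket a)) = heis n (heis m (ket a))"
        using neg_neg[of i j p M] unfolding a 6 .
      ultimately show ?thesis by simp
    qed
  qed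
  moreover have "clinear (\<lambda>v. heis m (heis n v) - heis n (heis m v))"
    by (rule clinearI) (simp_all add: clinear_add[OF lin] clinear_cscale[OF lin]
        cvs.scale_right_diff_distrib)
  moreover have "clinear (\<lambda>v. if m + n = 0 then cscale (- of_int m) v else 0)"
    by (rule clinearI) (simp_all add: cvs.scale_right_distrib cvs.scale_right_diff_distrib mult.commute)
  ultimately show ?thesis
    using clinear_ext[of "\<lambda>v. heis m (heis n v) - heis n (heis m v)"
        "\<lambda>v. if m + n = 0 then cscale (- of_int m) v else 0"] by blast
qed

lemma is_field_heis: "is_field heis"
proof (rule is_fieldI)
  fix a :: lattice_basis
  obtain p M where a: "a = (p, M)" by force
  have "heis n (ket a) = 0" if "n \<ge> int (Max (insert 0 (set_mset M))) + 2" for n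
  proof -
    have "count M (nat n - 1) = 0"
    proof (rule ccontr)
      assume "count M (nat n - 1) \<noteq> 0"
      then have "nat n - 1 \<le> Max (insert 0 (set_mset M))"
        by (intro Max_ge) (auto simp: count_eq_zero_iff)
      then show False using that by linarith
    qed
    then show ?thesis using that by (simp add: a heis_ket)
  qed
  then show "\<exists>N. \<forall>n\<ge>N. heis n (ket a) = 0" by blast
qed (rule clinear_heis)

lemma finite_compositions: "finite {js. sum_list js = (k::nat) \<and> 0 \<notin> set js}"
proof (rule finite_subset)
  have "length js \<le> sum_list js" if "0 \<notin> set js" for js :: "nat list"
    using that by (induction js) (auto simp: neq0_conv intro: Suc_leI add_mono[of 1, simplified])
  then show "{js. sum_list js = k \<and> 0 \<notin> set js} \<subseteq> {js. set js \<subseteq> {..k} \<and> length js \<le> k}"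
    using member_le_sum_list by fastforce
qed (simp add: finite_lists_length_le)

lemma exp_coeff_0 [simp]: "exp_coeff A 0 v = v"
proof -
  have "{js. sum_list js = (0::nat) \<and> 0 \<notin> set js} = {[]}"
    by (auto simp: sum_list_eq_0_iff) (metis list.set_sel(1))
  then show ?thesis by (simp add: exp_coeff_def)
qed

lemma exp_coeff_zero [simp]:
  assumes "\<And>j. clinear (A j)"
  shows "exp_coeff A k 0 = 0"
proof -
  have "foldr A js 0 = 0" for js by (induction js) (simp_all add: assms)
  then show ?thesis by (simp add: exp_coeff_def)
qed

definition lattice_weight :: "lattice_basis \<Rightarrow> nat"
  where "lattice_weight a = (\<Sum>k\<in>#snd a. k + 1)"

lemma heis_lowers_weight:
  assumes "k > 0" "\<forall>a\<in>Poly_Mapping.keys v. int (lattice_weight a) \<le> w"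
    "b \<in> Poly_Mapping.keys (heis k v)"
  shows "int (lattice_weight b) \<le> w - k"
proof -
  from assms(3) obtain a where a: "a \<in> Poly_Mapping.keys v" "b \<in> Poly_Mapping.keys (heis k (ket a))"
    unfolding heis_def by (elim keys_lin_ext) simp
  obtain p M where pM: "a = (p, M)" by force
  have "b = (p, M - {#nat k - 1#})" "count M (nat k - 1) \<noteq> 0"
    using a(2) assms(1) by (auto simp: pM heis_ket in_keys_iff lookup_ket split: if_splits)
  moreover from this obtain N where "M = add_mset (nat k - 1) N"
    by (metis count_eq_zero_iff multi_member_split)
  ultimately have "int (lattice_weight a) = int (lattice_weight b) + k"
    using assms(1) by (simp add: lattice_weight_def pM)
  then show ?thesis using assms(2) a(1) by force
qed

lemma exp_coeff_annihilates:
  assumes "\<forall>a\<in>Poly_Mapping.keys v. lattice_weight a < b"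
  shows "exp_coeff (\<lambda>k v. cscale (c k) (heis (int k) v)) b v = 0"
proof -
  obtain w where w: "\<forall>a\<in>Poly_Mapping.keys v. int (lattice_weight a) \<le> w" "w < int b"
    using assms by (intro that[of "int b - 1"]) auto
  have *: "\<forall>a\<in>Poly_Mapping.keys (foldr (\<lambda>k v. cscale (c k) (heis (int k) v)) js v).
      int (lattice_weight a) \<le> w - int (sum_list js)" if "0 \<notin> set js" for js
    using that
  proof (induction js)
    case Nil
    then show ?case using w by simp
  next
    case (Cons j js)
    let ?u = "foldr (\<lambda>k v. cscale (c k) (heis (int k) v)) js v"
    have "a \<in> Poly_Mapping.keys (heis (int j) ?u)"
      if "a \<in> Poly_Mapping.keys (cscale (c j) (heis (int j) ?u))" for a
      using that by (simp add: in_keys_iff)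
    then show ?case
      using heis_lowers_weight[of "int j" ?u "w - int (sum_list js)"] Cons by fastforce
  qed
  have "foldr (\<lambda>k v. cscale (c k) (heis (int k) v)) js v = 0"
    if "0 \<notin> set js" "sum_list js = b" for js
  proof -
    have "Poly_Mapping.keys (foldr (\<lambda>k v. cscale (c k) (heis (int k) v)) js v) = {}"
      using *[OF that(1)] w(2) that(2) by fastforce
    then show ?thesis by simp
  qed
  then show ?thesis by (simp add: exp_coeff_def)
qed

lemma vertex_coeff_eq_0:
  assumes "b > lattice_weight (p, M)"
  shows "vertex_coeff m a b (ket (p + m, M)) = 0"
proof -
  have lin: "clinear (\<lambda>v. cscale (of_int m / of_nat k) (heis (- int k) v))" for k
    by (rule clinearI) (simp_all add: clinear_add[OF clinear_heis] clinear_cscale[OF clinear_heis]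
        cvs.scale_right_distrib mult.commute)
  have *: "\<forall>x\<in>Poly_Mapping.keys (ket (p + m, M)). lattice_weight x < b"
    using assms by (simp add: ket_def lattice_weight_def)
  show ?thesis
    unfolding vertex_coeff_def exp_coeff_annihilates[OF *] by (rule exp_coeff_zero[OF lin])
qed

text \<open>The sum in \<^const>\<open>lattice_mode\<close> is finite.\<close>

lemma finite_lattice_mode:
  "finite {(a, b). (if int a - int b - m * p = - n - 1
      then vertex_coeff m a b (ket (p + m, M)) else 0) \<noteq> 0}" (is "finite ?A")
proof (rule finite_subset)
  show "?A \<subseteq> (\<lambda>b. (nat (int b + m * p - n - 1), b)) ` {..lattice_weight (p, M)}"
  proof clarify
    fix a b
    assume *: "(if int a - int b - m * p = - n - 1
      then vertex_coeff m a b (ket (p + m, M)) else 0) \<noteq> 0"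
    then have "int a - int b - m * p = - n - 1" "\<not> b > lattice_weight (p, M)"
      using vertex_coeff_eq_0 by (auto split: if_splits)
    then show "(a, b) \<in> (\<lambda>b. (nat (int b + m * p - n - 1), b)) ` {..lattice_weight (p, M)}"
      by (intro image_eqI[of _ _ b]) auto
  qed
qed simp

lemma lattice_mode_eq_0:
  assumes "n \<ge> m * p + int (lattice_weight (p, M))"
  shows "lattice_mode m n (ket (p, M)) = 0"
proof -
  have "(if int a - int b - m * p = - n - 1
      then vertex_coeff m a b (ket (p + m, M)) else 0) = 0" for a b
    using assms vertex_coeff_eq_0[of p M b m a] by auto
  then show ?thesis
    unfolding lattice_mode_def lin_ext_ket prod.case by simp
qed

lemma is_field_lattice_mode: "is_field (lattice_mode m)"
proof (rule is_fieldI)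
  fix x :: lattice_basis
  obtain p M where "x = (p, M)" by force
  then show "\<exists>N. \<forall>n\<ge>N. lattice_mode m n (ket x) = 0" using lattice_mode_eq_0 by blast
qed (simp add: lattice_mode_def linear_lin_ext)

text \<open>\<open>Y(e\<^sup>m\<^sup>\<beta>, z) e\<^sup>n\<^sup>\<beta> = z\<^sup>-\<^sup>m\<^sup>n (e\<^sup>(\<^sup>m\<^sup>+\<^sup>n\<^sup>)\<^sup>\<beta> + O(z))\<close>.\<close>

lemma lattice_mode_leading:
  "k \<ge> m * n \<Longrightarrow> lattice_mode m k (ket (n, {#})) = 0"
  "lattice_mode m (m * n - 1) (ket (n, {#})) = ket (m + n, {#})"
proof -
  have wt: "lattice_weight (n, {#}) = 0" by (simp add: lattice_weight_def)
  show "lattice_mode m k (ket (n, {#})) = 0" if "k \<ge> m * n"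
    using lattice_mode_eq_0[of m n "{#}" k] that by (simp add: wt)
  define f where "f = (\<lambda>(a, b). if int a - int b - m * n = - (m * n - 1) - 1
    then vertex_coeff m a b (ket (n + m, {#})) else 0)"
  have "f (a, b) = 0" if "(a, b) \<noteq> (0, 0)" for a b
    using that vertex_coeff_eq_0[of n "{#}" b m a] by (auto simp: wt f_def)
  then have "{x. f x \<noteq> 0} \<subseteq> {(0, 0)}" by (metis (mono_tags) mem_Collect_eq singletonI subsetI surj_pair)
  then have "Sum_any f = sum f {(0, 0)}" by (intro Sum_any.expand_superset) simp_all
  also have "\<dots> = ket (m + n, {#})"
    by (simp add: f_def vertex_coeff_def add.commute[of n m])
  finally show "lattice_mode m (m * n - 1) (ket (n, {#})) = ket (m + n, {#})"
    unfolding lattice_mode_def lin_ext_ket prod.case f_def .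
qed


section \<open>The vertex algebra \<open>\<Pi>(0)\<close>\<close>

type_synonym space_basis = "int fset \<times> lattice_basis"
type_synonym space = "space_basis \<Rightarrow>\<^sub>0 complex"

definition H_zero :: "space \<Rightarrow> space"
  where "H_zero v = tensor_op fock_charge id v + tensor_op id (heis 0) v"

definition Pi_zero :: "space set"
  where "Pi_zero = {v. H_zero v = 0}"

text \<open>\<open>L(n)\<close> is the mode \<open>\<omega>\<^sub>n\<^sub>+\<^sub>1\<close> of \<open>\<omega> = \<omega>\<^sup>(\<^sup>f\<^sup>) \<otimes> 1 - 1/2 (1 \<otimes> \<beta>(-1)\<^sup>2 1)\<close>.\<close>

definition virasoro :: "int \<Rightarrow> space \<Rightarrow> space"
  where "virasoro n v = tensor_op (fock_omega (n + 1)) id v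
    - cscale (1/2) (tensor_op id (normal_product 1 heis heis (n + 1)) v)"


section \<open>The Lie algebra \<open>\<gg>^ \<oplus> \<complex>L(0)\<close> for \<open>\<gg> = sl\<^sub>2\<close>\<close>

datatype sl2_basis = Sl2_e | Sl2_f | Sl2_h

fun sl2_bracket :: "sl2_basis \<Rightarrow> sl2_basis \<Rightarrow> (sl2_basis \<Rightarrow>\<^sub>0 complex)" where
  "sl2_bracket Sl2_h Sl2_e = cscale 2 (ket Sl2_e)"
| "sl2_bracket Sl2_e Sl2_h = cscale (- 2) (ket Sl2_e)"
| "sl2_bracket Sl2_h Sl2_f = cscale (- 2) (ket Sl2_f)"
| "sl2_bracket Sl2_f Sl2_h = cscale 2 (ket Sl2_f)"
| "sl2_bracket Sl2_e Sl2_f = ket Sl2_h"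
| "sl2_bracket Sl2_f Sl2_e = cscale (- 1) (ket Sl2_h)"
| "sl2_bracket _ _ = 0"

fun sl2_form :: "sl2_basis \<Rightarrow> sl2_basis \<Rightarrow> complex" where
  "sl2_form Sl2_e Sl2_f = 1"
| "sl2_form Sl2_f Sl2_e = 1"
| "sl2_form Sl2_h Sl2_h = 2"
| "sl2_form _ _ = 0"

text \<open>\<open>Loop x n\<close> is \<open>x(n) = x \<otimes> t\<^sup>n\<close>, \<open>Central\<close> is \<open>c\<close> and \<open>Energy\<close> is \<open>L(0)\<close>.\<close>

datatype aff_basis = Loop sl2_basis int | Central | Energy

type_synonym aff = "aff_basis \<Rightarrow>\<^sub>0 complex"

fun aff_basis_bracket :: "aff_basis \<Rightarrow> aff_basis \<Rightarrow> aff" where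
  "aff_basis_bracket (Loop x m) (Loop y n) =
    lin_ext (\<lambda>z. ket (Loop z (m + n))) (sl2_bracket x y)
    + (if m + n = 0 then cscale (of_int m * sl2_form x y) (ket Central) else 0)"
| "aff_basis_bracket Energy (Loop x n) = cscale (- of_int n) (ket (Loop x n))"
| "aff_basis_bracket (Loop x n) Energy = cscale (of_int n) (ket (Loop x n))"
| "aff_basis_bracket _ _ = 0"

definition aff_bracket :: "aff \<Rightarrow> aff \<Rightarrow> aff"
  where "aff_bracket u w = lin_ext (\<lambda>x. lin_ext (\<lambda>y. aff_basis_bracket x y) w) u"


section \<open>Modules\<close>

text \<open>A module is given by a subspace \<open>V\<close> and the action \<open>\<rho> u v\<close> of \<open>u\<close> on \<open>v \<in> V\<close>.\<close>

type_synonym 'b aff_action = "aff \<Rightarrow> ('b \<Rightarrow>\<^sub>0 complex) \<Rightarrow> ('b \<Rightarrow>\<^sub>0 complex)"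

definition aff_module :: "('b \<Rightarrow>\<^sub>0 complex) set \<Rightarrow> 'b aff_action \<Rightarrow> bool"
  where "aff_module V \<rho> \<longleftrightarrow>
    cvs.subspace V \<and>
    (\<forall>u. \<forall>v\<in>V. \<rho> u v \<in> V) \<and>
    (\<forall>u w. \<forall>v\<in>V. \<rho> (u + w) v = \<rho> u v + \<rho> w v) \<and>
    (\<forall>c u. \<forall>v\<in>V. \<rho> (cscale c u) v = cscale c (\<rho> u v)) \<and>
    (\<forall>u. \<forall>v\<in>V. \<forall>v'\<in>V. \<rho> u (v + v') = \<rho> u v + \<rho> u v') \<and>
    (\<forall>c u. \<forall>v\<in>V. \<rho> u (cscale c v) = cscale c (\<rho> u v)) \<and>
    (\<forall>u w. \<forall>v\<in>V. \<rho> (aff_bracket u w) v = \<rho> u (\<rho> w v) - \<rho> w (\<rho> u v))"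

definition irreducible_aff_module :: "('b \<Rightarrow>\<^sub>0 complex) set \<Rightarrow> 'b aff_action \<Rightarrow> bool"
  where "irreducible_aff_module V \<rho> \<longleftrightarrow>
    aff_module V \<rho> \<and> V \<noteq> {0} \<and>
    (\<forall>W. cvs.subspace W \<and> W \<subseteq> V \<and> (\<forall>u. \<forall>w\<in>W. \<rho> u w \<in> W) \<longrightarrow> W = {0} \<or> W = V)"

definition energy_space ::
    "('b \<Rightarrow>\<^sub>0 complex) set \<Rightarrow> 'b aff_action \<Rightarrow> complex \<Rightarrow> ('b \<Rightarrow>\<^sub>0 complex) set"
  where "energy_space V \<rho> s = {v \<in> V. \<rho> (ket Energy) v = cscale s v}"

text \<open>The sum of the eigenspaces is automatically direct.\<close>

definition nonneg_graded :: "('b \<Rightarrow>\<^sub>0 complex) set \<Rightarrow> 'b aff_action \<Rightarrow> bool"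
  where "nonneg_graded V \<rho> \<longleftrightarrow>
    V = cvs.span (\<Union>n::nat. energy_space V \<rho> (of_nat n)) \<and>
    (\<forall>x m s. \<forall>v \<in> energy_space V \<rho> s. \<rho> (ket (Loop x m)) v \<in> energy_space V \<rho> (s - of_int m))"

definition weight_space ::
    "('b \<Rightarrow>\<^sub>0 complex) set \<Rightarrow> 'b aff_action \<Rightarrow> nat \<Rightarrow> complex \<Rightarrow> ('b \<Rightarrow>\<^sub>0 complex) set"
  where "weight_space V \<rho> n \<nu> =
    {v \<in> energy_space V \<rho> (of_nat n). \<rho> (ket (Loop Sl2_h 0)) v = cscale \<nu> v}"

text \<open>
  The trace of \<open>q\<^sup>L\<^sup>(\<^sup>0\<^sup>) z\<^sup>h\<^sup>(\<^sup>0\<^sup>)\<close> makes sense if \<open>L(0)\<close> and \<open>h(0)\<close> are simultaneously diagonalizable with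
  finite-dimensional joint eigenspaces.  It is the formal series whose coefficient of
  \<open>q\<^sup>n z\<^sup>\<nu>\<close>, with \<open>n \<in> \<nat>\<close> and \<open>\<nu> \<in> \<complex>\<close>, is the dimension of the joint eigenspace.
\<close>

definition has_character :: "('b \<Rightarrow>\<^sub>0 complex) set \<Rightarrow> 'b aff_action \<Rightarrow> bool"
  where "has_character V \<rho> \<longleftrightarrow>
    V = cvs.span (\<Union>n \<nu>. weight_space V \<rho> n \<nu>) \<and>
    (\<forall>n \<nu>. \<exists>B. finite B \<and> weight_space V \<rho> n \<nu> \<subseteq> cvs.span B)"

type_synonym qz_series = "nat \<Rightarrow> complex \<Rightarrow> complex"

definition trace_character :: "('b \<Rightarrow>\<^sub>0 complex) set \<Rightarrow> 'b aff_action \<Rightarrow> qz_series"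
  where "trace_character V \<rho> n \<nu> = of_nat (cvs.dim (weight_space V \<rho> n \<nu>))"


section \<open>The module \<open>E\<^bsub>\<lambda>,\<mu>\<^esub>\<close>\<close>

text \<open>Recall that \<open>\<Psi>\<^sup>\<plusminus>(i - 1/2) = \<Psi>\<^sup>\<plusminus>\<^sub>i\<^sub>-\<^sub>1\<close>.\<close>

fun E_basis_action :: "complex \<Rightarrow> complex \<Rightarrow> aff_basis \<Rightarrow> space \<Rightarrow> space" where
  "E_basis_action lam mu (Loop Sl2_e m) v = Sum_any (\<lambda>i.
    cscale (lam - of_int i) (tensor_op (psi_plus (i - 1)) (lattice_mode 1 (m - i - 1)) v))"
| "E_basis_action lam mu (Loop Sl2_f m) v = Sum_any (\<lambda>i.
    cscale (mu - of_int i) (tensor_op (psi_minus (i - 1)) (lattice_mode (- 1) (m - i - 1)) v))"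
| "E_basis_action lam mu (Loop Sl2_h m) v =
    cscale (- 2) (tensor_op id (heis m) v) + (if m = 0 then cscale (lam - mu) v else 0)"
| "E_basis_action lam mu Central v = cscale (- 2) v"
| "E_basis_action lam mu Energy v = virasoro 0 v"

definition E_action :: "complex \<Rightarrow> complex \<Rightarrow> space_basis aff_action"
  where "E_action lam mu u v =
    (\<Sum>x\<in>Poly_Mapping.keys u. cscale (Poly_Mapping.lookup u x) (E_basis_action lam mu x v))"

lemma finite_tensor_modes:
  assumes "is_field a" "is_field b"
  shows "finite {i::int. cscale (c i) (tensor_op (a (i - 1)) (b (m - i - 1)) v) \<noteq> 0}"
proof -
  have ket: "finite {i. tensor_op (a (i - 1)) (b (m - i - 1)) (ket x) \<noteq> 0}" for x
  proof -
    obtain s t where x: "x = (s, t)" by force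
    obtain N M where N: "\<And>n. n \<ge> N \<Longrightarrow> a n (ket s) = 0" and M: "\<And>n. n \<ge> M \<Longrightarrow> b n (ket t) = 0"
      using assms unfolding is_field_def by meson
    have "tensor 0 y = 0" "tensor y' 0 = 0" for y :: "'b \<Rightarrow>\<^sub>0 complex" and y' :: "'a \<Rightarrow>\<^sub>0 complex"
      by (simp_all add: tensor_def lin_ext_def)
    then show ?thesis
      by (intro finite_int_bounded[of "N + 1" _ "m - M - 1"]) (simp_all add: x tensor_op_def N M)
  qed
  have "{i. cscale (c i) (tensor_op (a (i - 1)) (b (m - i - 1)) v) \<noteq> 0}
      \<subseteq> (\<Union>x\<in>Poly_Mapping.keys v. {i. tensor_op (a (i - 1)) (b (m - i - 1)) (ket x) \<noteq> 0})"
  proof clarify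
    fix i
    assume *: "cscale (c i) (tensor_op (a (i - 1)) (b (m - i - 1)) v) \<noteq> 0"
    have "tensor_op (a (i - 1)) (b (m - i - 1)) v = (\<Sum>x\<in>Poly_Mapping.keys v.
        cscale (Poly_Mapping.lookup v x) (tensor_op (a (i - 1)) (b (m - i - 1)) (ket x)))"
      by (simp add: tensor_op_def lin_ext_def[of _ v])
    with * show "i \<in> (\<Union>x\<in>Poly_Mapping.keys v. {i. tensor_op (a (i - 1)) (b (m - i - 1)) (ket x) \<noteq> 0})"
      by (auto intro: ccontr)
  qed
  then show ?thesis by (rule finite_subset) (simp add: ket)
qed

text \<open>The sums defining \<open>e(m)\<close> and \<open>f(m)\<close> are finite on every vector.\<close>

lemma finite_E_basis_action:
  "finite {i. cscale (lam - of_int i)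
    (tensor_op (psi_plus (i - 1)) (lattice_mode 1 (m - i - 1)) v) \<noteq> 0}"
  "finite {i. cscale (mu - of_int i)
    (tensor_op (psi_minus (i - 1)) (lattice_mode (- 1) (m - i - 1)) v) \<noteq> 0}"
  by (intro finite_tensor_modes is_field_psi is_field_lattice_mode)+


section \<open>Formal series in \<open>q\<close> and \<open>z\<close>\<close>

text \<open>
  The infinite products are power series in \<open>q\<close> over the ring \<open>\<complex>[z, z\<^sup>-\<^sup>1]\<close>; a series with
  constant term \<open>1\<close> is inverted as a power series in \<open>q\<close>.
\<close>

type_synonym laurent = "int \<Rightarrow>\<^sub>0 complex"

definition z_pow :: "int \<Rightarrow> laurent"
  where "z_pow k = Poly_Mapping.single k 1"

definition q_pow :: "nat \<Rightarrow> laurent fps"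
  where "q_pow n = fps_X ^ n"

definition q_inverse :: "laurent fps \<Rightarrow> laurent fps"
  where "q_inverse A = fps_right_inverse A 1"

definition delta_z2 :: qz_series
  where "delta_z2 n \<nu> = (if n = 0 \<and> (\<exists>k::int. \<nu> = of_int (2 * k)) then 1 else 0)"

definition qz_mult :: "laurent fps \<Rightarrow> qz_series \<Rightarrow> qz_series"
  where "qz_mult A D n \<nu> =
    (\<Sum>k\<le>n. \<Sum>j\<in>Poly_Mapping.keys (fps_nth A k).
      Poly_Mapping.lookup (fps_nth A k) j * D (n - k) (\<nu> - of_int j))"

text \<open>Multiplication by \<open>z\<^sup>a\<close> for \<open>a \<in> \<complex>\<close>.\<close>

definition z_shift :: "complex \<Rightarrow> qz_series \<Rightarrow> qz_series"
  where "z_shift a D n \<nu> = D n (\<nu> - a)"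

lemma q_inverse:
  assumes "fps_nth A 0 = 1"
  shows "A * q_inverse A = 1"
  using assms unfolding q_inverse_def by (intro fps_right_inverse) simp

lemma convergent_prod_q_pow:
  fixes B :: "nat \<Rightarrow> laurent fps"
  assumes "\<And>n. \<exists>G. B n = 1 + q_pow (Suc n) * G"
  shows "convergent_prod B"
proof -
  obtain G where G: "\<And>n. B n = 1 + q_pow (Suc n) * G n" using assms by metis
  have B_mult: "fps_nth (A * B n) k = fps_nth A k" if "k \<le> n" for A n k
  proof -
    have "A * B n = A + fps_X ^ Suc n * (A * G n)"
      unfolding G q_pow_def by (simp only: distrib_left mult_1_right mult.left_commute)
    then show ?thesis using that by (simp add: fps_X_power_mult_nth del: power_Suc)
  qed
  have stable: "fps_nth (\<Prod>i\<le>n. B i) k = fps_nth (\<Prod>i\<le>k. B i) k" if "k \<le> n" for n k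
    using that
  proof (induction n rule: dec_induct)
    case (step n)
    have "fps_nth (\<Prod>i\<le>Suc n. B i) k = fps_nth ((\<Prod>i\<le>n. B i) * B (Suc n)) k" by simp
    also have "\<dots> = fps_nth (\<Prod>i\<le>n. B i) k" using step.hyps by (intro B_mult) simp
    finally show ?case using step.IH by simp
  qed simp
  let ?L = "Abs_fps (\<lambda>k. fps_nth (\<Prod>i\<le>k. B i) k)"
  have "(\<lambda>n. \<Prod>i\<le>n. B i) \<longlonglongrightarrow> ?L"
  proof (rule tendsto_fpsI)
    fix k
    show "\<forall>\<^sub>F n in sequentially. fps_nth (\<Prod>i\<le>n. B i) k = fps_nth ?L k"
      using eventually_ge_at_top[of k] by eventually_elim (unfold fps_nth_Abs_fps, rule stable)
  qed
  moreover have "fps_nth ?L 0 = 1" by (simp add: G q_pow_def)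
  then have "?L \<noteq> 0" by (metis fps_zero_nth zero_neq_one)
  ultimately have "raw_has_prod B 0 ?L" by (simp add: raw_has_prod_def)
  then show ?thesis unfolding convergent_prod_def by blast
qed

text \<open>The infinite products of the character formula converge in the \<open>q\<close>-adic topology.\<close>

lemma convergent_prod_character:
  "convergent_prod (\<lambda>n. q_inverse (1 - q_pow (Suc n) * fps_const c) *
    q_inverse (1 - q_pow (Suc n) * fps_const d))"
proof (rule convergent_prod_q_pow)
  fix n
  have "\<exists>G. q_inverse (1 - q_pow (Suc n) * fps_const c) = 1 + q_pow (Suc n) * G" for c
    using q_inverse[of "1 - q_pow (Suc n) * fps_const c"]
    by (intro exI[of _ "fps_const c * q_inverse (1 - q_pow (Suc n) * fps_const c)"])
      (simp add: q_pow_def algebra_simps)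
  then obtain G G' where G: "q_inverse (1 - q_pow (Suc n) * fps_const c) = 1 + q_pow (Suc n) * G"
    "q_inverse (1 - q_pow (Suc n) * fps_const d) = 1 + q_pow (Suc n) * G'"
    by metis
  show "\<exists>G. q_inverse (1 - q_pow (Suc n) * fps_const c) * q_inverse (1 - q_pow (Suc n) * fps_const d)
      = 1 + q_pow (Suc n) * G"
    unfolding G
    by (intro exI[of _ "G + G' + q_pow (Suc n) * (G * G')"]) (simp add: algebra_simps)
qed

end

theory Submission
  imports Defs
begin

text \<open>
  The vertex operators \<open>Y(e\<^sup>\<plusminus>\<^sup>\<beta>, z)\<close> are determined by their commutators with the Heisenberg modes and
  by their vacuum coefficients.  This yields \<open>{e\<^sup>\<beta>\<^sub>a, e\<^sup>-\<^sup>\<beta>\<^sub>b} = 0\<close>, that \<open>{e\<^sup>\<beta>\<^sub>a, e\<^sup>\<beta>\<^sub>b}\<close> depends only on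
  \<open>a + b\<close>, and the values of \<open>\<Sum>a. a\<^sup>k e\<^sup>\<beta>\<^sub>a e\<^sup>-\<^sup>\<beta>\<^sub>K\<^sub>-\<^sub>a\<close> for \<open>k \<le> 2\<close>; the commutators of \<open>e(m)\<close> and \<open>f(n)\<close>
  reduce to these.  A submodule is stable under the modes \<open>\<beta>(n)\<close>, so the vertex operators can be
  stripped off \<open>e(m)\<close> and \<open>f(m)\<close>; what remains are the modes \<open>(\<lambda> - n - 1) \<Psi>\<^sup>+\<^sub>n\<close> and
  \<open>(\<mu> - n - 1) \<Psi>\<^sup>-\<^sub>n\<close>, whose coefficients do not vanish, and \<open>F\<close> is irreducible under the Clifford
  algebra.  The basis vectors of charge \<open>p\<close> in \<open>F\<close> are Maya diagrams and thus correspond to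
  partitions, which makes the coefficient of \<open>q\<^sup>n\<close> in the character count pairs of partitions.
\<close>

section \<open>Linear operators\<close>

text \<open>Since <\<beta>, \<beta>> = -1, the product of Y(e^(m\<beta>), z) and Y(e^(m'\<beta>), w)
  carries the factor (z - w)^(-m m'). For opposite charges 1 and -1 this is a simple zero, so the
  two orders cancel; for equal ones it is a simple pole, whose two expansions add up to a formal
  delta function. Formal calculus in two variables is avoided: commuting with \<beta>(k) only shifts
  mode numbers, so every identity reduces to scalar identities between coefficients of (1 - x)^(-m
  m'). In [e(m), f(n)] the fermions anticommute to a scalar supported on i + j = 1, and there
  (\<lambda> - i)(\<mu> - j) is quadratic in i; hence moments up to degree 2. The simple zero kills
  moment 0, its derivative makes moment 1 a multiple of the identity, and moment 2 contributes
  \<beta>. The two infinite products in the character are different series. They agree only after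
  multiplication by delta(z^2), which absorbs every even power of z, so that only their values at z
  = 1 count.\<close>

lemma clinear_diff:
  assumes "clinear A"
  shows "A (u - v) = A u - A v"
  using clinear_add[OF assms, of "u - v" v] by simp

lemma clinear_minus:
  assumes "clinear A"
  shows "A (- v) = - A v"
  using clinear_diff[OF assms, of 0 v] assms by simp

lemma clinear_id: "clinear (\<lambda>v. v)" "clinear id"
  by (auto intro: clinearI)

lemma clinear_comp:
  assumes "clinear A" "clinear B"
  shows "clinear (\<lambda>v. A (B v))"
  by (intro clinearI) (simp_all add: assms clinear_add clinear_cscale)

lemma clinear_plus:
  assumes "clinear A" "clinear B"
  shows "clinear (\<lambda>v. A v + B v)"
  by (intro clinearI) (simp_all add: assms clinear_add clinear_cscale cvs.scale_right_distrib)

lemma clinear_sub: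
  assumes "clinear A" "clinear B"
  shows "clinear (\<lambda>v. A v - B v)"
  by (intro clinearI) (simp_all add: assms clinear_add clinear_cscale cvs.scale_right_diff_distrib)

lemma clinear_scaled:
  assumes "clinear A"
  shows "clinear (\<lambda>v. cscale c (A v))"
  by (intro clinearI) (simp_all add: assms clinear_add clinear_cscale cvs.scale_right_distrib mult.commute)

lemma clinear_zero: "clinear (\<lambda>v. 0)"
  by (intro clinearI) simp_all

lemma clinear_sum_family:
  assumes "\<And>i. i \<in> I \<Longrightarrow> clinear (A i)"
  shows "clinear (\<lambda>v. \<Sum>i\<in>I. A i v)"
  using assms
  by (intro clinearI) (simp_all add: clinear_add clinear_cscale sum.distrib cvs.scale_sum_right)

lemma clinear_Sum_any:
  assumes "clinear A" "finite {i. f i \<noteq> 0}"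
  shows "A (Sum_any f) = Sum_any (\<lambda>i. A (f i))"
proof -
  have "Sum_any (\<lambda>i. A (f i)) = (\<Sum>i | f i \<noteq> 0. A (f i))"
    using assms by (intro Sum_any.expand_superset) auto
  then show ?thesis
    by (simp add: Sum_any.expand_set clinear_sum[OF assms(1)])
qed

lemma clinear_Sum_any_family:
  assumes "\<And>i. clinear (A i)" "\<And>v. finite {i. A i v \<noteq> 0}"
  shows "clinear (\<lambda>v. Sum_any (\<lambda>i. A i v))"
proof (rule clinearI)
  show "Sum_any (\<lambda>i. A i (u + v)) = Sum_any (\<lambda>i. A i u) + Sum_any (\<lambda>i. A i v)" for u v
    using assms by (simp add: clinear_add Sum_any.distrib)
  show "Sum_any (\<lambda>i. A i (cscale c v)) = cscale c (Sum_any (\<lambda>i. A i v))" for c v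
    using clinear_Sum_any[OF clinear_scaled[OF clinear_id(1), of c] assms(2)[of v]] assms(1)
    by (simp add: clinear_cscale)
qed

lemma Sum_any_shift: "Sum_any (\<lambda>i::int. f (i + k)) = Sum_any f"
  by (rule Sum_any.reindex_cong[where l = "\<lambda>i. i + k", symmetric]) (auto intro!: bijI' exI[of _ "_ - k"])

lemma clinear_span_closed:
  assumes "clinear A" "cvs.subspace W" "\<And>a. a \<in> Poly_Mapping.keys v \<Longrightarrow> A (ket a) \<in> W"
  shows "A v \<in> W"
  unfolding clinear_eq_lin_ext[OF assms(1), of v] lin_ext_def
  by (intro cvs.subspace_sum[OF assms(2)] cvs.subspace_scale[OF assms(2)] assms(3))

text \<open>Some formulas below, \<open>lattice_mode_eq\<close> for example, hold only on vectors of
  one fixed charge, so agreement on the basis vectors that occur in v has to suffice.\<close>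

lemma clinear_eq_on_keys:
  assumes "clinear A" "clinear B" "\<And>a. a \<in> Poly_Mapping.keys v \<Longrightarrow> A (ket a) = B (ket a)"
  shows "A v = B v"
  unfolding clinear_eq_lin_ext[OF assms(1), of v] clinear_eq_lin_ext[OF assms(2), of v] lin_ext_def
  by (intro sum.cong refl) (simp add: assms(3))


section \<open>Exponentials of commuting operators\<close>

text \<open>The degree-\<open>k\<close> part of \<open>(\<Sum>j\<ge>1. A j x\<^sup>j)\<^sup>n\<close>.\<close>

primrec power_coeff ::
    "(nat \<Rightarrow> ('a \<Rightarrow>\<^sub>0 complex) \<Rightarrow> ('a \<Rightarrow>\<^sub>0 complex)) \<Rightarrow> nat \<Rightarrow> nat \<Rightarrow> ('a \<Rightarrow>\<^sub>0 complex) \<Rightarrow> ('a \<Rightarrow>\<^sub>0 complex)"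
  where
    "power_coeff A 0 k v = (if k = 0 then v else 0)"
  | "power_coeff A (Suc n) k v = (\<Sum>j=1..k. A j (power_coeff A n (k - j) v))"

lemma compositions_Suc:
  "{js :: nat list. length js = Suc n \<and> sum_list js = k \<and> 0 \<notin> set js}
    = (\<lambda>(j, js). j # js) ` (SIGMA j:{1..k}. {js. length js = n \<and> sum_list js = k - j \<and> 0 \<notin> set js})"
  (is "?L = ?R")
proof (rule set_eqI)
  fix js :: "nat list"
  show "js \<in> ?L \<longleftrightarrow> js \<in> ?R"
    by (cases js) (auto simp: image_iff)
qed

lemma finite_compositions_length:
  "finite {js. length js = n \<and> sum_list js = (k::nat) \<and> 0 \<notin> set js}"
  by (rule finite_subset[OF _ finite_compositions[of k]]) auto

text \<open>A composition of length n picks one term from each factor of the n-th power; splitting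
  off its first part is the recursion of \<open>power_coeff\<close>.\<close>

lemma power_coeff_eq:
  assumes "\<And>j. clinear (A j)"
  shows "(\<Sum>js | length js = n \<and> sum_list js = k \<and> 0 \<notin> set js. foldr A js v) = power_coeff A n k v"
proof (induction n arbitrary: k)
  case 0
  have "{js. length js = 0 \<and> sum_list js = k \<and> 0 \<notin> set js} = (if k = 0 then {[]} else {})"
    by auto
  then show ?case by (simp split: if_splits)
next
  case (Suc n)
  have "inj_on (\<lambda>(j, js). j # js) X" for X :: "(nat \<times> nat list) set"
    by (auto simp: inj_on_def)
  then have "(\<Sum>js | length js = Suc n \<and> sum_list js = k \<and> 0 \<notin> set js. foldr A js v)
    = (\<Sum>(j, js)\<in>(SIGMA j:{1..k}. {js. length js = n \<and> sum_list js = k - j \<and> 0 \<notin> set js}).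
        A j (foldr A js v))"
    unfolding compositions_Suc by (subst sum.reindex) (auto intro!: sum.cong)
  also have "\<dots> = (\<Sum>j=1..k. \<Sum>js | length js = n \<and> sum_list js = k - j \<and> 0 \<notin> set js.
      A j (foldr A js v))"
    by (subst sum.Sigma) (auto simp: finite_compositions_length)
  finally show ?case using Suc.IH by (simp flip: clinear_sum[OF assms])
qed

lemma length_le_sum_list:
  assumes "0 \<notin> set js"
  shows "length js \<le> sum_list (js :: nat list)"
  using assms by (induction js) auto

text \<open>A composition of k without zeros has at most k parts, so the exponential series may be
  cut at any N >= k. The freedom in N lets \<open>exp_coeff_recursion\<close> use one range of
  summation for all degrees k - j.\<close>

lemma exp_coeff_eq_power_coeff:
  assumes "\<And>j. clinear (A j)" "k \<le> N"
  shows "exp_coeff A k v = (\<Sum>n\<le>N. cscale (1 / fact n) (power_coeff A n k v))"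
proof -
  let ?S = "{js. sum_list js = k \<and> 0 \<notin> set js}"
  have eq: "{js \<in> ?S. length js = n} = {js. length js = n \<and> sum_list js = k \<and> 0 \<notin> set js}" for n
    by auto
  have "exp_coeff A k v
    = (\<Sum>n\<le>N. \<Sum>js\<in>{js \<in> ?S. length js = n}. cscale (1 / fact (length js)) (foldr A js v))"
    unfolding exp_coeff_def using assms(2) length_le_sum_list
    by (intro sum.group[symmetric] finite_compositions) force+
  also have "\<dots> = (\<Sum>n\<le>N. cscale (1 / fact n) (\<Sum>js\<in>{js \<in> ?S. length js = n}. foldr A js v))"
    unfolding cvs.scale_sum_right by (intro sum.cong refl) auto
  finally show ?thesis unfolding eq power_coeff_eq[OF assms(1)] .
qed

lemma sum_triangle_swap:
  fixes f :: "nat \<Rightarrow> nat \<Rightarrow> 'a :: comm_monoid_add"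
  shows "(\<Sum>j=1..k. \<Sum>i=1..k - j. f j i) = (\<Sum>i=1..k. \<Sum>j=1..k - i. f j i)"
proof -
  have "(\<Sum>j=1..k. \<Sum>i=1..k - j. f j i) = (\<Sum>j=1..k. \<Sum>i=1..k. if i + j \<le> k then f j i else 0)"
    by (intro sum.cong refl sum.mono_neutral_cong_left) auto
  also have "\<dots> = (\<Sum>i=1..k. \<Sum>j=1..k. if i + j \<le> k then f j i else 0)"
    by (rule sum.swap)
  also have "\<dots> = (\<Sum>i=1..k. \<Sum>j=1..k - i. f j i)"
    by (intro sum.cong refl sum.mono_neutral_cong_right) auto
  finally show ?thesis .
qed

context
  fixes A :: "nat \<Rightarrow> ('a \<Rightarrow>\<^sub>0 complex) \<Rightarrow> ('a \<Rightarrow>\<^sub>0 complex)"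
  assumes A_linear: "\<And>j. clinear (A j)"
    and A_commute: "\<And>i j v. i > 0 \<Longrightarrow> j > 0 \<Longrightarrow> A i (A j v) = A j (A i v)"
begin

text \<open>With S = sum of A j x^j this is x d/dx S^(n+1) = (n+1) (x dS/dx) S^n; commutativity
  moves the differentiated factor to the front.\<close>

lemma power_coeff_recursion:
  "cscale (of_nat k) (power_coeff A (Suc n) k v)
    = cscale (of_nat (Suc n)) (\<Sum>j=1..k. cscale (of_nat j) (A j (power_coeff A n (k - j) v)))"
proof (induction n arbitrary: k)
  case 0
  have "(\<Sum>j=1..k. cscale (of_nat k) (A j (if k - j = 0 then v else 0)))
    = (\<Sum>j=1..k. cscale (of_nat j) (A j (if k - j = 0 then v else 0)))"
    by (rule sum.cong) (auto simp: A_linear)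
  then show ?case by (simp add: cvs.scale_sum_right)
next
  case (Suc n)
  let ?P = "power_coeff A"
  \<comment> \<open>The Leibniz rule: k = j + (k - j) splits the weight between the first factor and
    the remaining ones, and the induction hypothesis differentiates the latter.\<close>
  have "cscale (of_nat k) (?P (Suc (Suc n)) k v)
    = (\<Sum>j=1..k. cscale (of_nat j) (A j (?P (Suc n) (k - j) v))
        + A j (cscale (of_nat (k - j)) (?P (Suc n) (k - j) v)))"
    unfolding power_coeff.simps(2)[of A "Suc n"] cvs.scale_sum_right
    by (intro sum.cong refl)
      (simp add: clinear_cscale[OF A_linear] of_nat_diff flip: cvs.scale_left_distrib
        del: power_coeff.simps)
  also have "\<dots> = (\<Sum>j=1..k. cscale (of_nat j) (A j (?P (Suc n) (k - j) v)))
    + cscale (of_nat (Suc n)) (\<Sum>j=1..k. \<Sum>i=1..k - j. cscale (of_nat i) (A j (A i (?P n (k - j - i) v))))"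
    unfolding Suc.IH
    by (simp add: sum.distrib clinear_cscale[OF A_linear] clinear_sum[OF A_linear]
        cvs.scale_sum_right del: power_coeff.simps of_nat_Suc)
  also have "(\<Sum>j=1..k. \<Sum>i=1..k - j. cscale (of_nat i) (A j (A i (?P n (k - j - i) v))))
    = (\<Sum>i=1..k. \<Sum>j=1..k - i. cscale (of_nat i) (A i (A j (?P n (k - i - j) v))))"
    by (subst sum_triangle_swap) (auto intro!: sum.cong simp: A_commute add.commute)
  also have "\<dots> = (\<Sum>i=1..k. cscale (of_nat i) (A i (?P (Suc n) (k - i) v)))"
    by (simp add: clinear_sum[OF A_linear] cvs.scale_sum_right)
  finally show ?case
    by (simp only: of_nat_Suc[of "Suc n"] cvs.scale_left_distrib cvs.scale_one)
qed

text \<open>This is x d/dx exp S = (x dS/dx) exp S. It replaces the sum over compositions: linearity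
  and commutators of \<open>exp_coeff\<close> follow from it by induction on k.\<close>

lemma exp_coeff_recursion:
  "cscale (of_nat k) (exp_coeff A k v)
    = (\<Sum>j=1..k. cscale (of_nat j) (A j (exp_coeff A (k - j) v)))"
proof (cases k)
  case (Suc k')
  have "cscale (of_nat k) (exp_coeff A k v)
    = (\<Sum>n\<le>k. cscale (1 / fact n) (cscale (of_nat k) (power_coeff A n k v)))"
    unfolding exp_coeff_eq_power_coeff[OF A_linear order_refl] cvs.scale_sum_right
    by (simp add: mult.commute)
  \<comment> \<open>The term n = 0 vanishes because k > 0. Afterwards the factor n + 1 of
    \<open>power_coeff_recursion\<close> turns 1/(n+1)! into 1/n!.\<close>
  also have "\<dots> = (\<Sum>n\<le>k'. cscale (1 / fact (Suc n)) (cscale (of_nat k) (power_coeff A (Suc n) k v)))"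
    unfolding Suc sum.atMost_Suc_shift by simp
  also have "\<dots> = (\<Sum>n\<le>k'. \<Sum>j=1..k. cscale (of_nat j) (A j (cscale (1 / fact n) (power_coeff A n (k - j) v))))"
    unfolding power_coeff_recursion cvs.scale_sum_right
    by (intro sum.cong refl) (simp add: clinear_cscale[OF A_linear] field_simps fact_Suc del: of_nat_Suc)
  also have "\<dots> = (\<Sum>j=1..k. \<Sum>n\<le>k'. cscale (of_nat j) (A j (cscale (1 / fact n) (power_coeff A n (k - j) v))))"
    by (rule sum.swap)
  also have "\<dots> = (\<Sum>j=1..k. cscale (of_nat j) (A j (exp_coeff A (k - j) v)))"
    by (intro sum.cong refl, subst exp_coeff_eq_power_coeff[OF A_linear, where N = k'])
      (auto simp: Suc clinear_sum[OF A_linear] cvs.scale_sum_right)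
  finally show ?thesis .
qed simp

lemma exp_coeff_Suc:
  "exp_coeff A (Suc k) v
    = cscale (1 / of_nat (Suc k)) (\<Sum>j=1..Suc k. cscale (of_nat j) (A j (exp_coeff A (Suc k - j) v)))"
  unfolding exp_coeff_recursion[symmetric] by (simp del: of_nat_Suc)

lemma clinear_exp_coeff: "clinear (exp_coeff A k)"
proof (induction k rule: less_induct)
  case (less k)
  show ?case
  proof (cases k)
    case 0
    then show ?thesis by (simp add: clinearI)
  next
    case (Suc k')
    have lin: "clinear (exp_coeff A (Suc k' - j))" if "j \<in> {1..Suc k'}" for j
      using less that Suc by auto
    have "clinear (\<lambda>v. cscale (of_nat j) (A j (exp_coeff A (Suc k' - j) v)))" if "j \<in> {1..Suc k'}" for j
      by (intro clinear_scaled clinear_comp[OF A_linear] lin that)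
    then have "clinear (\<lambda>v. \<Sum>j=1..Suc k'. cscale (of_nat j) (A j (exp_coeff A (Suc k' - j) v)))"
      by (rule clinear_sum_family)
    then show ?thesis
      unfolding Suc exp_coeff_Suc[abs_def] by (rule clinear_scaled)
  qed
qed

text \<open>Scalar commutators [B, A j] = c j give [B, exp S] = (sum of c j x^j) exp S. Both sides
  are compared after multiplication by k, where \<open>exp_coeff_recursion\<close> applies.\<close>

lemma exp_coeff_commutator:
  assumes B: "clinear B" "\<And>j v. j > 0 \<Longrightarrow> B (A j v) = A j (B v) + cscale (c j) v"
  shows "B (exp_coeff A k v) = exp_coeff A k (B v) + (\<Sum>j=1..k. cscale (c j) (exp_coeff A (k - j) v))"
proof (induction k rule: less_induct)
  case (less k)
  show ?case
  proof (cases "k = 0")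
    case False
    let ?X = "exp_coeff A"
    have "cscale (of_nat k) (B (?X k v)) = (\<Sum>j=1..k. cscale (of_nat j) (B (A j (?X (k - j) v))))"
      unfolding clinear_cscale[OF B(1), symmetric] exp_coeff_recursion
      by (simp add: clinear_sum[OF B(1)] clinear_cscale[OF B(1)])
    also have "\<dots> = (\<Sum>j=1..k. cscale (of_nat j) (A j (?X (k - j) (B v))))
        + (\<Sum>j=1..k. \<Sum>i=1..k - j. cscale (of_nat j) (cscale (c i) (A j (?X (k - j - i) v))))
        + (\<Sum>j=1..k. cscale (of_nat j) (cscale (c j) (?X (k - j) v)))"
      unfolding sum.distrib[symmetric]
      by (intro sum.cong refl)
        (simp add: B(2) less.IH clinear_add[OF A_linear] clinear_sum[OF A_linear] clinear_cscale[OF A_linear]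
          cvs.scale_right_distrib cvs.scale_sum_right)
    also have "(\<Sum>j=1..k. \<Sum>i=1..k - j. cscale (of_nat j) (cscale (c i) (A j (?X (k - j - i) v))))
        = (\<Sum>i=1..k. cscale (c i) (cscale (of_nat (k - i)) (?X (k - i) v)))"
    proof (subst sum_triangle_swap, intro sum.cong refl)
      fix i
      have "(\<Sum>j=1..k - i. cscale (of_nat j) (cscale (c i) (A j (?X (k - j - i) v))))
        = cscale (c i) (\<Sum>j=1..k - i. cscale (of_nat j) (A j (?X (k - i - j) v)))"
        by (simp add: cvs.scale_sum_right mult.commute add.commute)
      then show "(\<Sum>j=1..k - i. cscale (of_nat j) (cscale (c i) (A j (?X (k - j - i) v))))
        = cscale (c i) (cscale (of_nat (k - i)) (?X (k - i) v))"
        by (simp only: exp_coeff_recursion)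
    qed
    also have "(\<Sum>j=1..k. cscale (of_nat j) (A j (?X (k - j) (B v))))
        = cscale (of_nat k) (?X k (B v))"
      by (rule exp_coeff_recursion[symmetric])
    \<comment> \<open>The weights k - i, from commuting B past the smaller exponential, and i, from
      commuting it past A i, add up to k, which can then be cancelled.\<close>
    also have "cscale (of_nat k) (?X k (B v)) + (\<Sum>i=1..k. cscale (c i) (cscale (of_nat (k - i)) (?X (k - i) v)))
        + (\<Sum>j=1..k. cscale (of_nat j) (cscale (c j) (?X (k - j) v)))
        = cscale (of_nat k) (?X k (B v)) + (\<Sum>i=1..k. cscale (of_nat k) (cscale (c i) (?X (k - i) v)))"
      unfolding add.assoc sum.distrib[symmetric]
      by (intro arg_cong2[where f = "(+)"] sum.cong refl)
        (simp add: of_nat_diff right_diff_distrib mult.commute flip: cvs.scale_left_distrib)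
    finally have "cscale (of_nat k) (B (?X k v))
      = cscale (of_nat k) (?X k (B v) + (\<Sum>i=1..k. cscale (c i) (?X (k - i) v)))"
      by (simp only: cvs.scale_right_distrib cvs.scale_sum_right)
    then show ?thesis using False by (simp only: cvs.scale_cancel_left of_nat_eq_0_iff) simp
  qed simp
qed

end


section \<open>Vertex operators of the lattice vertex superalgebra\<close>

text \<open>
  \<open>half_vertex c s a\<close> is the coefficient of \<open>x\<^sup>a\<close> in \<open>exp (\<Sum>k\<ge>1. c \<beta>(s k)/k x\<^sup>k)\<close>, so that
  \<open>E_minus m a\<close> and \<open>E_plus m b\<close> are the coefficients of \<open>z\<^sup>a\<close> in \<open>exp (\<Sum>k\<ge>1. m \<beta>(-k)/k z\<^sup>k)\<close> and of
  \<open>z\<^sup>-\<^sup>b\<close> in \<open>exp (- \<Sum>k\<ge>1. m \<beta>(k)/k z\<^sup>-\<^sup>k)\<close>; integer indices avoid side conditions in shifts.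
\<close>

definition half_vertex :: "complex \<Rightarrow> int \<Rightarrow> int \<Rightarrow> lattice_space \<Rightarrow> lattice_space"
  where "half_vertex c s a v =
    (if a < 0 then 0 else exp_coeff (\<lambda>k u. cscale (c / of_nat k) (heis (s * int k) u)) (nat a) v)"

definition E_minus :: "int \<Rightarrow> int \<Rightarrow> lattice_space \<Rightarrow> lattice_space"
  where "E_minus m = half_vertex (of_int m) (- 1)"

definition E_plus :: "int \<Rightarrow> int \<Rightarrow> lattice_space \<Rightarrow> lattice_space"
  where "E_plus m = half_vertex (- of_int m) 1"

definition charge_shift :: "int \<Rightarrow> lattice_space \<Rightarrow> lattice_space"
  where "charge_shift m = lin_ext (\<lambda>(p, M). ket (p + m, M))"

lemma heis_commutes:
  assumes "k + l \<noteq> 0"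
  shows "heis k (heis l v) = heis l (heis k v)"
  using heis_commutator[of k l v] assms by simp

lemma heis_scaled_linear: "clinear (\<lambda>u. cscale c (heis k u))"
  by (intro clinear_scaled clinear_heis)

lemma heis_scaled_commute:
  assumes "k + l \<noteq> 0"
  shows "cscale c (heis k (cscale d (heis l v))) = cscale d (heis l (cscale c (heis k v)))"
  by (simp add: clinear_cscale[OF clinear_heis] heis_commutes[OF assms] mult.commute)

lemma heis_sign_commute:
  assumes "i > 0" "j > 0" "s = 1 \<or> s = - 1"
  shows "cscale c (heis (s * int i) (cscale d (heis (s * int j) v)))
    = cscale d (heis (s * int j) (cscale c (heis (s * int i) v)))"
  using assms by (intro heis_scaled_commute) auto

lemma clinear_half_vertex:
  assumes "s = 1 \<or> s = - 1"
  shows "clinear (half_vertex c s a)"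
proof (cases "a < 0")
  case False
  have "clinear (exp_coeff (\<lambda>k u. cscale (c / of_nat k) (heis (s * int k) u)) (nat a))"
    by (intro clinear_exp_coeff heis_scaled_linear heis_sign_commute assms)
  with False show ?thesis by (simp add: half_vertex_def[abs_def])
qed (simp add: half_vertex_def[abs_def] clinear_zero)

text \<open>The weight j cancels the 1/j in the exponent, so only c remains. The grading, the
  closure of submodules and the vacuum coefficients are all read off this recursion by induction on
  a.\<close>

lemma half_vertex_recursion:
  assumes "a \<ge> 0" "s = 1 \<or> s = - 1"
  shows "cscale (of_int a) (half_vertex c s a v)
      = cscale c (\<Sum>j=1..nat a. heis (s * int j) (half_vertex c s (a - int j) v))"
proof -
  let ?A = "\<lambda>k u. cscale (c / of_nat k) (heis (s * int k) u)"
  have a: "(of_int a :: complex) = of_nat (nat a)" using assms(1) by simp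
  have "cscale (of_int a) (half_vertex c s a v) = cscale (of_nat (nat a)) (exp_coeff ?A (nat a) v)"
    using assms(1) by (simp add: half_vertex_def)
  also have "\<dots> = (\<Sum>j=1..nat a. cscale (of_nat j) (?A j (exp_coeff ?A (nat a - j) v)))"
    by (intro exp_coeff_recursion heis_scaled_linear heis_sign_commute assms(2))
  also have "\<dots> = (\<Sum>j=1..nat a. cscale c (heis (s * int j) (half_vertex c s (a - int j) v)))"
    by (intro sum.cong refl) (auto simp: half_vertex_def nat_diff_distrib)
  finally show ?thesis by (simp add: cvs.scale_sum_right)
qed

text \<open>Only the mode \<beta>(-l) in the exponent fails to commute with \<beta>(l), and it
  occurs iff s l < 0. Then [\<beta>(l), \<beta>(-l)] = -l = s |l|, so the commutator with c
  \<beta>(-l)/|l| is the scalar c s.\<close>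

lemma half_vertex_heis:
  assumes "s = 1 \<or> s = - 1"
  shows "heis l (half_vertex c s a v) = half_vertex c s a (heis l v)
    + cscale (c * of_int s) (if s * l < 0 then half_vertex c s (a - \<bar>l\<bar>) v else 0)"
proof (cases "a < 0")
  case False
  let ?A = "\<lambda>k u. cscale (c / of_nat k) (heis (s * int k) u)"
  define d :: "nat \<Rightarrow> complex" where "d j = (if l = - s * int j then c * of_int s else 0)" for j
  have s: "(of_int s :: complex) * of_int s = 1" "s * s = 1" "s * (s * x) = x" for x
    using assms by auto
  have l_iff: "l = - s * int j \<longleftrightarrow> s * l < 0 \<and> j = nat \<bar>l\<bar>" if "j > 0" for j
    using assms that by auto
  have d_0: "d j = 0" if "j > 0" "j \<noteq> nat \<bar>l\<bar>" for j
    using l_iff[OF that(1)] that(2) by (simp add: d_def)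
  have B: "heis l (?A j v) = ?A j (heis l v) + cscale (d j) v" if "j > 0" for j v
  proof -
    have "heis l (heis (s * int j) v) - heis (s * int j) (heis l v)
        = cscale (if l = - s * int j then of_int s * of_nat j else 0) v"
      unfolding heis_commutator by (auto simp: add_eq_0_iff2 add_eq_0_iff)
    then have "heis l (heis (s * int j) v) = heis (s * int j) (heis l v)
        + cscale (if l = - s * int j then of_int s * of_nat j else 0) v"
      by (simp add: diff_eq_eq add.commute)
    then show ?thesis using that
      by (auto simp: clinear_cscale[OF clinear_heis] d_def cvs.scale_right_distrib)
  qed
  have "heis l (exp_coeff ?A (nat a) v) = exp_coeff ?A (nat a) (heis l v)
      + (\<Sum>j=1..nat a. cscale (d j) (exp_coeff ?A (nat a - j) v))"
    by (rule exp_coeff_commutator[OF _ _ clinear_heis B])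
      (simp_all add: heis_scaled_linear heis_sign_commute assms)
  also have "(\<Sum>j=1..nat a. cscale (d j) (exp_coeff ?A (nat a - j) v))
      = (\<Sum>j=1..nat a. if j = nat \<bar>l\<bar> then cscale (d j) (exp_coeff ?A (nat a - j) v) else 0)"
    using d_0 by (intro sum.cong refl) auto
  also have "\<dots> = cscale (c * of_int s) (if s * l < 0 then half_vertex c s (a - \<bar>l\<bar>) v else 0)"
    using False l_iff[of "nat \<bar>l\<bar>"]
    by (cases "l = 0") (auto simp: d_def half_vertex_def nat_diff_distrib)
  finally show ?thesis using False by (simp add: half_vertex_def)
next
  case True
  then have "a - \<bar>l\<bar> < 0" by linarith
  with True show ?thesis by (simp add: half_vertex_def clinear_0[OF clinear_heis])
qed

lemma clinear_E: "clinear (E_minus m a)" "clinear (E_plus m a)"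
  by (simp_all add: E_minus_def E_plus_def clinear_half_vertex)

lemma clinear_charge_shift: "clinear (charge_shift m)"
  by (simp add: charge_shift_def linear_lin_ext)

lemma charge_shift_ket [simp]: "charge_shift m (ket (p, M)) = ket (p + m, M)"
  by (simp add: charge_shift_def)

lemma E_zero [simp]: "E_minus m 0 v = v" "E_plus m 0 v = v"
  by (simp_all add: E_minus_def E_plus_def half_vertex_def)

lemma E_neg [simp]:
  assumes "a < 0"
  shows "E_minus m a v = 0" "E_plus m a v = 0"
  using assms by (simp_all add: E_minus_def E_plus_def half_vertex_def)

lemma E_minus_heis:
  "heis l (E_minus m a v) = E_minus m a (heis l v)
    - cscale (of_int m) (if l > 0 then E_minus m (a - l) v else 0)"
  by (simp add: E_minus_def half_vertex_heis)

lemma E_plus_heis: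
  "heis l (E_plus m b v) = E_plus m b (heis l v)
    - cscale (of_int m) (if l < 0 then E_plus m (b + l) v else 0)"
  by (simp add: E_plus_def half_vertex_heis)

lemma charge_shift_heis:
  "heis l (charge_shift m v) = charge_shift m (heis l v)
    - cscale (of_int m) (if l = 0 then charge_shift m v else 0)"
proof (rule clinear_ext[where A = "\<lambda>v. heis l (charge_shift m v)"])
  show "clinear (\<lambda>v. heis l (charge_shift m v))"
    by (intro clinear_comp[OF clinear_heis] clinear_charge_shift)
  show "clinear (\<lambda>v. charge_shift m (heis l v) - cscale (of_int m) (if l = 0 then charge_shift m v else 0))"
    using clinear_charge_shift clinear_zero
    by (intro clinear_sub clinear_scaled clinear_comp[OF clinear_charge_shift] clinear_heis) (cases "l = 0"; simp)
  show "heis l (charge_shift m (ket x)) = charge_shift m (heis l (ket x))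
    - cscale (of_int m) (if l = 0 then charge_shift m (ket x) else 0)" for x
    by (cases x) (simp add: heis_ket clinear_cscale[OF clinear_charge_shift]
        clinear_minus[OF clinear_charge_shift] cvs.scale_left_diff_distrib)
qed

lemma finite_E_plus: "finite {b. E_plus m b v \<noteq> 0}"
proof -
  define N where "N = Max (insert 0 (lattice_weight ` Poly_Mapping.keys v)) + 1"
  have wt: "lattice_weight a < N" if "a \<in> Poly_Mapping.keys v" for a
    unfolding N_def Suc_eq_plus1[symmetric] less_Suc_eq_le using that by (intro Max.coboundedI) auto
  have "E_plus m b v = 0" if "b \<ge> int N" for b
  proof -
    have "lattice_weight a < nat b" if "a \<in> Poly_Mapping.keys v" for a
      using wt[OF that] \<open>b \<ge> int N\<close> by linarith
    then show ?thesis
      using that exp_coeff_annihilates[of v "nat b" "\<lambda>k. - of_int m / of_nat k"]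
      by (simp add: E_plus_def half_vertex_def)
  qed
  then show ?thesis by (intro finite_int_bounded[of "int N" _ "- 1"]) auto
qed

lemma finite_vertex_sum: "finite {b. E_minus m (b + c) (E_plus m b v) \<noteq> 0}"
  by (rule finite_subset[OF _ finite_E_plus[of m v]]) (auto simp: clinear_E)

text \<open>In the defining sum over pairs the condition determines a from b. Summing over all
  integers b, with vanishing terms at negative indices, makes later shifts of b
  unconditional.\<close>

lemma lattice_mode_ket:
  "lattice_mode m n (ket (p, M))
    = Sum_any (\<lambda>b. E_minus m (b + (m * p - n - 1)) (E_plus m b (charge_shift m (ket (p, M)))))"
proof -
  define f where "f = (\<lambda>(a, b). if int a - int b - m * p = - n - 1
      then vertex_coeff m a b (ket (p + m, M)) else 0)"
  let ?w = "lattice_weight (p, M)"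
  define g where "g b = E_minus m (b + (m * p - n - 1)) (E_plus m b (ket (p + m, M)))" for b
  have f_eq: "f (nat (int b + (m * p - n - 1)), b) = g (int b)"
    if "int b + (m * p - n - 1) \<ge> 0" for b
    using that by (simp add: f_def g_def vertex_coeff_def E_minus_def E_plus_def half_vertex_def)
  have g_eq: "g b = 0" if "b + (m * p - n - 1) < 0 \<or> b < 0" for b
    using that by (auto simp: g_def clinear_E)
  have g_large: "g (int b) = 0" if "b > ?w" for b
    using f_eq[of b] g_eq[of "int b"] vertex_coeff_eq_0[OF that, of m]
    by (cases "int b + (m * p - n - 1) < 0") (auto simp: f_def)
  let ?h = "\<lambda>b. (nat (int b + (m * p - n - 1)), b)"
  let ?B = "{b. b \<le> ?w \<and> int b + (m * p - n - 1) \<ge> 0}"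
  have "Sum_any f = sum f (?h ` ?B)"
  proof (rule Sum_any.expand_superset)
    show "{x. f x \<noteq> 0} \<subseteq> ?h ` ?B"
    proof clarify
      fix a b
      assume *: "f (a, b) \<noteq> 0"
      then have "int a - int b - m * p = - n - 1" "\<not> b > ?w"
        using vertex_coeff_eq_0 by (auto simp: f_def split: if_splits)
      then show "(a, b) \<in> ?h ` ?B" by (intro image_eqI[of _ _ b]) auto
    qed
  qed simp
  also have "\<dots> = (\<Sum>b\<in>?B. f (?h b))"
    by (subst sum.reindex) (auto simp: inj_on_def)
  also have "\<dots> = (\<Sum>b\<in>?B. g (int b))"
    by (rule sum.cong) (simp_all only: mem_Collect_eq f_eq)
  also have "\<dots> = sum g (int ` ?B)"
    by (subst sum.reindex) auto
  also have "\<dots> = Sum_any g"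
  proof (rule Sum_any.expand_superset[symmetric])
    show "{b. g b \<noteq> 0} \<subseteq> int ` ?B"
    proof clarify
      fix b assume *: "g b \<noteq> 0"
      then have "b \<ge> 0" "b + (m * p - n - 1) \<ge> 0" using g_eq[of b] by (auto simp: not_less[symmetric])
      moreover from this * have "nat b \<le> ?w" using g_large[of "nat b"] by (auto simp: not_less[symmetric])
      ultimately show "b \<in> int ` ?B" by (intro image_eqI[of _ _ "nat b"]) auto
    qed
  qed simp
  finally show ?thesis
    unfolding lattice_mode_def lin_ext_ket prod.case f_def g_def charge_shift_ket .
qed

lemma clinear_lattice_mode: "clinear (lattice_mode m n)"
  by (simp add: lattice_mode_def linear_lin_ext)

text \<open>The factor z^(m \<beta>(0)) contributes the exponent -m p, which is constant only on
  vectors of one charge p.\<close>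

lemma lattice_mode_eq:
  assumes "\<And>x. x \<in> Poly_Mapping.keys v \<Longrightarrow> fst x = p"
  shows "lattice_mode m n v
    = Sum_any (\<lambda>b. E_minus m (b + (m * p - n - 1)) (E_plus m b (charge_shift m v)))"
proof (rule clinear_eq_on_keys[OF clinear_lattice_mode])
  show "clinear (\<lambda>v. Sum_any (\<lambda>b. E_minus m (b + (m * p - n - 1)) (E_plus m b (charge_shift m v))))"
    by (intro clinear_Sum_any_family finite_vertex_sum)
      (intro clinear_comp[OF clinear_E(1)] clinear_comp[OF clinear_E(2)] clinear_charge_shift)
  show "lattice_mode m n (ket x)
    = Sum_any (\<lambda>b. E_minus m (b + (m * p - n - 1)) (E_plus m b (charge_shift m (ket x))))"
    if "x \<in> Poly_Mapping.keys v" for x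
    using assms[OF that] by (cases x) (simp add: lattice_mode_ket del: charge_shift_ket)
qed

text \<open>This is [\<beta>(k), Y(e^(m\<beta>), z)] = -m z^k Y(e^(m\<beta>), z). By the sign of k
  exactly one of the three factors contributes: \<open>E_minus\<close> for k > 0, the charge shift
  for k = 0, \<open>E_plus\<close> for k < 0.\<close>

lemma lattice_mode_heis:
  "heis k (lattice_mode m n v) = lattice_mode m n (heis k v) - cscale (of_int m) (lattice_mode m (n + k) v)"
proof (rule clinear_ext[where A = "\<lambda>v. heis k (lattice_mode m n v)"])
  show "clinear (\<lambda>v. heis k (lattice_mode m n v))"
    by (intro clinear_comp[OF clinear_heis] clinear_lattice_mode)
  show "clinear (\<lambda>v. lattice_mode m n (heis k v) - cscale (of_int m) (lattice_mode m (n + k) v))"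
    by (intro clinear_sub clinear_comp[OF clinear_lattice_mode] clinear_scaled clinear_heis clinear_lattice_mode)
  fix x :: lattice_basis
  obtain p M where x: "x = (p, M)" by force
  let ?v = "ket (p, M)"
  let ?s = "charge_shift m ?v"
  define c where "c = m * p - n - 1"
  have keys: "fst y = p" if "y \<in> Poly_Mapping.keys (heis k ?v)" for y
    using that by (auto simp: heis_ket in_keys_iff lookup_ket split: if_splits)
  define R where "R b = E_minus m (b + c - k) (E_plus m b ?s)" for b
  have fin_R: "finite {b. R b \<noteq> 0}"
    using finite_vertex_sum[of m "c - k" ?s] by (simp add: R_def add_diff_eq)
  have R: "Sum_any R = lattice_mode m (n + k) ?v"
    unfolding R_def lattice_mode_ket by (simp add: c_def algebra_simps del: charge_shift_ket)
  \<comment> \<open>Q b is the correction at index b. For k < 0 it comes from \<open>E_plus\<close>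
    with index b + k, so Q is R shifted by k and has the same total.\<close>
  define Q where "Q b = (if k < 0 then R (b + k) else R b)" for b
  have fin_Q: "finite {b. Q b \<noteq> 0}"
  proof (cases "k < 0")
    case True
    then have "{b. Q b \<noteq> 0} = (\<lambda>b. b + k) -` {b. R b \<noteq> 0}" by (auto simp: Q_def)
    also have "finite \<dots>" by (intro finite_vimageI fin_R) simp
    finally show ?thesis .
  qed (simp add: Q_def fin_R)
  have Q: "Sum_any Q = lattice_mode m (n + k) ?v"
    using R Sum_any_shift[of R k] by (cases "k < 0") (simp_all add: Q_def[abs_def])
  have Q_eq: "Q b = E_minus m (b + c) (E_plus m b (if k = 0 then ?s else 0))
      + E_minus m (b + c) (if k < 0 then E_plus m (b + k) ?s else 0)
      + (if k > 0 then E_minus m (b + c - k) (E_plus m b ?s) else 0)" for b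
    by (cases k "0::int" rule: linorder_cases)
      (simp_all add: Q_def R_def clinear_E add.commute add.left_commute)
  have step: "heis k (E_minus m (b + c) (E_plus m b ?s)) + cscale (of_int m) (Q b)
      = E_minus m (b + c) (E_plus m b (charge_shift m (heis k ?v)))" for b
    unfolding Q_eq E_minus_heis E_plus_heis charge_shift_heis
    by (simp only: clinear_diff[OF clinear_E(1)] clinear_diff[OF clinear_E(2)]
        clinear_cscale[OF clinear_E(1)] clinear_cscale[OF clinear_E(2)] cvs.scale_right_distrib)
      (simp only: algebra_simps)
  have fin: "finite {b. heis k (E_minus m (b + c) (E_plus m b ?s)) \<noteq> 0}"
    by (rule finite_subset[OF _ finite_vertex_sum[of m c ?s]]) (auto simp: clinear_heis)
  have "heis k (lattice_mode m n ?v) = Sum_any (\<lambda>b. heis k (E_minus m (b + c) (E_plus m b ?s)))"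
    unfolding lattice_mode_ket c_def[symmetric] by (rule clinear_Sum_any[OF clinear_heis finite_vertex_sum])
  also have "\<dots> + cscale (of_int m) (Sum_any Q)
    = Sum_any (\<lambda>b. heis k (E_minus m (b + c) (E_plus m b ?s)) + cscale (of_int m) (Q b))"
    unfolding clinear_Sum_any[OF clinear_scaled[OF clinear_id(1)] fin_Q]
    by (rule Sum_any.distrib[symmetric, OF fin finite_subset[OF _ fin_Q]]) auto
  finally have "heis k (lattice_mode m n ?v) + cscale (of_int m) (Sum_any Q)
    = Sum_any (\<lambda>b. E_minus m (b + c) (E_plus m b (charge_shift m (heis k ?v))))"
    unfolding step .
  also have "\<dots> = lattice_mode m n (heis k ?v)"
    unfolding c_def by (rule lattice_mode_eq[symmetric]) (rule keys)
  finally show "heis k (lattice_mode m n (ket x))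
    = lattice_mode m n (heis k (ket x)) - cscale (of_int m) (lattice_mode m (n + k) (ket x))"
    unfolding x Q by (simp only: eq_diff_eq)
qed


section \<open>The grading of the lattice space\<close>

definition graded_part :: "int \<Rightarrow> int \<Rightarrow> lattice_space set"
  where "graded_part p w = {v. \<forall>x\<in>Poly_Mapping.keys v. fst x = p \<and> int (lattice_weight x) = w}"

lemma subspace_keys: "cvs.subspace {v. \<forall>x\<in>Poly_Mapping.keys v. P x}"
  by (rule cvs.subspaceI) (auto simp: in_keys_iff lookup_add)

lemma subspace_graded_part: "cvs.subspace (graded_part p w)"
  unfolding graded_part_def by (rule subspace_keys)

lemma ket_graded_part: "ket (p, M) \<in> graded_part p (int (lattice_weight (p, M)))"
  by (auto simp: graded_part_def ket_def)

lemma graded_part_neg: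
  assumes "v \<in> graded_part p w" "w < 0"
  shows "v = 0"
proof -
  have "x \<notin> Poly_Mapping.keys v" for x using assms by (cases x) (auto simp: graded_part_def)
  then have "Poly_Mapping.keys v = {}" by blast
  then show ?thesis by simp
qed

lemma graded_part_fst:
  assumes "v \<in> graded_part p w" "x \<in> Poly_Mapping.keys v"
  shows "fst x = p"
  using assms by (simp add: graded_part_def)

lemma heis_graded:
  assumes "v \<in> graded_part p w"
  shows "heis k v \<in> graded_part p (w - k)"
proof (rule clinear_span_closed[OF clinear_heis subspace_graded_part])
  fix x assume "x \<in> Poly_Mapping.keys v"
  then have "fst x = p" "int (lattice_weight x) = w" using assms by (auto simp: graded_part_def)
  then obtain M where x: "x = (p, M)" "int (lattice_weight (p, M)) = w" by (cases x) auto
  note scale = cvs.subspace_scale[OF subspace_graded_part]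
  show "heis k (ket x) \<in> graded_part p (w - k)"
  proof (cases "k > 0 \<and> nat k - 1 \<in># M")
    case True
    then obtain N where N: "M = add_mset (nat k - 1) N" by (metis multi_member_split)
    then have w: "w = int (lattice_weight (p, N)) + k" using True x(2) by (auto simp: lattice_weight_def)
    then show ?thesis
      using True scale[OF ket_graded_part[of p N]] by (simp add: x(1) heis_ket N del: cvs.scale_minus_left)
  next
    case False
    then consider "k > 0" "count M (nat k - 1) = 0" | "k = 0" | "k < 0"
      by (cases k "0::int" rule: linorder_cases) (auto simp: not_in_iff)
    then show ?thesis
    proof cases
      case 1
      then show ?thesis by (simp add: x(1) heis_ket cvs.subspace_0[OF subspace_graded_part])
    next
      case 2
      then show ?thesis using scale[OF ket_graded_part[of p M]]
        by (simp add: x heis_ket del: cvs.scale_minus_left)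
    next
      case 3
      have "int (lattice_weight (p, add_mset (nat (- k) - 1) M)) = w - k"
        using 3 x(2) by (simp add: lattice_weight_def)
      with 3 show ?thesis using ket_graded_part[of p "add_mset (nat (- k) - 1) M"]
        by (simp add: x(1) heis_ket)
    qed
  qed
qed

lemma half_vertex_graded:
  assumes "s = 1 \<or> s = - 1" "v \<in> graded_part p w"
  shows "half_vertex c s a v \<in> graded_part p (w - s * a)"
proof (cases "a < 0")
  case False
  then show ?thesis
  proof (induction "nat a" arbitrary: a rule: less_induct)
    case less
    note sub = subspace_graded_part
    show ?case
    proof (cases "a = 0")
      case True
      with assms(2) show ?thesis by (simp add: half_vertex_def)
    next
      case False
      have "heis (s * int j) (half_vertex c s (a - int j) v) \<in> graded_part p (w - s * a)"
        if "j \<in> {1..nat a}" for j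
      proof -
        have "half_vertex c s (a - int j) v \<in> graded_part p (w - s * (a - int j))"
          using that by (intro less.hyps) auto
        from heis_graded[OF this, of "s * int j"] show ?thesis by (simp add: right_diff_distrib)
      qed
      then have "cscale (of_int a) (half_vertex c s a v) \<in> graded_part p (w - s * a)"
        using less.prems assms(1)
        by (subst half_vertex_recursion) (auto intro!: cvs.subspace_scale[OF sub] cvs.subspace_sum[OF sub])
      then have "cscale (1 / of_int a) (cscale (of_int a) (half_vertex c s a v)) \<in> graded_part p (w - s * a)"
        by (rule cvs.subspace_scale[OF sub])
      with False show ?thesis by simp
    qed
  qed
qed (simp add: half_vertex_def cvs.subspace_0[OF subspace_graded_part])

lemma subspace_Sum_any:
  assumes "cvs.subspace W" "\<And>i. f i \<in> W"
  shows "Sum_any f \<in> W"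
  unfolding Sum_any.expand_set by (rule cvs.subspace_sum[OF assms(1)]) (rule assms(2))

text \<open>Here w is the Heisenberg weight alone, without the weight -p^2/2 of e^(p\<beta>). The
  passage from -p^2/2 to -(p + m)^2/2 is compensated by the term m p together with the weight -m^2/2
  of e^(m\<beta>).\<close>

lemma lattice_mode_graded:
  assumes "v \<in> graded_part p w"
  shows "lattice_mode m n v \<in> graded_part (p + m) (w + m * p - n - 1)"
proof (rule clinear_span_closed[OF clinear_lattice_mode subspace_graded_part])
  fix x assume "x \<in> Poly_Mapping.keys v"
  then have "fst x = p" "int (lattice_weight x) = w" using assms by (auto simp: graded_part_def)
  then obtain M where x: "x = (p, M)" "int (lattice_weight (p, M)) = w" by (cases x) auto
  have "ket (p + m, M) \<in> graded_part (p + m) w"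
    using ket_graded_part[of "p + m" M] x(2) by (simp add: lattice_weight_def)
  then have "E_minus m (b + (m * p - n - 1)) (E_plus m b (ket (p + m, M)))
      \<in> graded_part (p + m) ((w - 1 * b) - (- 1) * (b + (m * p - n - 1)))" for b
    unfolding E_minus_def E_plus_def by (intro half_vertex_graded) auto
  then show "lattice_mode m n (ket x) \<in> graded_part (p + m) (w + m * p - n - 1)"
    unfolding x(1) lattice_mode_ket
    by (intro subspace_Sum_any[OF subspace_graded_part]) (simp add: algebra_simps)
qed


section \<open>Vacuum coefficients\<close>

abbreviation vac_coeff :: "int \<Rightarrow> lattice_space \<Rightarrow> complex"
  where "vac_coeff q v \<equiv> Poly_Mapping.lookup v (q, {#})"

lemma lookup_Sum_any:
  assumes "finite {i. f i \<noteq> 0}"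
  shows "Poly_Mapping.lookup (Sum_any f) x = Sum_any (\<lambda>i. Poly_Mapping.lookup (f i) x)"
proof -
  have "Sum_any (\<lambda>i. Poly_Mapping.lookup (f i) x) = (\<Sum>i | f i \<noteq> 0. Poly_Mapping.lookup (f i) x)"
    using assms by (intro Sum_any.expand_superset) auto
  then show ?thesis by (simp add: Sum_any.expand_set lookup_sum)
qed

lemma vac_coeff_heis_creation:
  assumes "k > 0"
  shows "vac_coeff q (heis (- k) v) = 0"
proof (rule ccontr)
  assume "vac_coeff q (heis (- k) v) \<noteq> 0"
  then have "(q, {#}) \<in> Poly_Mapping.keys (heis (- k) v)" by (simp add: in_keys_iff)
  then obtain x where "(q, {#}) \<in> Poly_Mapping.keys (heis (- k) (ket x))"
    unfolding heis_def by (elim keys_lin_ext) simp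
  then show False using assms by (cases x) (simp add: heis_ket in_keys_iff lookup_ket)
qed

text \<open>By the recursion, a coefficient of positive degree is a combination of vectors
  \<beta>(-j) u, which have no vacuum component.\<close>

lemma vac_coeff_E_minus: "vac_coeff q (E_minus m a v) = (if a = 0 then vac_coeff q v else 0)"
proof (cases "a > 0")
  case True
  have "of_int a * vac_coeff q (E_minus m a v) = vac_coeff q (cscale (of_int a) (E_minus m a v))"
    by simp
  also have "\<dots> = of_int m * (\<Sum>j=1..nat a. vac_coeff q (heis (- int j) (half_vertex (of_int m) (- 1) (a - int j) v)))"
    using True by (simp add: E_minus_def half_vertex_recursion lookup_sum del: lookup_cscale)
      (simp add: lookup_sum)
  also have "\<dots> = 0" by (simp add: vac_coeff_heis_creation)
  finally show ?thesis using True by simp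
qed (cases "a = 0"; simp)

text \<open>The coefficients of \<open>(1 - x)\<^sup>-\<^sup>\<epsilon>\<close> for \<open>\<epsilon> = \<plusminus>1\<close>.\<close>

definition pairing_coeff :: "int \<Rightarrow> int \<Rightarrow> complex"
  where "pairing_coeff e b = (if b < 0 then 0 else if e = 1 then 1 else if b = 0 then 1 else if b = 1 then - 1 else 0)"

text \<open>The annihilation exponential in x and the creation exponential in y commute up to the
  factor (1 - xy)^(-m m'), which is all that the vacuum sees. The coefficients G of (1 - x)^(-m m')
  are determined by b G(b) = m m' (G(0) + ... + G(b - 1)), the logarithmic derivative of this
  series.\<close>

lemma vac_coeff_E_plus_E_minus:
  assumes "m * m' = 1 \<or> m * m' = - 1"
  shows "vac_coeff q (E_plus m b (E_minus m' n (ket (p, {#}))))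
    = (if p = q \<and> b = n then pairing_coeff (m * m') b else 0)"
proof (cases "b < 0")
  case False
  then show ?thesis
  proof (induction "nat b" arbitrary: b n rule: less_induct)
    case less
    show ?case
    proof (cases "b = 0")
      case True
      then show ?thesis by (simp add: vac_coeff_E_minus lookup_ket pairing_coeff_def)
    next
      case False
      with less.prems have b: "b > 0" by simp
      let ?v = "ket (p, {#}) :: lattice_space"
      define G where "G n = pairing_coeff (m * m') n" for n
      have heis_vac: "heis (int j) ?v = 0" if "j > 0" for j
        using that by (simp add: heis_ket)
      \<comment> \<open>A positive mode passes \<open>E_plus\<close> freely and kills the charged
        vacuum, so only its commutator with \<open>E_minus\<close> survives and lowers n by
        j.\<close>
      have step: "heis (int j) (E_plus m (b - int j) (E_minus m' n ?v))
        = - cscale (of_int m') (E_plus m (b - int j) (E_minus m' (n - int j) ?v))" if "j > 0" for j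
        using that unfolding E_plus_heis E_minus_heis heis_vac[OF that]
        by (simp add: clinear_E clinear_cscale[OF clinear_E(2)] clinear_minus[OF clinear_E(2)])
      have "of_int b * vac_coeff q (E_plus m b (E_minus m' n ?v))
        = vac_coeff q (cscale (of_int b) (E_plus m b (E_minus m' n ?v)))" by simp
      also have "\<dots> = - of_int m * (\<Sum>j=1..nat b. vac_coeff q (heis (int j) (E_plus m (b - int j) (E_minus m' n ?v))))"
        using b by (simp add: E_plus_def half_vertex_recursion lookup_sum del: lookup_cscale)
          (simp add: lookup_sum)
      also have "\<dots> = - of_int m * (\<Sum>j=1..nat b. - of_int m' * (if p = q \<and> b = n then G (b - int j) else 0))"
      proof (intro arg_cong2[where f = times] sum.cong refl)
        fix j assume j: "j \<in> {1..nat b}"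
        then have "vac_coeff q (E_plus m (b - int j) (E_minus m' (n - int j) ?v))
          = (if p = q \<and> b - int j = n - int j then G (b - int j) else 0)"
          unfolding G_def by (intro less.hyps) auto
        then show "vac_coeff q (heis (int j) (E_plus m (b - int j) (E_minus m' n ?v)))
          = - of_int m' * (if p = q \<and> b = n then G (b - int j) else 0)"
          using j by (simp add: step)
      qed
      also have "\<dots> = (if p = q \<and> b = n then of_int (m * m') * (\<Sum>j=1..nat b. G (b - int j)) else 0)"
        by (cases "p = q"; cases "b = n") (simp_all add: sum_negf sum_distrib_left mult.assoc)
      also have "(\<Sum>j=1..nat b. G (b - int j)) = (\<Sum>j<nat b. G (int j))"
        by (rule sum.reindex_bij_witness[of _ "\<lambda>j. nat b - j" "\<lambda>j. nat b - j"]) (use b in auto)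
      \<comment> \<open>For (1 - x)^(-1) all coefficients are 1. For 1 - x the sums of the initial
        coefficients 1, -1, 0, 0, ... vanish from length 2 on.\<close>
      also have "of_int (m * m') * \<dots> = of_int b * G b"
      proof (cases "m * m' = 1")
        case True
        with b show ?thesis by (simp add: G_def pairing_coeff_def)
      next
        case False
        with assms have mm: "m * m' = - 1" by simp
        have "(\<Sum>j<n. G (int j)) = (if n = 0 then 0 else if n = 1 then 1 else 0)" for n
          by (induction n) (auto simp: G_def pairing_coeff_def mm)
        with b mm show ?thesis by (auto simp: G_def pairing_coeff_def)
      qed
      finally show ?thesis using b by (auto simp: G_def)
    qed
  qed
qed (auto simp: pairing_coeff_def)

text \<open>\<open>E_plus\<close> with index b lowers the Heisenberg weight by b, and a charged
  vacuum has weight 0, so only b = 0 contributes.\<close>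

lemma lattice_mode_vacuum: "lattice_mode m n (ket (p, {#})) = E_minus m (m * p - n - 1) (ket (p + m, {#}))"
proof -
  have "half_vertex (- of_int m) 1 b (ket (p + m, {#})) \<in> graded_part (p + m) (int (lattice_weight (p + m, {#})) - 1 * b)"
    for b by (intro half_vertex_graded ket_graded_part) simp
  then have "E_plus m b (ket (p + m, {#})) = 0" if "b \<noteq> 0" for b
    using graded_part_neg[of "E_plus m b (ket (p + m, {#}))" "p + m" "- b"] that
    by (cases "b < 0") (simp_all add: E_plus_def[symmetric] lattice_weight_def)
  then have "Sum_any (\<lambda>b. E_minus m (b + (m * p - n - 1)) (E_plus m b (charge_shift m (ket (p, {#})))))
    = (\<Sum>b\<in>{0}. E_minus m (b + (m * p - n - 1)) (E_plus m b (charge_shift m (ket (p, {#})))))"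
    by (intro Sum_any.expand_superset) (auto simp: clinear_E intro: ccontr)
  then show ?thesis unfolding lattice_mode_ket by simp
qed

lemma charge_shift_E_minus: "charge_shift k (E_minus m a v) = E_minus m a (charge_shift k v)"
proof (cases "a < 0")
  case False
  let ?A = "\<lambda>j u. cscale (of_int m / of_nat j) (heis (- 1 * int j) u)"
  have B: "charge_shift k (?A j v) = ?A j (charge_shift k v) + cscale 0 v" if "j > 0" for j v
    using that charge_shift_heis[of "- 1 * int j" k v] by (simp add: clinear_cscale[OF clinear_charge_shift])
  have "charge_shift k (exp_coeff ?A (nat a) v) = exp_coeff ?A (nat a) (charge_shift k v)
      + (\<Sum>j=1..nat a. cscale 0 (exp_coeff ?A (nat a - j) v))"
    by (rule exp_coeff_commutator[OF _ _ clinear_charge_shift B])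
      (rule heis_scaled_linear heis_sign_commute; simp)+
  with False show ?thesis by (simp add: E_minus_def half_vertex_def)
qed (simp add: clinear_charge_shift)

text \<open>On the vacuum of charge p the generating function is z^(-m(p+m')) w^(-m' p) (1 -
  w/z)^(-m m'): the outer creation part contributes only its constant term, and the outer
  annihilation part meets the inner creation part.\<close>

lemma vac_coeff_lattice_modes:
  assumes "m * m' = 1 \<or> m * m' = - 1"
  shows "vac_coeff q (lattice_mode m a (lattice_mode m' b (ket (p, {#}))))
    = (if q = p + m' + m \<and> a + 1 - m * (p + m') = m' * p - b - 1
       then pairing_coeff (m * m') (a + 1 - m * (p + m')) else 0)"
proof -
  let ?v = "E_minus m' (m' * p - b - 1) (ket (p + m', {#}))"
  let ?c = "m * (p + m') - a - 1"
  have shift: "charge_shift m ?v = E_minus m' (m' * p - b - 1) (ket (p + m' + m, {#}))"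
    by (simp add: charge_shift_E_minus)
  have "?v \<in> graded_part (p + m') (0 + m' * p - b - 1)"
    using lattice_mode_graded[OF ket_graded_part[of p "{#}"], of m' b]
    by (simp add: lattice_mode_vacuum lattice_weight_def)
  then have "lattice_mode m a ?v = Sum_any (\<lambda>i. E_minus m (i + ?c) (E_plus m i (charge_shift m ?v)))"
    by (intro lattice_mode_eq) (rule graded_part_fst)
  then have "vac_coeff q (lattice_mode m a ?v)
    = Sum_any (\<lambda>i. vac_coeff q (E_minus m (i + ?c) (E_plus m i (charge_shift m ?v))))"
    by (simp only: lookup_Sum_any[OF finite_vertex_sum])
  also have "\<dots> = Sum_any (\<lambda>i. if i = - ?c then vac_coeff q (E_plus m i (charge_shift m ?v)) else 0)"
    unfolding vac_coeff_E_minus by (intro Sum_any.cong) auto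
  also have "\<dots> = vac_coeff q (E_plus m (- ?c) (charge_shift m ?v))"
    by simp
  finally show ?thesis
    unfolding lattice_mode_vacuum shift vac_coeff_E_plus_E_minus[OF assms] by (auto simp: algebra_simps)
qed


section \<open>Quadratic relations between vertex operators\<close>

lemma lookup_heis_annihilation:
  "Poly_Mapping.lookup (heis (int (Suc j)) v) (q, N)
    = - of_nat (Suc j) * of_nat (Suc (count N j)) * Poly_Mapping.lookup v (q, add_mset j N)"
proof -
  have "Poly_Mapping.lookup (heis (int (Suc j)) (ket (p, M))) (q, N)
      = (if (p, M) = (q, add_mset j N) then - of_nat (Suc j) * of_nat (Suc (count N j)) else 0)" for p M
  proof (cases "j \<in># M")
    case True
    then obtain M' where "M = add_mset j M'" by (metis multi_member_split)
    then show ?thesis by (auto simp: heis_ket lookup_ket nat_add_distrib)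
  next
    case False
    then show ?thesis by (auto simp: heis_ket not_in_iff nat_add_distrib)
  qed
  note ket = this
  have "Poly_Mapping.lookup (heis (int (Suc j)) v) (q, N)
    = (\<Sum>x\<in>Poly_Mapping.keys v. if x = (q, add_mset j N)
        then - of_nat (Suc j) * of_nat (Suc (count N j)) * Poly_Mapping.lookup v x else 0)"
    unfolding clinear_eq_lin_ext[OF clinear_heis, of _ v] lookup_lin_ext
  proof (rule sum.cong)
    fix x
    show "Poly_Mapping.lookup v x * Poly_Mapping.lookup (heis (int (Suc j)) (ket x)) (q, N)
      = (if x = (q, add_mset j N)
         then - of_nat (Suc j) * of_nat (Suc (count N j)) * Poly_Mapping.lookup v x else 0)"
      using ket[of "fst x" "snd x"] by (simp del: of_nat_Suc)
  qed simp
  then show ?thesis by (simp add: in_keys_iff del: of_nat_Suc)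
qed

text \<open>A coefficient at a nonempty multiset \<open>add_mset j N\<close> is seen, up to a
  nonzero factor, by \<beta>(j + 1) at \<open>N\<close>; only the charged vacua escape.\<close>

lemma singular_eq_0:
  assumes "\<And>k. k > 0 \<Longrightarrow> heis k v = 0" "\<And>q. vac_coeff q v = 0"
  shows "v = 0"
proof (rule poly_mapping_eqI)
  fix x :: lattice_basis
  obtain q M where x: "x = (q, M)" by force
  show "Poly_Mapping.lookup v x = Poly_Mapping.lookup 0 x"
  proof (cases M)
    case empty
    then show ?thesis using assms(2) x by simp
  next
    case (add j N)
    have "Poly_Mapping.lookup (heis (int (Suc j)) v) (q, N) = 0" using assms(1) by simp
    then show ?thesis unfolding lookup_heis_annihilation x add by (simp del: of_nat_Suc)
  qed
qed

text \<open>
  A family of operators with rank \<open>r\<close> for which \<open>[\<beta>(k), T i]\<close> involves only operators of rank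
  \<open>r i + k\<close> is determined by its vacuum coefficients: on the vacuum vectors it vanishes by
  downward induction on the rank, and then the creation operators propagate this.
\<close>

lemma family_eq_0:
  fixes T :: "'i \<Rightarrow> lattice_space \<Rightarrow> lattice_space" and r :: "'i \<Rightarrow> int"
  assumes lin: "\<And>i. clinear (T i)"
    and comm: "\<And>i k v. k \<noteq> 0 \<Longrightarrow> (\<And>j. r j = r i + k \<Longrightarrow> T j v = 0) \<Longrightarrow> heis k (T i v) = T i (heis k v)"
    and vac: "\<And>i p q. vac_coeff q (T i (ket (p, {#}))) = 0"
    and bound: "\<And>p. \<exists>N. \<forall>i. r i \<ge> N \<longrightarrow> T i (ket (p, {#})) = 0"
  shows "T i v = 0"
proof -
  have vacuum: "T i (ket (p, {#})) = 0" for i p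
  proof -
    obtain N where N: "\<And>i. r i \<ge> N \<Longrightarrow> T i (ket (p, {#})) = 0" using bound[of p] by blast
    show ?thesis
    proof (induction "nat (N - r i)" arbitrary: i rule: less_induct)
      case less
      show ?case
      proof (cases "r i \<ge> N")
        case False
        have "heis k (T i (ket (p, {#}))) = 0" if "k > 0" for k
        proof -
          have "heis k (T i (ket (p, {#}))) = T i (heis k (ket (p, {#})))"
            using that False by (intro comm less.hyps) auto
          also have "heis k (ket (p, {#})) = 0" using that by (simp add: heis_ket)
          finally show ?thesis by (simp add: lin)
        qed
        then show ?thesis by (rule singular_eq_0[OF _ vac])
      qed (rule N)
    qed
  qed
  have "T i (ket (p, M)) = 0" for i p M
  proof (induction M arbitrary: i)
    case (add x M)
    have "ket (p, add_mset x M) = heis (- int (Suc x)) (ket (p, M))"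
      by (simp add: heis_ket nat_add_distrib)
    then have "T i (ket (p, add_mset x M)) = heis (- int (Suc x)) (T i (ket (p, M)))"
      by (simp only:) (rule comm[symmetric]; simp add: add.IH)
    then show ?case by (simp add: add.IH clinear_heis)
  qed (rule vacuum)
  then show ?thesis using clinear_ext[OF lin clinear_zero, of i v] by fast
qed

lemma heis_lattice_modes:
  "heis k (lattice_mode m a (lattice_mode m' b v)) = lattice_mode m a (lattice_mode m' b (heis k v))
    - cscale (of_int m) (lattice_mode m (a + k) (lattice_mode m' b v))
    - cscale (of_int m') (lattice_mode m a (lattice_mode m' (b + k) v))"
  unfolding lattice_mode_heis
  by (simp only: clinear_diff[OF clinear_lattice_mode] clinear_cscale[OF clinear_lattice_mode]) (simp only: algebra_simps)

lemma clinear_lattice_modes: "clinear (\<lambda>v. lattice_mode m a (lattice_mode m' b v))"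
  by (intro clinear_comp[OF clinear_lattice_mode] clinear_lattice_mode)

lemma lattice_modes_vacuum_eq_0:
  assumes "a + b > m' * p + m * (p + m') - 2"
  shows "lattice_mode m a (lattice_mode m' b (ket (p, {#}))) = 0"
proof (rule graded_part_neg)
  show "lattice_mode m a (lattice_mode m' b (ket (p, {#})))
    \<in> graded_part (p + m' + m) (int (lattice_weight (p, {#})) + m' * p - b - 1 + m * (p + m') - a - 1)"
    by (intro lattice_mode_graded ket_graded_part)
  show "int (lattice_weight (p, {#})) + m' * p - b - 1 + m * (p + m') - a - 1 < 0"
    using assms by (simp add: lattice_weight_def)
qed

definition anticommutator :: "int \<Rightarrow> int \<Rightarrow> int \<Rightarrow> int \<Rightarrow> lattice_space \<Rightarrow> lattice_space"
  where "anticommutator m a m' b v =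
    lattice_mode m a (lattice_mode m' b v) + lattice_mode m' b (lattice_mode m a v)"

lemma clinear_anticommutator: "clinear (anticommutator m a m' b)"
  unfolding anticommutator_def[abs_def] by (intro clinear_plus clinear_lattice_modes)

lemma anticommutator_heis:
  "heis k (anticommutator m a m' b v) = anticommutator m a m' b (heis k v)
    - cscale (of_int m) (anticommutator m (a + k) m' b v)
    - cscale (of_int m') (anticommutator m a m' (b + k) v)"
  unfolding anticommutator_def clinear_add[OF clinear_heis] heis_lattice_modes cvs.scale_right_distrib
  by (simp only: algebra_simps)

lemma anticommutator_vacuum_eq_0:
  assumes "a + b > m' * p + m * (p + m') - 2"
  shows "anticommutator m a m' b (ket (p, {#})) = 0"
  using lattice_modes_vacuum_eq_0[of m' p m a b] lattice_modes_vacuum_eq_0[of m p m' b a] assms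
  by (simp add: anticommutator_def algebra_simps)

text \<open>The vacuum coefficients of the two orders are those of z^(-p) w^p (z - w) and z^(-p) w^p
  (w - z). The rank a + b is suitable because \<beta>(k) raises one of the two mode numbers by
  k.\<close>

lemma anticommutator_opposite: "anticommutator 1 a (- 1) b v = 0"
proof -
  let ?T = "\<lambda>(a, b). anticommutator 1 a (- 1) b"
  have "?T (a, b) v = 0"
  proof (rule family_eq_0[where T = ?T and r = "\<lambda>(a, b). a + b"])
    show "clinear (?T i)" for i by (cases i) (simp add: clinear_anticommutator)
    show "heis k (?T i v) = ?T i (heis k v)"
      if *: "\<And>j. (case j of (a, b) \<Rightarrow> a + b) = (case i of (a, b) \<Rightarrow> a + b) + k \<Longrightarrow> ?T j v = 0" for i k v
    proof -
      obtain a b where i: "i = (a, b)" by force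
      show ?thesis
        using *[of "(a + k, b)"] *[of "(a, b + k)"] by (simp add: i anticommutator_heis)
    qed
    show "vac_coeff q (?T i (ket (p, {#}))) = 0" for i p q
      by (cases i) (auto simp: anticommutator_def lookup_add vac_coeff_lattice_modes pairing_coeff_def)
    show "\<exists>N. \<forall>i. (case i of (a, b) \<Rightarrow> a + b) \<ge> N \<longrightarrow> ?T i (ket (p, {#})) = 0" for p
      by (intro exI[of _ 0] allI) (auto intro: anticommutator_vacuum_eq_0)
  qed
  then show ?thesis by simp
qed

text \<open>In generating functions, (z - w) times the anticommutator vanishes: multiplication by z
  or w raises the corresponding mode number, and the simple pole is cleared.\<close>

lemma anticommutator_shift_1:
  assumes "m * m = 1"
  shows "anticommutator m (a + 1) m b v = anticommutator m a m (b + 1) v"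
proof -
  let ?T = "\<lambda>(a, b) v. anticommutator m (a + 1) m b v - anticommutator m a m (b + 1) v"
  have "?T (a, b) v = 0"
  proof (rule family_eq_0[where T = ?T and r = "\<lambda>(a, b). a + b"])
    show "clinear (?T i)" for i
      by (cases i) (simp add: clinear_anticommutator clinear_sub)
    show "heis k (?T i v) = ?T i (heis k v)"
      if *: "\<And>j. (case j of (a, b) \<Rightarrow> a + b) = (case i of (a, b) \<Rightarrow> a + b) + k \<Longrightarrow> ?T j v = 0" for i k v
    proof -
      obtain a b where i: "i = (a, b)" by force
      show ?thesis
        using *[of "(a + k, b)"] *[of "(a, b + k)"]
        by (simp add: i anticommutator_heis clinear_diff[OF clinear_heis] add_ac)
    qed
    have m: "m * (p + m) = m * p + 1" "m * (m + x) = 1 + m * x" for p x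
      using assms by (simp_all add: distrib_left)
    show "vac_coeff q (?T i (ket (p, {#}))) = 0" for i p q
      by (cases i) (auto simp: anticommutator_def lookup_add lookup_minus vac_coeff_lattice_modes assms
          pairing_coeff_def m)
    show "\<exists>N. \<forall>i. (case i of (a, b) \<Rightarrow> a + b) \<ge> N \<longrightarrow> ?T i (ket (p, {#})) = 0" for p
      by (intro exI[of _ "m * p + m * (p + m)"] allI) (auto simp: anticommutator_vacuum_eq_0)
  qed
  then show ?thesis by simp
qed

lemma anticommutator_shift:
  assumes "m * m = 1"
  shows "anticommutator m (a + k) m b v = anticommutator m a m (b + k) v"
proof (induction k arbitrary: a b rule: int_induct[where k = 0])
  case (step1 i)
  show ?case
    using anticommutator_shift_1[OF assms, of "a + i" b v] step1(2)[of a "b + 1"] by (simp add: add_ac)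
next
  case (step2 i)
  show ?case
    using anticommutator_shift_1[OF assms, of "a + i - 1" "b - 1" v] step2(2)[of a "b - 1"]
    by (simp add: algebra_simps)
qed simp

lemma anticommutator_diagonal:
  assumes "m * m = 1"
  shows "anticommutator m a m b v = anticommutator m 0 m (a + b) v"
  using anticommutator_shift[OF assms, of 0 a b v] by (simp add: add.commute)


text \<open>
  \<open>mode_sum c K\<close> is \<open>\<Sum>a. c a e\<^sup>\<beta>\<^sub>a e\<^sup>-\<^sup>\<beta>\<^sub>K\<^sub>-\<^sub>a\<close>; for the polynomials \<open>1\<close>, \<open>a + 1\<close> and \<open>(a + 1)(a + 2)\<close>
  these are, up to sign, the modes of \<open>\<partial>\<^sup>j Y(e\<^sup>\<beta>, z) Y(e\<^sup>-\<^sup>\<beta>, z)\<close> for \<open>j = 0, 1, 2\<close>.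
\<close>

definition mode_sum :: "(int \<Rightarrow> complex) \<Rightarrow> int \<Rightarrow> lattice_space \<Rightarrow> lattice_space"
  where "mode_sum c K v = Sum_any (\<lambda>a. cscale (c a) (lattice_mode 1 a (lattice_mode (- 1) (K - a) v)))"

lemma lattice_modes_anticommute:
  "lattice_mode 1 a (lattice_mode (- 1) b v) = - lattice_mode (- 1) b (lattice_mode 1 a v)"
  using anticommutator_opposite[of a b v] by (simp add: anticommutator_def eq_neg_iff_add_eq_0)

text \<open>For small a the inner mode K - a is large and kills v. For large a the same is seen only
  after anticommuting the two factors.\<close>

lemma finite_mode_sum:
  "finite {a. cscale (c a) (lattice_mode 1 a (lattice_mode (- 1) (K - a) v)) \<noteq> 0}"
proof -
  obtain N where N: "\<And>n. n \<ge> N \<Longrightarrow> lattice_mode 1 n v = 0"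
    using is_field_lattice_mode[of 1] unfolding is_field_def by meson
  obtain M where M: "\<And>n. n \<ge> M \<Longrightarrow> lattice_mode (- 1) n v = 0"
    using is_field_lattice_mode[of "- 1"] unfolding is_field_def by meson
  show ?thesis
  proof (rule finite_int_bounded[of N _ "K - M"])
    show "\<not> cscale (c a) (lattice_mode 1 a (lattice_mode (- 1) (K - a) v)) \<noteq> 0" if "a \<ge> N" for a
      unfolding lattice_modes_anticommute using N[OF that] by (simp add: clinear_lattice_mode)
    show "\<not> cscale (c a) (lattice_mode 1 a (lattice_mode (- 1) (K - a) v)) \<noteq> 0" if "a \<le> K - M" for a
      using M[of "K - a"] that by (simp add: clinear_lattice_mode)
  qed
qed

lemma clinear_mode_sum: "clinear (mode_sum c K)"
  unfolding mode_sum_def[abs_def]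
  by (intro clinear_Sum_any_family finite_mode_sum clinear_scaled clinear_lattice_modes)

lemma mode_sum_add: "mode_sum (\<lambda>a. c a + d a) K v = mode_sum c K v + mode_sum d K v"
  unfolding mode_sum_def cvs.scale_left_distrib by (rule Sum_any.distrib[OF finite_mode_sum finite_mode_sum])

lemma mode_sum_scale: "mode_sum (\<lambda>a. x * c a) K v = cscale x (mode_sum c K v)"
  unfolding mode_sum_def clinear_Sum_any[OF clinear_scaled[OF clinear_id(1)] finite_mode_sum] by simp

lemma mode_sum_diff: "mode_sum (\<lambda>a. c a - d a) K v = mode_sum c K v - mode_sum d K v"
  using mode_sum_add[of c "\<lambda>a. - 1 * d a" K v] unfolding mode_sum_scale by simp

text \<open>\<beta>(k) acts on the weights as the difference operator c(a) - c(a - k). It lowers the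
  degree of a polynomial, so the moments can be computed one degree after the other.\<close>

lemma mode_sum_heis:
  "heis k (mode_sum c K v) = mode_sum c K (heis k v) + mode_sum (\<lambda>a. c a - c (a - k)) (K + k) v"
proof -
  let ?t = "\<lambda>a. cscale (c a) (lattice_mode 1 a (lattice_mode (- 1) (K - a) (heis k v)))"
  let ?s = "\<lambda>a. cscale (c a) (lattice_mode 1 a (lattice_mode (- 1) (K + k - a) v))"
  let ?r = "\<lambda>a. cscale (c (a - k)) (lattice_mode 1 a (lattice_mode (- 1) (K + k - a) v))"
  have fin: "finite {a. ?t a \<noteq> 0}" "finite {a. ?s a \<noteq> 0}" "finite {a. ?r a \<noteq> 0}"
    by (rule finite_mode_sum)+
  have "{a. ?r (a + k) \<noteq> 0} = (\<lambda>a. a + k) -` {a. ?r a \<noteq> 0}" by auto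
  also have "finite \<dots>" by (intro finite_vimageI fin) simp
  finally have fin': "finite {a. - ?r (a + k) \<noteq> 0}" by simp
  have "heis k (mode_sum c K v) = Sum_any (\<lambda>a. ?t a + (?s a + - ?r (a + k)))"
    unfolding mode_sum_def clinear_Sum_any[OF clinear_heis finite_mode_sum] clinear_cscale[OF clinear_heis]
      heis_lattice_modes
    by (intro Sum_any.cong) (simp add: cvs.scale_right_distrib cvs.scale_right_diff_distrib algebra_simps)
  also have "\<dots> = Sum_any ?t + (Sum_any ?s + Sum_any (\<lambda>a. - ?r (a + k)))"
    by (subst Sum_any.distrib[OF fin(1)], rule finite_subset[OF _ finite_UnI[OF fin(2) fin']], force)
      (subst Sum_any.distrib[OF fin(2) fin'], rule refl)
  also have "Sum_any (\<lambda>a. - ?r (a + k)) = Sum_any (\<lambda>a. - ?r a)"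
    by (rule Sum_any_shift)
  also have "\<dots> = - Sum_any ?r"
    using clinear_Sum_any[OF clinear_scaled[OF clinear_id(1), of "- 1"] fin(3)] by simp
  finally show ?thesis unfolding mode_sum_diff by (simp add: mode_sum_def)
qed

text \<open>The pairing series is 1 - x. Its two terms occur at a = p - 2 and a = p - 1, and both
  force K = -3.\<close>

lemma vac_coeff_mode_sum:
  "vac_coeff q (mode_sum c K (ket (p, {#}))) = (if q = p \<and> K = - 3 then c (p - 2) - c (p - 1) else 0)"
proof -
  have "vac_coeff q (mode_sum c K (ket (p, {#})))
    = Sum_any (\<lambda>a. if q = p \<and> K = - 3 \<and> (a = p - 2 \<or> a = p - 1)
        then if a = p - 2 then c a else - c a else 0)" (is "_ = Sum_any ?f")
    unfolding mode_sum_def lookup_Sum_any[OF finite_mode_sum]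
    by (intro Sum_any.cong) (auto simp: vac_coeff_lattice_modes pairing_coeff_def)
  also have "\<dots> = sum ?f {p - 2, p - 1}"
    by (rule Sum_any.expand_superset) auto
  finally show ?thesis by auto
qed

lemma mode_sum_vacuum_eq_0:
  assumes "K \<ge> 0"
  shows "mode_sum c K (ket (p, {#})) = 0"
  unfolding mode_sum_def using assms by (simp add: lattice_modes_vacuum_eq_0)

text \<open>The simple zero at z = w: a constant weight has vanishing differences and equal values
  at the two relevant modes.\<close>

lemma mode_sum_0: "mode_sum (\<lambda>_. 1) K v = 0"
proof (rule family_eq_0[where T = "mode_sum (\<lambda>_. 1)" and r = "\<lambda>K. K"])
  have 0: "mode_sum (\<lambda>_. 0) K v = 0" for K v by (simp add: mode_sum_def)
  show "heis k (mode_sum (\<lambda>_. 1) K v) = mode_sum (\<lambda>_. 1) K (heis k v)" for k K v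
    by (simp add: mode_sum_heis 0)
qed (auto simp: clinear_mode_sum vac_coeff_mode_sum intro: mode_sum_vacuum_eq_0)

lemma mode_sum_const: "mode_sum (\<lambda>_. x) K v = 0"
  using mode_sum_scale[of x "\<lambda>_. 1"] by (simp add: mode_sum_0)

text \<open>The difference of the weight is the constant k, so all commutators with \<beta>(k)
  vanish by \<open>mode_sum_const\<close>; what remains is (p - 1) - p = -1 at K = -3.\<close>

lemma mode_sum_1: "mode_sum (\<lambda>a. of_int a + 1) K v = (if K = - 3 then - v else 0)"
proof -
  let ?c = "\<lambda>a. of_int a + 1 :: complex"
  have lin: "clinear (\<lambda>v. (if K = - 3 then v else 0) :: lattice_space)" for K
    by (cases "K = - 3") (simp_all add: clinear_zero clinear_id)
  let ?T = "\<lambda>K v. mode_sum ?c K v + (if K = - 3 then v else 0)"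
  have "?T K v = 0"
  proof (rule family_eq_0[where T = ?T and r = "\<lambda>K. K"])
    show "clinear (?T K)" for K by (intro clinear_plus clinear_mode_sum lin)
    show "heis k (?T K v) = ?T K (heis k v)" for k K v
      by (simp add: clinear_add[OF clinear_heis] mode_sum_heis mode_sum_const clinear_heis)
    show "vac_coeff q (?T K (ket (p, {#}))) = 0" for q K p
      by (simp add: lookup_add vac_coeff_mode_sum lookup_ket)
    show "\<exists>N. \<forall>K. K \<ge> N \<longrightarrow> ?T K (ket (p, {#})) = 0" for p
      by (intro exI[of _ 0]) (simp add: mode_sum_vacuum_eq_0)
  qed
  then show ?thesis by (simp add: add_eq_0_iff2 split: if_splits)
qed

text \<open>The difference of the weight is 2k (a + 1) plus a constant, so by
  \<open>mode_sum_1\<close> the commutator with \<beta>(k) is the scalar -2k at K + k = -3, as for 2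
  \<beta>(K + 3). The vacuum values agree too: (p - 1) p - p (p + 1) = -2p.\<close>

lemma mode_sum_2: "mode_sum (\<lambda>a. (of_int a + 1) * (of_int a + 2)) K v = cscale 2 (heis (K + 3) v)"
proof -
  let ?c = "\<lambda>a. (of_int a + 1) * (of_int a + 2) :: complex"
  let ?T = "\<lambda>K v. mode_sum ?c K v - cscale 2 (heis (K + 3) v)"
  have "?T K v = 0"
  proof (rule family_eq_0[where T = ?T and r = "\<lambda>K. K"])
    show "clinear (?T K)" for K by (intro clinear_sub clinear_mode_sum clinear_scaled clinear_heis)
    show "heis k (?T K v) = ?T K (heis k v)" for k K v
    proof -
      have c: "?c a - ?c (a - k) = (2 * of_int k) * (of_int a + 1) + (of_int k - of_int k * of_int k)" for a
        by (simp add: algebra_simps)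
      have "mode_sum (\<lambda>a. ?c a - ?c (a - k)) (K + k) v
        = cscale 2 (if K + k = - 3 then cscale (- of_int k) v else 0)"
        unfolding c by (subst mode_sum_add) (simp add: mode_sum_scale mode_sum_const mode_sum_1)
      moreover have "heis k (heis (K + 3) v)
        = heis (K + 3) (heis k v) + (if K + k = - 3 then cscale (- of_int k) v else 0)"
      proof -
        have "k + (K + 3) = 0 \<longleftrightarrow> K + k = - 3" by linarith
        then show ?thesis using heis_commutator[of k "K + 3" v] by (simp only: diff_eq_eq add.commute)
      qed
      ultimately show ?thesis
        unfolding clinear_diff[OF clinear_heis] clinear_cscale[OF clinear_heis] mode_sum_heis
        by (simp only: cvs.scale_right_distrib) (simp only: algebra_simps)
    qed
    show "vac_coeff q (?T K (ket (p, {#}))) = 0" for q K p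
      by (auto simp: lookup_minus vac_coeff_mode_sum heis_ket lookup_ket algebra_simps)
    show "\<exists>N. \<forall>K. K \<ge> N \<longrightarrow> ?T K (ket (p, {#})) = 0" for p
      by (intro exI[of _ 0]) (simp add: mode_sum_vacuum_eq_0 heis_ket)
  qed
  then show ?thesis by simp
qed


section \<open>Tensor products of fields\<close>

lemma tensor_linear_right: "clinear (tensor x)"
  by (rule clinearI; rule poly_mapping_eqI)
    (simp_all add: split_paired_all lookup_tensor lookup_add algebra_simps)

lemma tensor_linear_left: "clinear (\<lambda>x. tensor x y)"
  by (rule clinearI; rule poly_mapping_eqI)
    (simp_all add: split_paired_all lookup_tensor lookup_add algebra_simps)

lemma tensor_ket: "tensor (ket s) (ket t) = ket (s, t)"
  by (rule poly_mapping_eqI) (auto simp: split_paired_all lookup_tensor lookup_ket)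

lemma tensor_0 [simp]: "tensor 0 y = 0" "tensor x 0 = 0"
  using clinear_0[OF tensor_linear_left, of y] clinear_0[OF tensor_linear_right, of x] by simp_all

lemma tensor_minus: "tensor (- x) y = - tensor x y" "tensor x (- y) = - tensor x y"
  by (rule clinear_minus[OF tensor_linear_left]) (rule clinear_minus[OF tensor_linear_right])

lemma tensor_ext:
  assumes "clinear A" "clinear B" "\<And>s t. A (tensor (ket s) (ket t)) = B (tensor (ket s) (ket t))"
  shows "A v = B v"
proof (rule clinear_ext[OF assms(1,2)])
  show "A (ket x) = B (ket x)" for x
    using assms(3)[of "fst x" "snd x"] by (simp add: tensor_ket)
qed

lemma clinear_tensor_op: "clinear (tensor_op A B)"
  by (simp add: tensor_op_def linear_lin_ext)

lemma Sum_any_pairs: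
  assumes "finite {(i, j). F i j \<noteq> 0}"
  shows "Sum_any (\<lambda>j. Sum_any (\<lambda>i. F i j)) = Sum_any (\<lambda>(i, j). F i j)"
proof -
  let ?S = "{(i, j). F i j \<noteq> 0}"
  have "Sum_any (\<lambda>j. Sum_any (\<lambda>i. F i j)) = Sum_any (\<lambda>(j, i). F i j)"
    using assms by (intro Sum_any.cartesian_product[of "snd ` ?S \<times> fst ` ?S"]) (auto simp: image_iff)
  also have "\<dots> = Sum_any (\<lambda>(i, j). F i j)"
    by (rule Sum_any.reindex_cong[where l = prod.swap, symmetric]) auto
  finally show ?thesis .
qed

text \<open>The common shape of e(m) and f(m), so that gradings and the stripping of vertex
  operators are treated once for both.\<close>

definition field_sum ::
    "complex \<Rightarrow> 'a modes \<Rightarrow> 'b modes \<Rightarrow> int \<Rightarrow> ('a \<times> 'b \<Rightarrow>\<^sub>0 complex) \<Rightarrow> ('a \<times> 'b \<Rightarrow>\<^sub>0 complex)"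
  where "field_sum c a b m v =
    Sum_any (\<lambda>i. cscale (c - of_int i) (tensor_op (a (i - 1)) (b (m - i - 1)) v))"

lemma E_basis_action_field_sum:
  "E_basis_action lam mu (Loop Sl2_e m) = field_sum lam psi_plus (lattice_mode 1) m"
  "E_basis_action lam mu (Loop Sl2_f m) = field_sum mu psi_minus (lattice_mode (- 1)) m"
  by (simp_all add: field_sum_def fun_eq_iff)

lemma field_linear: "is_field a \<Longrightarrow> clinear (a n)"
  by (simp add: is_field_def)

lemma clinear_field_sum:
  assumes "is_field a" "is_field b"
  shows "clinear (field_sum c a b m)"
  unfolding field_sum_def[abs_def]
  by (intro clinear_Sum_any_family finite_tensor_modes assms clinear_scaled clinear_tensor_op)

lemma finite_tensor_field:
  assumes "is_field a" "is_field b"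
  shows "finite {i::int. cscale (c i) (tensor (a (i - 1) x) (b (m - i - 1) y)) \<noteq> 0}"
  using finite_tensor_modes[OF assms, of c m "tensor x y"]
  by (simp add: tensor_op_tensor field_linear assms)

lemma field_sum_tensor:
  assumes "is_field a" "is_field b"
  shows "field_sum c a b m (tensor x y)
    = Sum_any (\<lambda>i. cscale (c - of_int i) (tensor (a (i - 1) x) (b (m - i - 1) y)))"
  by (simp add: field_sum_def tensor_op_tensor field_linear assms)

lemma finite_tensor_field_field:
  assumes "is_field a" "is_field b" "is_field c" "is_field d"
  shows "finite {(i::int, j::int). cscale (u i j) (tensor (a (i - 1) (c (j - 1) x)) (b (m - i - 1) (d (n - j - 1) y))) \<noteq> 0}"
proof -
  let ?J = "{j. cscale 1 (tensor (c (j - 1) x) (d (n - j - 1) y)) \<noteq> 0}"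
  let ?I = "\<lambda>j. {i. cscale 1 (tensor (a (i - 1) (c (j - 1) x)) (b (m - i - 1) (d (n - j - 1) y))) \<noteq> 0}"
  have "tensor (a (i - 1) (c (j - 1) x)) (b (m - i - 1) (d (n - j - 1) y))
    = tensor_op (a (i - 1)) (b (m - i - 1)) (tensor (c (j - 1) x) (d (n - j - 1) y))" for i j
    by (simp add: tensor_op_tensor field_linear assms)
  then have "{(i, j). cscale (u i j) (tensor (a (i - 1) (c (j - 1) x)) (b (m - i - 1) (d (n - j - 1) y))) \<noteq> 0}
    \<subseteq> prod.swap ` (SIGMA j:?J. ?I j)"
    by (auto simp: image_iff clinear_tensor_op)
  moreover have "finite (SIGMA j:?J. ?I j)"
    by (intro finite_SigmaI finite_tensor_field assms)
  ultimately show ?thesis by (rule finite_subset[OF _ finite_imageI])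
qed

lemma field_sum_field_sum:
  assumes "is_field a" "is_field b" "is_field c" "is_field d"
  shows "field_sum l a b m (field_sum l' c d n (tensor x y))
    = Sum_any (\<lambda>(i, j). cscale ((l - of_int i) * (l' - of_int j))
        (tensor (a (i - 1) (c (j - 1) x)) (b (m - i - 1) (d (n - j - 1) y))))"
proof -
  have "field_sum l a b m (field_sum l' c d n (tensor x y))
    = Sum_any (\<lambda>j. cscale (l' - of_int j) (field_sum l a b m (tensor (c (j - 1) x) (d (n - j - 1) y))))"
    unfolding field_sum_tensor[OF assms(3,4)]
      clinear_Sum_any[OF clinear_field_sum[OF assms(1,2)] finite_tensor_field[OF assms(3,4)]]
    by (simp add: clinear_cscale[OF clinear_field_sum[OF assms(1,2)]])
  also have "\<dots> = Sum_any (\<lambda>j. Sum_any (\<lambda>i. cscale ((l - of_int i) * (l' - of_int j))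
        (tensor (a (i - 1) (c (j - 1) x)) (b (m - i - 1) (d (n - j - 1) y)))))"
    unfolding field_sum_tensor[OF assms(1,2)]
      clinear_Sum_any[OF clinear_scaled[OF clinear_id(1)] finite_tensor_field[OF assms(1,2)]]
    by (simp add: mult.commute)
  finally show ?thesis
    by (simp only: Sum_any_pairs[OF finite_tensor_field_field[OF assms]])
qed

lemma Sum_any_swap: "Sum_any (\<lambda>(j, i). F i j) = Sum_any (\<lambda>(i, j). F i j)"
  by (rule Sum_any.reindex_cong[where l = prod.swap, symmetric]) auto

lemma Sum_any_antisymmetric:
  fixes F :: "'i \<Rightarrow> 'i \<Rightarrow> ('a \<Rightarrow>\<^sub>0 complex)"
  assumes "finite {(i, j). F i j \<noteq> 0}" "\<And>i j. F j i = - F i j"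
  shows "Sum_any (\<lambda>(i, j). F i j) = 0"
proof -
  let ?S = "Sum_any (\<lambda>(i, j). F i j)"
  have "?S = Sum_any (\<lambda>(i, j). F j i)"
    by (rule Sum_any_swap)
  also have "\<dots> = Sum_any (\<lambda>p. - (case p of (i, j) \<Rightarrow> F i j))"
    by (intro Sum_any.cong) (auto intro: assms(2))
  also have "\<dots> = - ?S"
    using clinear_Sum_any[OF clinear_scaled[OF clinear_id(1), of "- 1"], of "\<lambda>(i, j). F i j"] assms(1)
    by (simp add: case_prod_unfold)
  finally have "cscale 2 ?S = 0"
    using cvs.scale_left_distrib[of 1 1 ?S] by (simp add: eq_neg_iff_add_eq_0)
  then show ?thesis by simp
qed

lemma Sum_any_diff:
  fixes f g :: "'i \<Rightarrow> 'a :: ab_group_add"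
  assumes "finite {i. f i \<noteq> 0}" "finite {i. g i \<noteq> 0}"
  shows "Sum_any f - Sum_any g = Sum_any (\<lambda>i. f i - g i)"
proof -
  have "finite {i. f i - g i \<noteq> 0}"
    by (rule finite_subset[OF _ finite_UnI[OF assms]]) auto
  then have "Sum_any (\<lambda>i. f i - g i + g i) = Sum_any (\<lambda>i. f i - g i) + Sum_any g"
    using assms by (intro Sum_any.distrib)
  then show ?thesis by simp
qed

text \<open>
  The anticommutator of two modes of the same lattice vertex operator depends only on the sum of
  the modes, so the commutator is a sum over an antisymmetric array.
\<close>

lemma field_sum_commute_same:
  fixes a :: "'a modes"
  assumes a: "is_field a" "\<And>i j x. a i (a j x) + a j (a i x) = 0" and s: "s * s = 1"
  shows "field_sum l a (lattice_mode s) m (field_sum l a (lattice_mode s) n v)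
    = field_sum l a (lattice_mode s) n (field_sum l a (lattice_mode s) m v)"
proof (rule tensor_ext[where A = "\<lambda>v. field_sum l a (lattice_mode s) m (field_sum l a (lattice_mode s) n v)"])
  let ?b = "lattice_mode s"
  note fields = a(1) is_field_lattice_mode[of s]
  show "clinear (\<lambda>v. field_sum l a ?b m (field_sum l a ?b n v))"
    "clinear (\<lambda>v. field_sum l a ?b n (field_sum l a ?b m v))"
    by (intro clinear_comp[OF clinear_field_sum] clinear_field_sum fields)+
  fix S :: 'a and T :: lattice_basis
  define x where "x = ket S"
  define y where "y = (ket T :: lattice_space)"
  define F where "F i j = cscale ((l - of_int i) * (l - of_int j))
      (tensor (a (i - 1) (a (j - 1) x)) (?b (m - i - 1) (?b (n - j - 1) y)))" for i j
  define G where "G j i = cscale ((l - of_int j) * (l - of_int i))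
      (tensor (a (j - 1) (a (i - 1) x)) (?b (n - j - 1) (?b (m - i - 1) y)))" for i j
  define D where "D i j = F i j - G j i" for i j
  have finF: "finite {(i, j). F i j \<noteq> 0}" and finG: "finite {(j, i). G j i \<noteq> 0}"
    unfolding F_def G_def by (intro finite_tensor_field_field fields)+
  have "{(i, j). G j i \<noteq> 0} = prod.swap ` {(j, i). G j i \<noteq> 0}" by auto
  then have finG': "finite {(i, j). G j i \<noteq> 0}" using finG by simp
  have finD: "finite {(i, j). D i j \<noteq> 0}"
    by (rule finite_subset[OF _ finite_UnI[OF finF finG']]) (auto simp: D_def)
  have anti: "a j (a i x) = - a i (a j x)" for i j
    using a(2)[of j i x] by (simp add: eq_neg_iff_add_eq_0)
  \<comment> \<open>The total mode number (m - i - 1) + (n - j - 1) is symmetric in i and j, so the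
    sign under exchange comes from the fermions alone.\<close>
  have D: "D i j = cscale ((l - of_int i) * (l - of_int j))
      (tensor (a (i - 1) (a (j - 1) x)) (anticommutator s 0 s (m + n - i - j - 2) y))" for i j
  proof -
    have "anticommutator s 0 s (m + n - i - j - 2) y = anticommutator s (m - i - 1) s (n - j - 1) y"
      unfolding anticommutator_diagonal[OF s, of "m - i - 1"] by (simp add: algebra_simps)
    then show ?thesis
      unfolding D_def F_def G_def anti[of "j - 1"] anticommutator_def
      by (simp add: tensor_minus clinear_add[OF tensor_linear_right] cvs.scale_right_distrib mult.commute)
  qed
  have D_anti: "D j i = - D i j" for i j
    unfolding D anti[of "j - 1"] by (simp add: tensor_minus algebra_simps)
  have "Sum_any (\<lambda>(i, j). F i j) - Sum_any (\<lambda>(j, i). G j i)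
    = Sum_any (\<lambda>(i, j). F i j) - Sum_any (\<lambda>(i, j). G j i)"
    by (simp only: Sum_any_swap[of "\<lambda>i j. G j i"])
  also have "\<dots> = Sum_any (\<lambda>p. (case p of (i, j) \<Rightarrow> F i j) - (case p of (i, j) \<Rightarrow> G j i))"
    using finF finG' by (intro Sum_any_diff) (simp_all add: case_prod_unfold)
  also have "\<dots> = Sum_any (\<lambda>(i, j). D i j)"
    by (intro Sum_any.cong) (auto simp: D_def)
  also have "\<dots> = 0" by (rule Sum_any_antisymmetric[OF finD D_anti])
  finally show "field_sum l a ?b m (field_sum l a ?b n (tensor (ket S) (ket T)))
    = field_sum l a ?b n (field_sum l a ?b m (tensor (ket S) (ket T)))"
    unfolding field_sum_field_sum[OF fields fields] F_def G_def x_def y_def by simp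
qed

lemma Sum_any_diagonal:
  "Sum_any (\<lambda>(i, j). if i + j = (1::int) then t i else 0) = Sum_any t"
proof -
  have "{p. (case p of (i, j) \<Rightarrow> if i + j = (1::int) then t i else 0) \<noteq> 0} = (\<lambda>i. (i, 1 - i)) ` {i. t i \<noteq> 0}"
    by (auto simp: image_iff split: if_splits)
  moreover have "inj_on (\<lambda>i::int. (i, 1 - i)) X" for X by (auto simp: inj_on_def)
  ultimately show ?thesis by (simp add: Sum_any.expand_set sum.reindex)
qed

text \<open>There is no super sign, but both tensor factors anticommute, so F - G is the fermionic
  anticommutator tensored with one product of vertex operators. It lives on i + j = 1 and leaves a
  single moment sum.\<close>

lemma field_sum_commutator:
  "field_sum l psi_plus (lattice_mode 1) m (field_sum l' psi_minus (lattice_mode (- 1)) n v)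
    - field_sum l' psi_minus (lattice_mode (- 1)) n (field_sum l psi_plus (lattice_mode 1) m v)
    = cscale (- 2) (tensor_op id (heis (m + n)) v)
      + (if m + n = 0 then cscale (l - l' - 2 * of_int m) v else 0)" (is "?L v = ?R v")
proof (rule tensor_ext[where A = ?L and B = ?R])
  note fields = is_field_psi(1) is_field_lattice_mode[of 1] is_field_psi(2) is_field_lattice_mode[of "- 1"]
  note fields' = fields(3,4,1,2)
  show "clinear ?L"
    by (intro clinear_sub clinear_comp[OF clinear_field_sum] clinear_field_sum fields)
  have "clinear (\<lambda>v. if m + n = 0 then cscale (l - l' - 2 * of_int m) v else 0)"
    by (cases "m + n = 0") (simp_all add: clinear_zero clinear_scaled[OF clinear_id(1)])
  then show "clinear ?R"
    by (intro clinear_plus clinear_scaled clinear_tensor_op)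
  fix S :: "int fset" and T :: lattice_basis
  define x where "x = ket S"
  define y where "y = (ket T :: lattice_space)"
  let ?e = "lattice_mode 1" and ?f = "lattice_mode (- 1)"
  define F where "F i j = cscale ((l - of_int i) * (l' - of_int j))
      (tensor (psi_plus (i - 1) (psi_minus (j - 1) x)) (?e (m - i - 1) (?f (n - j - 1) y)))" for i j
  define G where "G j i = cscale ((l' - of_int j) * (l - of_int i))
      (tensor (psi_minus (j - 1) (psi_plus (i - 1) x)) (?f (n - j - 1) (?e (m - i - 1) y)))" for i j
  define t where "t i = tensor x (cscale ((l - of_int i) * (l' - of_int (1 - i))) (?e (m - i - 1) (?f (n + i - 2) y)))" for i
  have finF: "finite {(i, j). F i j \<noteq> 0}" and finG: "finite {(j, i). G j i \<noteq> 0}"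
    unfolding F_def G_def by (intro finite_tensor_field_field fields)+
  have "{(i, j). G j i \<noteq> 0} = prod.swap ` {(j, i). G j i \<noteq> 0}" by auto
  then have finG': "finite {(i, j). G j i \<noteq> 0}" using finG by simp
  have D: "F i j - G j i = (if i + j = 1 then t i else 0)" for i j
  proof -
    have "F i j - G j i = cscale ((l - of_int i) * (l' - of_int j))
      (tensor (psi_plus (i - 1) (psi_minus (j - 1) x) + psi_minus (j - 1) (psi_plus (i - 1) x))
        (?e (m - i - 1) (?f (n - j - 1) y)))"
      unfolding F_def G_def lattice_modes_anticommute[of "m - i - 1" "n - j - 1"]
      by (simp add: tensor_minus clinear_add[OF tensor_linear_left] cvs.scale_right_distrib mult.commute
        flip: minus_add_distrib)
    also have "\<dots> = (if i + j = 1 then t i else 0)"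
    proof (cases "i + j = 1")
      case True
      then have j: "j = 1 - i" and idx: "n - (1 - i) - 1 = n + i - 2" by simp_all
      show ?thesis
        unfolding psi_car(3) t_def j idx by (simp add: clinear_cscale[OF tensor_linear_right])
    qed (simp add: psi_car(3))
    finally show ?thesis .
  qed
  have fin: "finite {i. cscale ((l - of_int i) * (l' - of_int (1 - i))) (?e (m - i - 1) (?f (n + i - 2) y)) \<noteq> 0}"
  proof -
    have "finite {a. cscale 1 (?e a (?f (m + n - 3 - a) y)) \<noteq> 0}" by (rule finite_mode_sum)
    then have "finite ((\<lambda>i. m - i - 1) -` {a. cscale 1 (?e a (?f (m + n - 3 - a) y)) \<noteq> 0})"
      by (rule finite_vimageI) (simp add: inj_on_def)
    then show ?thesis by (rule finite_subset[rotated]) (auto simp: algebra_simps)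
  qed
  \<comment> \<open>Substituting i = m - a - 1 makes a the mode number of e^\<beta>. The weight is
    then expanded in 1, a + 1 and (a + 1)(a + 2), whose moments are known; K = m + n - 3 turns the
    condition K = -3 into m + n = 0.\<close>
  define c where "c a = (l - of_int (m - a - 1)) * (l' - of_int (1 - (m - a - 1)))" for a
  have c: "c a = - 1 * ((of_int a + 1) * (of_int a + 2)) + ((l' - l + 2 * of_int m) * (of_int a + 1)
      + (l - of_int m) * (l' + of_int m - 1))" for a
    by (simp add: c_def algebra_simps)
  have "Sum_any t = tensor x (Sum_any (\<lambda>i. cscale ((l - of_int i) * (l' - of_int (1 - i))) (?e (m - i - 1) (?f (n + i - 2) y))))"
    unfolding t_def by (rule clinear_Sum_any[OF tensor_linear_right fin, symmetric])
  also have "Sum_any (\<lambda>i. cscale ((l - of_int i) * (l' - of_int (1 - i))) (?e (m - i - 1) (?f (n + i - 2) y)))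
    = mode_sum c (m + n - 3) y"
    unfolding mode_sum_def c_def
  proof (rule Sum_any.reindex_cong[where l = "\<lambda>a. m - a - 1"])
    show "bij (\<lambda>a. m - a - 1)" by (rule bijI') (auto intro: exI[of _ "m - _ - 1"])
    have idx: "n + (m - a - 1) - 2 = m + n - 3 - a" "m - (m - a - 1) - 1 = a" for a by simp_all
    show "(\<lambda>i. cscale ((l - of_int i) * (l' - of_int (1 - i))) (?e (m - i - 1) (?f (n + i - 2) y))) \<circ> (\<lambda>a. m - a - 1)
      = (\<lambda>a. cscale ((l - of_int (m - a - 1)) * (l' - of_int (1 - (m - a - 1)))) (?e a (?f (m + n - 3 - a) y)))"
      by (simp only: o_def idx)
  qed
  also have "mode_sum c (m + n - 3) y
    = cscale (- 1) (mode_sum (\<lambda>a. (of_int a + 1) * (of_int a + 2)) (m + n - 3) y)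
      + (cscale (l' - l + 2 * of_int m) (mode_sum (\<lambda>a. of_int a + 1) (m + n - 3) y)
        + mode_sum (\<lambda>_. (l - of_int m) * (l' + of_int m - 1)) (m + n - 3) y)"
    unfolding c[abs_def] mode_sum_scale[symmetric] mode_sum_add[symmetric] ..
  also have "\<dots> = cscale (- 2) (heis (m + n) y)
      + (if m + n = 0 then cscale (l - l' - 2 * of_int m) y else 0)"
    unfolding mode_sum_2 mode_sum_1 mode_sum_const
    by (simp add: cvs.scale_left_diff_distrib cvs.scale_left_distrib)
  finally have t: "Sum_any t = tensor x \<dots>" .
  have "Sum_any (\<lambda>(i, j). F i j) - Sum_any (\<lambda>(j, i). G j i)
    = Sum_any (\<lambda>(i, j). F i j) - Sum_any (\<lambda>(i, j). G j i)"
    by (simp only: Sum_any_swap[of "\<lambda>i j. G j i"])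
  also have "\<dots> = Sum_any (\<lambda>p. (case p of (i, j) \<Rightarrow> F i j) - (case p of (i, j) \<Rightarrow> G j i))"
    using finF finG' by (intro Sum_any_diff) (simp_all add: case_prod_unfold)
  also have "\<dots> = Sum_any (\<lambda>(i, j). if i + j = 1 then t i else 0)"
    by (intro Sum_any.cong) (simp only: D case_prod_unfold)
  also have "\<dots> = Sum_any t" by (rule Sum_any_diagonal)
  finally have eq: "Sum_any (\<lambda>(i, j). F i j) - Sum_any (\<lambda>(j, i). G j i) = Sum_any t" .
  show "?L (tensor (ket S) (ket T)) = ?R (tensor (ket S) (ket T))"
    using eq
    unfolding field_sum_field_sum[OF fields] field_sum_field_sum[OF fields'] F_def G_def t x_def y_def
    by (simp add: tensor_op_tensor clinear_id clinear_heis clinear_diff[OF tensor_linear_right]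
        clinear_cscale[OF tensor_linear_right] tensor_minus)
qed

lemma field_sum_heis:
  fixes a :: "'a modes"
  assumes "is_field a"
  shows "tensor_op id (heis k) (field_sum l a (lattice_mode s) m v)
    = field_sum l a (lattice_mode s) m (tensor_op id (heis k) v)
      - cscale (of_int s) (field_sum l a (lattice_mode s) (m + k) v)"
proof (rule tensor_ext[where A = "\<lambda>v. tensor_op id (heis k) (field_sum l a (lattice_mode s) m v)"])
  note fields = assms is_field_lattice_mode[of s]
  show "clinear (\<lambda>v. tensor_op id (heis k) (field_sum l a (lattice_mode s) m v))"
    by (intro clinear_comp[OF clinear_tensor_op] clinear_field_sum fields)
  show "clinear (\<lambda>v. field_sum l a (lattice_mode s) m (tensor_op id (heis k) v)
      - cscale (of_int s) (field_sum l a (lattice_mode s) (m + k) v))"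
    by (intro clinear_sub clinear_comp[OF clinear_field_sum] clinear_scaled clinear_field_sum fields clinear_tensor_op)
  fix S :: 'a and T :: lattice_basis
  define x where "x = ket S"
  define y where "y = (ket T :: lattice_space)"
  let ?b = "lattice_mode s"
  let ?t = "\<lambda>i. cscale (l - of_int i) (tensor (a (i - 1) x) (?b (m - i - 1) (heis k y)))"
  let ?r = "\<lambda>i. cscale (l - of_int i) (tensor (a (i - 1) x) (?b (m + k - i - 1) y))"
  have fin: "finite {i. ?t i \<noteq> 0}" "finite {i. ?r i \<noteq> 0}"
    by (intro finite_tensor_field fields)+
  have "finite {i. cscale (of_int s) (?r i) \<noteq> 0}"
    by (rule finite_subset[OF _ fin(2)]) auto
  then have "Sum_any ?t - Sum_any (\<lambda>i. cscale (of_int s) (?r i)) = Sum_any (\<lambda>i. ?t i - cscale (of_int s) (?r i))"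
    by (rule Sum_any_diff[OF fin(1)])
  also have "\<dots> = Sum_any (\<lambda>i. tensor_op id (heis k) (cscale (l - of_int i) (tensor (a (i - 1) x) (?b (m - i - 1) y))))"
  proof (intro Sum_any.cong)
    fix i
    have idx: "m - i - 1 + k = m + k - i - 1" by simp
    show "?t i - cscale (of_int s) (?r i)
      = tensor_op id (heis k) (cscale (l - of_int i) (tensor (a (i - 1) x) (?b (m - i - 1) y)))"
      by (simp add: clinear_cscale[OF clinear_tensor_op] tensor_op_tensor clinear_id clinear_heis lattice_mode_heis idx
        clinear_diff[OF tensor_linear_right] clinear_cscale[OF tensor_linear_right] cvs.scale_right_diff_distrib
        mult.commute)
  qed
  also have "\<dots> = tensor_op id (heis k) (field_sum l a ?b m (tensor x y))"
    unfolding field_sum_tensor[OF fields]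
    by (rule clinear_Sum_any[OF clinear_tensor_op finite_tensor_field[OF fields], symmetric])
  also have "Sum_any (\<lambda>i. cscale (of_int s) (?r i)) = cscale (of_int s) (Sum_any ?r)"
    by (rule clinear_Sum_any[OF clinear_scaled[OF clinear_id(1)] fin(2), symmetric])
  finally show "tensor_op id (heis k) (field_sum l a ?b m (tensor (ket S) (ket T)))
    = field_sum l a ?b m (tensor_op id (heis k) (tensor (ket S) (ket T)))
      - cscale (of_int s) (field_sum l a ?b (m + k) (tensor (ket S) (ket T)))"
    by (simp only: field_sum_tensor[OF fields] tensor_op_tensor[OF clinear_id(1) clinear_heis] id_def x_def y_def)
qed


section \<open>Diagonal operators and gradings\<close>

definition diag :: "('a \<Rightarrow> complex) \<Rightarrow> ('a \<Rightarrow>\<^sub>0 complex) \<Rightarrow> ('a \<Rightarrow>\<^sub>0 complex)"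
  where "diag w = lin_ext (\<lambda>x. cscale (w x) (ket x))"

lemma clinear_diag: "clinear (diag w)"
  by (simp add: diag_def linear_lin_ext)

lemma diag_ket [simp]: "diag w (ket x) = cscale (w x) (ket x)"
  by (simp add: diag_def)

lemma lookup_diag: "Poly_Mapping.lookup (diag w v) x = w x * Poly_Mapping.lookup v x"
  by (auto simp: diag_def lookup_lin_ext lookup_ket in_keys_iff if_distrib cong: if_cong)

lemma diag_eq_scale_iff:
  "diag w v = cscale s v \<longleftrightarrow> (\<forall>x\<in>Poly_Mapping.keys v. w x = s)"
  by (auto simp: poly_mapping_eq_iff fun_eq_iff lookup_diag in_keys_iff)

text \<open>Basis vectors are eigenvectors of \<open>diag w\<close>, so an operator T shifting
  eigenvalues by c satisfies [diag w, T] = c T. Applied to L(0) and, with c = 0, to H(0).\<close>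

lemma diag_shift:
  assumes "clinear T" "\<And>x b. b \<in> Poly_Mapping.keys (T (ket x)) \<Longrightarrow> w b = w x + c"
  shows "diag w (T v) = T (diag w v) + cscale c (T v)"
proof (rule clinear_ext[where A = "\<lambda>v. diag w (T v)"])
  show "clinear (\<lambda>v. diag w (T v))" by (rule clinear_comp[OF clinear_diag assms(1)])
  show "clinear (\<lambda>v. T (diag w v) + cscale c (T v))"
    by (intro clinear_plus clinear_comp[OF assms(1)] clinear_diag clinear_scaled assms(1))
  show "diag w (T (ket x)) = T (diag w (ket x)) + cscale c (T (ket x))" for x
  proof (rule poly_mapping_eqI)
    fix b
    show "Poly_Mapping.lookup (diag w (T (ket x))) b
      = Poly_Mapping.lookup (T (diag w (ket x)) + cscale c (T (ket x))) b"
      using assms(2)[of b x]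
      by (cases "Poly_Mapping.lookup (T (ket x)) b = 0")
        (simp_all add: lookup_diag lookup_add clinear_cscale[OF assms(1)] in_keys_iff distrib_right)
  qed
qed

section \<open>The fermionic contribution to L(0)\<close>

lemma fermion_number:
  "Poly_Mapping.lookup (fermion_create l (fermion_annihilate l v)) T
    = (if l |\<in>| T then Poly_Mapping.lookup v T else 0)"
proof -
  have "finsert l (T |-| {|l|}) = T" if "l |\<in>| T" using that by auto
  then show ?thesis
    by (simp add: lookup_fermion_create lookup_fermion_annihilate flip: mult.assoc)
qed

text \<open>Twice the conformal weight, \<open>\<Psi>\<^sup>\<plusminus>(-r)\<close> contributing \<open>2r\<close>.\<close>

definition label_energy :: "int fset \<Rightarrow> int"
  where "label_energy S = (\<Sum>j\<in>fset S. \<bar>2 * j + 1\<bar>)"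

lemma label_energy_finsert:
  assumes "j |\<notin>| S"
  shows "label_energy (finsert j S) = label_energy S + \<bar>2 * j + 1\<bar>"
  using assms by (simp add: label_energy_def)

lemma clinear_fermion: "clinear (fermion_create j)" "clinear (fermion_annihilate j)"
  by (simp_all add: fermion_create_def fermion_annihilate_def linear_lin_ext)

lemma Sum_any_fset_shift:
  fixes g :: "int \<Rightarrow> int"
  assumes "inj_on g (fset T)" "\<And>j. h j |\<in>| T \<longleftrightarrow> j \<in> g ` fset T"
  shows "Sum_any (\<lambda>j. if h j |\<in>| T then c j else 0) = (\<Sum>l\<in>fset T. c (g l) :: complex)"
proof -
  have "Sum_any (\<lambda>j. if h j |\<in>| T then c j else 0) = (\<Sum>j\<in>g ` fset T. if h j |\<in>| T then c j else 0)"
    using assms(2) by (intro Sum_any.expand_superset) auto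
  also have "\<dots> = (\<Sum>j\<in>g ` fset T. c j)"
    using assms(2) by (intro sum.cong) auto
  finally show ?thesis by (simp add: sum.reindex[OF assms(1)])
qed

text \<open>Normal ordering turns each summand into an occupation number: the first product weights
  an occupied label l by |l + 1|, the second by |l|. These add up to |2l + 1|, since the integers l
  and l + 1 never have opposite signs.\<close>

lemma fock_omega_diag: "fock_omega 1 = diag (\<lambda>S. of_int (label_energy S) / 2)"
proof
  fix v
  show "fock_omega 1 v = diag (\<lambda>S. of_int (label_energy S) / 2) v"
  proof (rule poly_mapping_eqI)
    fix T
    let ?v = "Poly_Mapping.lookup v T"
    have plus: "Poly_Mapping.lookup (normal_product (- 1) (deriv_modes psi_plus) psi_minus 1 v) T
      = (\<Sum>l\<in>fset T. of_int \<bar>l + 1\<bar> * ?v)"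
    proof -
      have "Poly_Mapping.lookup (normal_product (- 1) (deriv_modes psi_plus) psi_minus 1 v) T
        = Sum_any (\<lambda>j. if j - 1 |\<in>| T then of_int \<bar>j\<bar> * ?v else 0)"
        unfolding normal_product_def lookup_Sum_any[OF finite_normal_product[OF is_field_deriv[OF is_field_psi(1)] is_field_psi(2)]]
        by (intro Sum_any.cong)
          (auto simp: deriv_modes_def psi_plus_def psi_minus_def fermion_number clinear_cscale[OF clinear_fermion(1)]
            clinear_minus[OF clinear_fermion(1)] clinear_fermion)
      also have "\<dots> = (\<Sum>l\<in>fset T. of_int \<bar>l + 1\<bar> * ?v)"
        by (rule Sum_any_fset_shift) (auto simp: inj_on_def image_iff intro: bexI[of _ "_ - 1"])
      finally show ?thesis .
    qed
    have minus: "Poly_Mapping.lookup (normal_product (- 1) (deriv_modes psi_minus) psi_plus 1 v) T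
      = (\<Sum>l\<in>fset T. of_int \<bar>- l\<bar> * ?v)"
    proof -
      have "Poly_Mapping.lookup (normal_product (- 1) (deriv_modes psi_minus) psi_plus 1 v) T
        = Sum_any (\<lambda>j. if - j |\<in>| T then of_int \<bar>j\<bar> * ?v else 0)"
        unfolding normal_product_def lookup_Sum_any[OF finite_normal_product[OF is_field_deriv[OF is_field_psi(2)] is_field_psi(1)]]
        by (intro Sum_any.cong)
          (auto simp: deriv_modes_def psi_plus_def psi_minus_def fermion_number clinear_cscale[OF clinear_fermion(1)]
            clinear_minus[OF clinear_fermion(1)] clinear_fermion)
      also have "\<dots> = (\<Sum>l\<in>fset T. of_int \<bar>- l\<bar> * ?v)"
        by (rule Sum_any_fset_shift) (auto simp: inj_on_def image_iff intro: bexI[of _ "- _"])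
      finally show ?thesis .
    qed
    have "(\<Sum>l\<in>fset T. \<bar>l + 1\<bar>) + (\<Sum>l\<in>fset T. \<bar>- l\<bar>) = label_energy T"
      unfolding label_energy_def sum.distrib[symmetric] by (rule sum.cong) auto
    then have "(\<Sum>l\<in>fset T. of_int \<bar>l + 1\<bar> * ?v) + (\<Sum>l\<in>fset T. of_int \<bar>- l\<bar> * ?v) = of_int (label_energy T) * ?v"
      unfolding sum_distrib_right[symmetric] distrib_right[symmetric] of_int_sum[symmetric] of_int_add[symmetric]
      by simp
    then show "Poly_Mapping.lookup (fock_omega 1 v) T
      = Poly_Mapping.lookup (diag (\<lambda>S. of_int (label_energy S) / 2) v) T"
      unfolding fock_omega_def lookup_cscale lookup_add plus minus lookup_diag by simp
  qed
qed

section \<open>The Heisenberg contribution to L(0)\<close>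

lemma lattice_weight_count:
  "lattice_weight (p, M) = (\<Sum>k\<in>set_mset M. (k + 1) * count M k)"
proof (induction M)
  case (add x M)
  have "(\<Sum>k\<in>set_mset (add_mset x M). (k + 1) * count (add_mset x M) k)
    = (\<Sum>k\<in>insert x (set_mset M). (k + 1) * count M k + (if k = x then x + 1 else 0))"
    by (rule sum.cong) auto
  also have "\<dots> = (\<Sum>k\<in>insert x (set_mset M). (k + 1) * count M k) + (x + 1)"
    unfolding sum.distrib by simp
  also have "(\<Sum>k\<in>insert x (set_mset M). (k + 1) * count M k) = (\<Sum>k\<in>set_mset M. (k + 1) * count M k)"
    by (rule sum.mono_neutral_right) (auto simp: not_in_iff)
  finally show ?case using add.IH by (simp add: lattice_weight_def)
qed (simp add: lattice_weight_def)

text \<open>The sum is \<beta>(0)^2 plus twice the sum of \<beta>(-j) \<beta>(j) over j > 0. The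
  latter summand has eigenvalue -j times the multiplicity of the part j, stored as j - 1. The sign
  is that of <\<beta>, \<beta>> = -1, and the factor -1/2 in \<omega> reverses it.\<close>

lemma heis_normal_product_diag:
  "normal_product 1 heis heis 1 = diag (\<lambda>(p, M). of_int (p * p) - 2 * of_nat (lattice_weight (p, M)))"
proof (rule ext, rule clinear_ext[OF _ clinear_diag])
  show "clinear (normal_product 1 heis heis 1)"
    unfolding normal_product_def[abs_def]
  proof (rule clinear_Sum_any_family)
    show "clinear (\<lambda>v. if j < 0 then heis j (heis (1 - j - 1) v) else cscale 1 (heis (1 - j - 1) (heis j v)))" for j
      by (cases "j < 0") (simp_all add: clinear_comp[OF clinear_heis clinear_heis])
  qed (rule finite_normal_product[OF is_field_heis is_field_heis])
  fix x :: lattice_basis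
  obtain p M where x: "x = (p, M)" by force
  define c :: "int \<Rightarrow> complex" where "c j = - of_int \<bar>j\<bar> * of_nat (count M (nat \<bar>j\<bar> - 1))" for j
  define f :: "int \<Rightarrow> complex" where "f j = (if j = 0 then of_int (p * p) else c j)" for j
  have number: "heis (- k) (heis k (ket (p, M))) = cscale (- of_int k * of_nat (count M (nat k - 1))) (ket (p, M))"
    if "k > 0" for k
  proof (cases "nat k - 1 \<in># M")
    case True
    with that show ?thesis
      by (simp add: heis_ket clinear_cscale[OF clinear_heis] clinear_minus[OF clinear_heis])
  next
    case False
    with that show ?thesis by (simp add: heis_ket not_in_iff clinear_heis)
  qed
  let ?P = "(\<lambda>k. int k + 1) ` set_mset M" and ?N = "(\<lambda>k. - int k - 1) ` set_mset M"
  have supp: "{j. f j \<noteq> 0} \<subseteq> insert 0 (?P \<union> ?N)"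
  proof
    fix j assume j: "j \<in> {j. f j \<noteq> 0}"
    show "j \<in> insert 0 (?P \<union> ?N)"
    proof (cases "j = 0")
      case False
      with j have "nat \<bar>j\<bar> - 1 \<in># M" by (auto simp: f_def c_def not_in_iff)
      moreover have "j = int (nat \<bar>j\<bar> - 1) + 1 \<or> j = - int (nat \<bar>j\<bar> - 1) - 1" using False by linarith
      ultimately show ?thesis by blast
    qed simp
  qed
  have "(if j < 0 then heis j (heis (1 - j - 1) (ket x)) else cscale 1 (heis (1 - j - 1) (heis j (ket x))))
    = cscale (f j) (ket x)" for j
  proof (cases "j = 0")
    case True
    then show ?thesis by (simp add: x f_def heis_ket clinear_cscale[OF clinear_heis] clinear_minus[OF clinear_heis])
  next
    case False
    then show ?thesis using number[of "\<bar>j\<bar>"] by (cases "j < 0") (auto simp: x f_def c_def)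
  qed
  then have "normal_product 1 heis heis 1 (ket x) = Sum_any (\<lambda>j. cscale (f j) (ket x))"
    by (simp only: normal_product_def)
  also have "\<dots> = cscale (Sum_any f) (ket x)"
  proof -
    have "Sum_any (\<lambda>j. cscale (f j) (ket x)) = (\<Sum>j | f j \<noteq> 0. cscale (f j) (ket x))"
      by (rule Sum_any.expand_superset[OF finite_subset[OF supp]]) auto
    then show ?thesis by (simp add: Sum_any.expand_set cvs.scale_sum_left)
  qed
  also have "Sum_any f = of_int (p * p) - 2 * of_nat (lattice_weight (p, M))"
  proof -
    have "Sum_any f = sum f (insert 0 (?P \<union> ?N))"
      by (rule Sum_any.expand_superset[OF _ supp]) simp
    also have "\<dots> = f 0 + (sum f ?P + sum f ?N)"
    proof -
      have "0 \<notin> ?P \<union> ?N" "?P \<inter> ?N = {}" by auto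
      then show ?thesis by (simp add: sum.union_disjoint)
    qed
    also have "sum f ?P = (\<Sum>k\<in>set_mset M. - of_nat ((k + 1) * count M k))"
      by (subst sum.reindex) (auto simp: inj_on_def f_def c_def nat_add_distrib left_diff_distrib intro!: sum.cong)
    also have "sum f ?N = (\<Sum>k\<in>set_mset M. - of_nat ((k + 1) * count M k))"
    proof (subst sum.reindex)
      have "\<bar>- int k - 1\<bar> = int k + 1" for k by simp
      then show "sum (f \<circ> (\<lambda>k. - int k - 1)) (set_mset M) = (\<Sum>k\<in>set_mset M. - of_nat ((k + 1) * count M k))"
        by (intro sum.cong) (auto simp: f_def c_def nat_add_distrib left_diff_distrib)
    qed (auto simp: inj_on_def)
    also have "f 0 = of_int (p * p)" by (simp add: f_def)
    finally show ?thesis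
      unfolding lattice_weight_count sum_negf of_nat_sum[symmetric] by (simp only: mult_2 diff_conv_add_uminus minus_add_distrib)
  qed
  finally show "normal_product 1 heis heis 1 (ket x)
    = diag (\<lambda>(p, M). of_int (p * p) - 2 * of_nat (lattice_weight (p, M))) (ket x)"
    by (simp add: x)
qed

text \<open>The term -p^2/2 is the conformal weight of e^(p\<beta>). On \<Pi>(0) the fermions have
  charge p and at least the energy p^2/2, see \<open>label_energy_excess\<close>, which makes L(0)
  non-negative there.\<close>

definition energy :: "space_basis \<Rightarrow> complex"
  where "energy = (\<lambda>(S, p, M). of_int (label_energy S - p * p) / 2 + of_nat (lattice_weight (p, M)))"

lemma tensor_op_ket: "tensor_op A B (ket (s, t)) = tensor (A (ket s)) (B (ket t))"
  by (simp add: tensor_op_def)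

lemma virasoro_diag: "virasoro 0 = diag energy"
proof (rule ext, rule clinear_ext[OF _ clinear_diag])
  show "clinear (virasoro 0)"
    unfolding virasoro_def[abs_def] by (intro clinear_sub clinear_scaled clinear_tensor_op)
  fix x :: space_basis
  obtain S p M where x: "x = (S, p, M)" by (cases x) auto
  have "virasoro 0 (ket x) = cscale (of_int (label_energy S) / 2) (ket x)
      - cscale (1 / 2) (cscale (of_int (p * p) - 2 * of_nat (lattice_weight (p, M))) (ket x))"
    by (simp only: virasoro_def add_0 fock_omega_diag heis_normal_product_diag x tensor_op_ket diag_ket prod.case
        clinear_cscale[OF tensor_linear_left] clinear_cscale[OF tensor_linear_right] tensor_ket id_apply)
  also have "\<dots> = cscale (of_int (label_energy S) / 2 - 1 / 2 * (of_int (p * p) - 2 * of_nat (lattice_weight (p, M)))) (ket x)"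
    unfolding cvs.scale_scale cvs.scale_left_diff_distrib[symmetric] ..
  also have "of_int (label_energy S) / 2 - 1 / 2 * (of_int (p * p) - 2 * of_nat (lattice_weight (p, M))) = energy x"
    by (simp add: energy_def x field_simps)
  finally show "virasoro 0 (ket x) = diag energy (ket x)" by simp
qed

definition charge_defect :: "space_basis \<Rightarrow> complex"
  where "charge_defect = (\<lambda>(S, p, M). of_int (label_charge S - p))"

lemma heis_0_diag: "heis 0 = diag (\<lambda>(p, M). - of_int p)"
  unfolding heis_def diag_def by (rule arg_cong[where f = lin_ext]) auto

lemma fock_charge_diag: "fock_charge = diag (\<lambda>S. of_int (label_charge S))"
  by (simp add: fock_charge_def diag_def)

lemma H_zero_diag: "H_zero = diag charge_defect"
proof (rule ext, rule clinear_ext[OF _ clinear_diag])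
  show "clinear H_zero"
    unfolding H_zero_def[abs_def] by (intro clinear_plus clinear_tensor_op)
  show "H_zero (ket x) = diag charge_defect (ket x)" for x
    by (cases x) (simp add: H_zero_def fock_charge_diag heis_0_diag tensor_op_ket charge_defect_def
      clinear_cscale[OF tensor_linear_left] clinear_cscale[OF tensor_linear_right] tensor_ket tensor_minus
      cvs.scale_left_diff_distrib)
qed

lemma Pi_zero_iff: "v \<in> Pi_zero \<longleftrightarrow> (\<forall>(S, p, M)\<in>Poly_Mapping.keys v. label_charge S = p)"
  using diag_eq_scale_iff[of charge_defect v 0]
  by (auto simp: Pi_zero_def H_zero_diag charge_defect_def)

lemma subspace_Pi_zero: "cvs.subspace Pi_zero"
  unfolding Pi_zero_def H_zero_diag
  by (rule cvs.subspaceI) (simp_all add: clinear_diag clinear_add[OF clinear_diag] clinear_cscale[OF clinear_diag])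

lemma keys_psi_plus:
  assumes "T \<in> Poly_Mapping.keys (psi_plus n (ket S))"
  shows "label_charge T = label_charge S + 1" "label_energy T = label_energy S - (2 * n + 1)"
proof -
  have "label_charge T = label_charge S + 1 \<and> label_energy T = label_energy S - (2 * n + 1)"
  proof (cases "n < 0")
    case True
    then have "n |\<notin>| S" "T = finsert n S"
      using assms by (auto simp: psi_plus_def fermion_create_def in_keys_iff lookup_ket split: if_splits)
    then show ?thesis using True by (simp add: label_charge_finsert label_energy_finsert)
  next
    case False
    then have "n |\<in>| S" "T = S |-| {|n|}"
      using assms by (auto simp: psi_plus_def fermion_annihilate_def in_keys_iff lookup_ket split: if_splits)
    then have "n |\<notin>| T" "S = finsert n T" by auto
    then show ?thesis using False by (simp add: label_charge_finsert label_energy_finsert)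
  qed
  then show "label_charge T = label_charge S + 1" "label_energy T = label_energy S - (2 * n + 1)" by auto
qed

lemma keys_psi_minus:
  assumes "T \<in> Poly_Mapping.keys (psi_minus n (ket S))"
  shows "label_charge T = label_charge S - 1" "label_energy T = label_energy S - (2 * n + 1)"
proof -
  have "label_charge T = label_charge S - 1 \<and> label_energy T = label_energy S - (2 * n + 1)"
  proof (cases "n < 0")
    case True
    then have "- n - 1 |\<notin>| S" "T = finsert (- n - 1) S"
      using assms by (auto simp: psi_minus_def fermion_create_def in_keys_iff lookup_ket split: if_splits)
    then show ?thesis using True by (simp add: label_charge_finsert label_energy_finsert)
  next
    case False
    then have "- n - 1 |\<in>| S" "T = S |-| {|- n - 1|}"
      using assms by (auto simp: psi_minus_def fermion_annihilate_def in_keys_iff lookup_ket split: if_splits)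
    then have "- n - 1 |\<notin>| T" "S = finsert (- n - 1) T" by auto
    then show ?thesis using False by (simp add: label_charge_finsert label_energy_finsert)
  qed
  then show "label_charge T = label_charge S - 1" "label_energy T = label_energy S - (2 * n + 1)" by auto
qed

text \<open>The fermionic mode shifts the energy by 1/2 - i, the charge shift changes -p^2/2 by -s p
  - 1/2, and the Heisenberg weight changes by s p - m + i. The total is -m for every i.\<close>

lemma keys_field_sum:
  fixes a :: "int fset modes"
  assumes "is_field a" "s * s = 1"
    and a: "\<And>n S T. T \<in> Poly_Mapping.keys (a n (ket S)) \<Longrightarrow>
      label_charge T = label_charge S + s \<and> label_energy T = label_energy S - (2 * n + 1)"
    and b: "b \<in> Poly_Mapping.keys (field_sum l a (lattice_mode s) m (ket x))"
  shows "energy b = energy x - of_int m" "charge_defect b = charge_defect x"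
proof -
  obtain S p M where x: "x = (S, p, M)" by (cases x) auto
  let ?P = "\<lambda>b. energy b = energy x - of_int m \<and> charge_defect b = charge_defect x"
  let ?W = "{v. \<forall>b\<in>Poly_Mapping.keys v. ?P b}"
  have "tensor (a (i - 1) (ket S)) (lattice_mode s (m - i - 1) (ket (p, M))) \<in> ?W" for i
  proof (intro CollectI ballI)
    fix b
    assume *: "b \<in> Poly_Mapping.keys (tensor (a (i - 1) (ket S)) (lattice_mode s (m - i - 1) (ket (p, M))))"
    obtain T p' M' where b: "b = (T, p', M')" by (cases b) auto
    have T: "T \<in> Poly_Mapping.keys (a (i - 1) (ket S))"
      and M: "(p', M') \<in> Poly_Mapping.keys (lattice_mode s (m - i - 1) (ket (p, M)))"
      using * by (auto simp: b in_keys_iff lookup_tensor)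
    have "p' = p + s" "int (lattice_weight (p', M')) = int (lattice_weight (p, M)) + s * p - (m - i - 1) - 1"
      using lattice_mode_graded[OF ket_graded_part, of s "m - i - 1" p M] M by (auto simp: graded_part_def)
    then have p': "p' = p + s" and w: "int (lattice_weight (p', M')) = int (lattice_weight (p, M)) + s * p - m + i"
      by simp_all
    have w': "(of_nat (lattice_weight (p', M')) :: complex)
        = of_nat (lattice_weight (p, M)) + of_int s * of_int p - of_int m + of_int i"
      using arg_cong[OF w, of "of_int :: int \<Rightarrow> complex"] by simp
    have "(of_int s :: complex) * of_int s = 1" using assms(2) by (metis of_int_1 of_int_mult)
    then show "?P b"
      unfolding energy_def charge_defect_def prod.case x b w'
      by (simp add: p' conjunct1[OF a[OF T]] conjunct2[OF a[OF T]] field_simps)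
  qed
  then have "field_sum l a (lattice_mode s) m (ket x) \<in> ?W"
    unfolding field_sum_def x tensor_op_ket
    by (intro subspace_Sum_any subspace_keys cvs.subspace_scale)
  then show "energy b = energy x - of_int m" "charge_defect b = charge_defect x" using b by auto
qed

lemma keys_tensor_heis:
  assumes "b \<in> Poly_Mapping.keys (tensor_op id (heis m) (ket x))"
  shows "energy b = energy x - of_int m" "charge_defect b = charge_defect x"
proof -
  obtain S p M where x: "x = (S, p, M)" by (cases x) auto
  obtain T p' M' where b: "b = (T, p', M')" by (cases b) auto
  have T: "T = S" and M: "(p', M') \<in> Poly_Mapping.keys (heis m (ket (p, M)))"
    using assms by (auto simp: x b tensor_op_ket in_keys_iff lookup_tensor lookup_ket split: if_splits)
  have "p' = p" "int (lattice_weight (p', M')) = int (lattice_weight (p, M)) - m"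
    using heis_graded[OF ket_graded_part, of m p M] M by (auto simp: graded_part_def)
  moreover from this(2) have "(of_nat (lattice_weight (p', M')) :: complex) = of_nat (lattice_weight (p, M)) - of_int m"
    by (metis of_int_diff of_int_of_nat_eq)
  ultimately show "energy b = energy x - of_int m" "charge_defect b = charge_defect x"
    by (simp_all add: T x b energy_def charge_defect_def)
qed


section \<open>The module structure\<close>

lemma E_action_lin_ext: "E_action lam mu u v = lin_ext (\<lambda>x. E_basis_action lam mu x v) u"
  by (simp add: E_action_def lin_ext_def)

lemma E_action_ket [simp]: "E_action lam mu (ket x) v = E_basis_action lam mu x v"
  by (simp add: E_action_lin_ext)

lemma clinear_E_action_left: "clinear (\<lambda>u. E_action lam mu u v)"
  by (simp add: E_action_lin_ext linear_lin_ext)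

lemma clinear_E_basis_action: "clinear (E_basis_action lam mu x)"
proof (cases x)
  case (Loop y m)
  show ?thesis
  proof (cases y)
    case Sl2_h
    have "clinear (\<lambda>v. if m = 0 then cscale (lam - mu) v else 0)"
      by (cases "m = 0") (simp_all add: clinear_zero clinear_scaled[OF clinear_id(1)])
    then have lin: "clinear (\<lambda>v. cscale (- 2) (tensor_op id (heis m) v) + (if m = 0 then cscale (lam - mu) v else 0))"
      by (intro clinear_plus clinear_scaled clinear_tensor_op)
    have "E_basis_action lam mu x = (\<lambda>v. cscale (- 2) (tensor_op id (heis m) v) + (if m = 0 then cscale (lam - mu) v else 0))"
      unfolding Loop Sl2_h by (rule ext) (rule E_basis_action.simps(3))
    with lin show ?thesis by (simp only:)
  qed (simp_all only: Loop E_basis_action_field_sum clinear_field_sum is_field_psi is_field_lattice_mode)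
next
  case Energy
  have "E_basis_action lam mu Energy = diag energy" by (simp add: fun_eq_iff virasoro_diag)
  then show ?thesis unfolding Energy by (simp only: clinear_diag)
next
  case Central
  have "E_basis_action lam mu Central = (\<lambda>v. cscale (- 2) v)" by (simp add: fun_eq_iff)
  then show ?thesis unfolding Central by (simp only: clinear_scaled[OF clinear_id(1)])
qed

lemma clinear_E_action_right: "clinear (E_action lam mu u)"
  unfolding E_action_def[abs_def] by (intro clinear_sum_family clinear_scaled clinear_E_basis_action)

definition loop_shift :: "aff_basis \<Rightarrow> complex"
  where "loop_shift x = (case x of Loop _ m \<Rightarrow> - of_int m | _ \<Rightarrow> 0)"

lemma keys_E_basis_action:
  assumes "b \<in> Poly_Mapping.keys (E_basis_action lam mu y (ket x))"
  shows "energy b = energy x + loop_shift y \<and> charge_defect b = charge_defect x"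
proof (cases y)
  case (Loop z m)
  show ?thesis
  proof (cases z)
    case Sl2_e
    show ?thesis
      using keys_field_sum[OF is_field_psi(1), of 1 b lam m x] assms keys_psi_plus
      by (simp add: Loop Sl2_e loop_shift_def E_basis_action_field_sum del: E_basis_action.simps)
  next
    case Sl2_f
    show ?thesis
      using keys_field_sum[OF is_field_psi(2), of "- 1" b mu m x] assms keys_psi_minus
      by (simp add: Loop Sl2_f loop_shift_def E_basis_action_field_sum del: E_basis_action.simps)
  next
    case Sl2_h
    have "b \<in> Poly_Mapping.keys (tensor_op id (heis m) (ket x)) \<or> m = 0 \<and> b = x"
      using assms by (auto simp: Loop Sl2_h in_keys_iff lookup_add lookup_minus lookup_ket split: if_splits)
    then show ?thesis using keys_tensor_heis[of b m x] by (elim disjE) (simp_all add: Loop Sl2_h loop_shift_def)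
  qed
qed (use assms in \<open>auto simp: loop_shift_def virasoro_diag in_keys_iff lookup_ket split: if_splits\<close>)

lemma energy_E_basis_action:
  "diag energy (E_basis_action lam mu y v)
    = E_basis_action lam mu y (diag energy v) + cscale (loop_shift y) (E_basis_action lam mu y v)"
  by (rule diag_shift[OF clinear_E_basis_action]) (use keys_E_basis_action in blast)

lemma E_basis_action_Pi_zero:
  assumes "v \<in> Pi_zero"
  shows "E_basis_action lam mu y v \<in> Pi_zero"
proof -
  have "diag charge_defect (E_basis_action lam mu y v)
    = E_basis_action lam mu y (diag charge_defect v) + cscale 0 (E_basis_action lam mu y v)"
    by (rule diag_shift[OF clinear_E_basis_action]) (use keys_E_basis_action in auto)
  with assms show ?thesis by (simp add: Pi_zero_def H_zero_diag clinear_0[OF clinear_E_basis_action])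
qed

lemma E_action_Pi_zero:
  assumes "v \<in> Pi_zero"
  shows "E_action lam mu u v \<in> Pi_zero"
  unfolding E_action_def
  by (intro cvs.subspace_sum cvs.subspace_scale subspace_Pi_zero E_basis_action_Pi_zero assms)

lemma h_commutator:
  assumes "is_field a"
  shows "E_basis_action lam mu (Loop Sl2_h m) (field_sum l a (lattice_mode s) n v)
      - field_sum l a (lattice_mode s) n (E_basis_action lam mu (Loop Sl2_h m) v)
    = cscale (2 * of_int s) (field_sum l a (lattice_mode s) (m + n) v)"
proof -
  have lin: "clinear (field_sum l a (lattice_mode s) n)"
    by (intro clinear_field_sum assms is_field_lattice_mode)
  show ?thesis
    unfolding E_basis_action.simps field_sum_heis[OF assms]
    by (simp add: clinear_add[OF lin] clinear_diff[OF lin] clinear_minus[OF lin] clinear_cscale[OF lin] clinear_0[OF lin]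
        cvs.scale_right_diff_distrib add.commute[of n] if_distrib)
qed

lemma heis_tensor_commutator:
  "tensor_op id (heis m) (tensor_op id (heis n) v) - tensor_op id (heis n) (tensor_op id (heis m) v)
    = (if m + n = 0 then cscale (- of_int m) v else 0)"
proof (rule tensor_ext[where A = "\<lambda>v. tensor_op id (heis m) (tensor_op id (heis n) v)
      - tensor_op id (heis n) (tensor_op id (heis m) v)"])
  show "clinear (\<lambda>v. tensor_op id (heis m) (tensor_op id (heis n) v)
      - tensor_op id (heis n) (tensor_op id (heis m) v))"
    by (intro clinear_sub clinear_comp[OF clinear_tensor_op] clinear_tensor_op)
  show "clinear (\<lambda>v. if m + n = 0 then cscale (- of_int m) v else 0)"
    by (cases "m + n = 0") (simp_all only: if_True if_False simp_thms clinear_zero clinear_scaled[OF clinear_id(1)])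
  fix s :: 'a and t :: lattice_basis
  have "tensor (ket s) (heis m (heis n (ket t)) - heis n (heis m (ket t)))
    = (if m + n = 0 then cscale (- of_int m) (tensor (ket s) (ket t)) else 0)"
    unfolding heis_commutator
    by (simp only: if_distrib[of "tensor (ket s)"] tensor_0 clinear_cscale[OF tensor_linear_right])
  then show "tensor_op id (heis m) (tensor_op id (heis n) (tensor (ket s) (ket t)))
      - tensor_op id (heis n) (tensor_op id (heis m) (tensor (ket s) (ket t)))
    = (if m + n = 0 then cscale (- of_int m) (tensor (ket s) (ket t)) else 0)"
    by (simp only: tensor_op_tensor[OF clinear_id(2) clinear_heis] id_apply clinear_diff[OF tensor_linear_right])
qed

text \<open>The level -2 appears twice independently, for m + n = 0: [h(m), h(n)] is 4 times the
  Heisenberg commutator -m, which equals 2m times -2, and in [e(m), f(n)] it is the term -2m of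
  \<open>field_sum_commutator\<close>.\<close>

lemma E_basis_bracket_loop:
  "E_action lam mu (aff_basis_bracket (Loop x m) (Loop y n)) v
    = E_basis_action lam mu (Loop x m) (E_basis_action lam mu (Loop y n) v)
      - E_basis_action lam mu (Loop y n) (E_basis_action lam mu (Loop x m) v)"
proof -
  note lin = clinear_add[OF clinear_E_action_left] clinear_cscale[OF clinear_E_action_left]
    clinear_minus[OF clinear_E_action_left] clinear_diff[OF clinear_E_action_left]
    clinear_0[OF clinear_E_action_left] clinear_cscale[OF linear_lin_ext]
    clinear_minus[OF linear_lin_ext] clinear_0[OF linear_lin_ext] 
  define e where "e = (\<lambda>m. E_basis_action lam mu (Loop Sl2_e m))"
  define f where "f = (\<lambda>m. E_basis_action lam mu (Loop Sl2_f m))"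
  define h where "h = (\<lambda>m. E_basis_action lam mu (Loop Sl2_h m))"
  have ee: "e m (e n v) - e n (e m v) = 0" for m n
    unfolding e_def E_basis_action_field_sum
    using field_sum_commute_same[OF is_field_psi(1) psi_car(1), of 1 lam m n v] by simp
  have ff: "f m (f n v) - f n (f m v) = 0" for m n
    unfolding f_def E_basis_action_field_sum
    using field_sum_commute_same[OF is_field_psi(2) psi_car(2), of "- 1" mu m n v] by simp
  have ef: "e m (f n v) - f n (e m v) = h (m + n) v + (if m + n = 0 then cscale (- 2 * of_int m) v else 0)" for m n
    unfolding e_def f_def h_def E_basis_action_field_sum field_sum_commutator
    by (simp add: cvs.scale_left_diff_distrib)
  have he: "h m (e n v) - e n (h m v) = cscale 2 (e (m + n) v)" for m n
    using h_commutator[OF is_field_psi(1), of lam mu m lam 1 n v]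
    unfolding e_def h_def E_basis_action_field_sum by simp
  have hf: "h m (f n v) - f n (h m v) = cscale (- 2) (f (m + n) v)" for m n
    using h_commutator[OF is_field_psi(2), of lam mu m mu "- 1" n v]
    unfolding f_def h_def E_basis_action_field_sum by simp
  have hh: "h m (h n v) - h n (h m v) = (if m + n = 0 then cscale (- 4 * of_int m) v else 0)" for m n
  proof -
    let ?N = "\<lambda>m. tensor_op id (heis m) :: space \<Rightarrow> space"
    have "h m (h n v) - h n (h m v) = cscale 4 (?N m (?N n v) - ?N n (?N m v))"
      unfolding h_def
      by (simp add: clinear_add[OF clinear_tensor_op] clinear_diff[OF clinear_tensor_op] clinear_cscale[OF clinear_tensor_op]
          clinear_minus[OF clinear_tensor_op] cvs.scale_right_distrib cvs.scale_right_diff_distrib clinear_tensor_op)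
    then show ?thesis unfolding heis_tensor_commutator by simp
  qed
  have swap: "A - B = - (B - A)" for A B :: space by simp
  have h_eq: "E_basis_action lam mu (Loop Sl2_h k) w = h k w" "E_basis_action lam mu (Loop Sl2_e k) w = e k w"
    "E_basis_action lam mu (Loop Sl2_f k) w = f k w" for k w
    by (simp_all only: h_def e_def f_def)
  show ?thesis
  proof (cases x; cases y; simp only: h_eq)
    show "E_action lam mu (aff_basis_bracket (Loop Sl2_e m) (Loop Sl2_e n)) v = e m (e n v) - e n (e m v)"
      unfolding ee by (simp add: lin)
    show "E_action lam mu (aff_basis_bracket (Loop Sl2_f m) (Loop Sl2_f n)) v = f m (f n v) - f n (f m v)"
      unfolding ff by (simp add: lin)
    show "E_action lam mu (aff_basis_bracket (Loop Sl2_h m) (Loop Sl2_h n)) v = h m (h n v) - h n (h m v)"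
      unfolding hh by (simp add: lin mult.commute)
    show "E_action lam mu (aff_basis_bracket (Loop Sl2_e m) (Loop Sl2_f n)) v = e m (f n v) - f n (e m v)"
      unfolding ef by (simp add: lin h_eq mult.commute del: E_basis_action.simps(1-3))
    show "E_action lam mu (aff_basis_bracket (Loop Sl2_f m) (Loop Sl2_e n)) v = f m (e n v) - e n (f m v)"
    proof -
      have "m + n = 0 \<Longrightarrow> (of_int n :: complex) = - of_int m" by (simp add: eq_neg_iff_add_eq_0 add.commute flip: of_int_add)
      then show ?thesis
        unfolding swap[of "f m (e n v)"] ef by (auto simp add: lin h_eq add.commute[of n] mult.commute simp del: E_basis_action.simps(1-3))
    qed
    show "E_action lam mu (aff_basis_bracket (Loop Sl2_h m) (Loop Sl2_e n)) v = h m (e n v) - e n (h m v)"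
      unfolding he by (simp add: lin h_eq del: E_basis_action.simps(1-3))
    show "E_action lam mu (aff_basis_bracket (Loop Sl2_h m) (Loop Sl2_f n)) v = h m (f n v) - f n (h m v)"
      unfolding hf by (simp add: lin h_eq del: E_basis_action.simps(1-3))
    show "E_action lam mu (aff_basis_bracket (Loop Sl2_e m) (Loop Sl2_h n)) v = e m (h n v) - h n (e m v)"
      unfolding swap[of "e m (h n v)"] he by (simp add: lin h_eq add.commute[of n] del: E_basis_action.simps(1-3))
    show "E_action lam mu (aff_basis_bracket (Loop Sl2_f m) (Loop Sl2_h n)) v = f m (h n v) - h n (f m v)"
      unfolding swap[of "f m (h n v)"] hf by (simp add: lin h_eq add.commute[of n] del: E_basis_action.simps(1-3))
  qed
qed

lemma E_basis_bracket:
  "E_action lam mu (aff_basis_bracket x y) v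
    = E_basis_action lam mu x (E_basis_action lam mu y v) - E_basis_action lam mu y (E_basis_action lam mu x v)"
proof -
  let ?B = "E_basis_action lam mu"
  have central: "?B Central w = cscale (- 2) w" for w by simp
  have energy: "?B Energy w = diag energy w" for w by (simp add: virasoro_diag)
  note lin = clinear_0[OF clinear_E_action_left] clinear_cscale[OF clinear_E_action_left]
  show ?thesis
  proof (cases "x = Central \<or> y = Central")
    case True
    then have "aff_basis_bracket x y = 0" by (cases x; cases y) auto
    then show ?thesis using True unfolding lin
      by (auto simp only: central clinear_cscale[OF clinear_E_basis_action] lin diff_self)
  next
    case False
    show ?thesis
    proof (cases x)
      case (Loop a m)
      show ?thesis
      proof (cases y)
        case (Loop b n)
        with \<open>x = Loop a m\<close> show ?thesis by (simp only: E_basis_bracket_loop)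
      next
        case Energy
        then show ?thesis
          using energy_E_basis_action[of lam mu "Loop a m" v]
          by (simp only: \<open>x = Loop a m\<close> energy aff_basis_bracket.simps lin E_action_ket loop_shift_def aff_basis.case)
            simp
      qed (use False in simp)
    next
      case Energy
      show ?thesis
      proof (cases y)
        case (Loop b n)
        then show ?thesis
          using energy_E_basis_action[of lam mu "Loop b n" v]
          by (simp only: \<open>x = Energy\<close> energy aff_basis_bracket.simps lin E_action_ket loop_shift_def aff_basis.case)
            simp
      next
        case Energy
        with \<open>x = Energy\<close> show ?thesis by (simp add: lin)
      qed (use False in simp)
    qed (use False in simp)
  qed
qed

lemma clinear_aff_bracket: "clinear (\<lambda>u. aff_bracket u w)" "clinear (aff_bracket u)"
proof -
  show "clinear (\<lambda>u. aff_bracket u w)" by (simp add: aff_bracket_def linear_lin_ext)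
  show "clinear (aff_bracket u)"
    unfolding aff_bracket_def[abs_def] lin_ext_def[of _ u]
    by (intro clinear_sum_family clinear_scaled linear_lin_ext)
qed

lemma E_action_bracket:
  "E_action lam mu (aff_bracket u w) v
    = E_action lam mu u (E_action lam mu w v) - E_action lam mu w (E_action lam mu u v)"
proof (rule clinear_ext[where A = "\<lambda>u. E_action lam mu (aff_bracket u w) v"])
  show "clinear (\<lambda>u. E_action lam mu (aff_bracket u w) v)"
    by (rule clinear_comp[OF clinear_E_action_left clinear_aff_bracket(1)])
  show "clinear (\<lambda>u. E_action lam mu u (E_action lam mu w v) - E_action lam mu w (E_action lam mu u v))"
    by (intro clinear_sub clinear_E_action_left clinear_comp[OF clinear_E_action_right])
  fix x
  show "E_action lam mu (aff_bracket (ket x) w) v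
    = E_action lam mu (ket x) (E_action lam mu w v) - E_action lam mu w (E_action lam mu (ket x) v)"
  proof (rule clinear_ext[where A = "\<lambda>w. E_action lam mu (aff_bracket (ket x) w) v"])
    show "clinear (\<lambda>w. E_action lam mu (aff_bracket (ket x) w) v)"
      by (rule clinear_comp[OF clinear_E_action_left clinear_aff_bracket(2)])
    show "clinear (\<lambda>w. E_action lam mu (ket x) (E_action lam mu w v) - E_action lam mu w (E_action lam mu (ket x) v))"
      by (intro clinear_sub clinear_E_action_left clinear_comp[OF clinear_E_action_right])
    show "E_action lam mu (aff_bracket (ket x) (ket y)) v
      = E_action lam mu (ket x) (E_action lam mu (ket y) v) - E_action lam mu (ket y) (E_action lam mu (ket x) v)" for y
      by (simp only: aff_bracket_def lin_ext_ket E_basis_bracket E_action_ket)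
  qed
qed

lemma aff_module_E: "aff_module Pi_zero (E_action lam mu)"
  unfolding aff_module_def
  by (intro conjI allI ballI subspace_Pi_zero E_action_Pi_zero E_action_bracket
      clinear_add[OF clinear_E_action_left] clinear_cscale[OF clinear_E_action_left]
      clinear_add[OF clinear_E_action_right] clinear_cscale[OF clinear_E_action_right]) assumption


section \<open>Irreducibility\<close>

text \<open>The operator D - c0 kills the component for c0 and multiplies the others by the nonzero
  numbers c - c0, so induction isolates the components one after the other.\<close>

lemma eigencomponents_closed:
  assumes "finite C" "cvs.subspace U" "clinear D" "\<And>x. x \<in> U \<Longrightarrow> D x \<in> U"
    and "\<And>c. c \<in> C \<Longrightarrow> D (y c) = cscale c (y c)" "(\<Sum>c\<in>C. y c) \<in> U" "c \<in> C"
  shows "y c \<in> U"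
  using assms(1,5-7)
proof (induction C arbitrary: y c rule: finite_induct)
  case (insert c0 C)
  let ?z = "\<Sum>c\<in>insert c0 C. y c"
  have "D ?z - cscale c0 ?z = (\<Sum>c\<in>insert c0 C. cscale (c - c0) (y c))"
    unfolding clinear_sum[OF assms(3)] cvs.scale_sum_right sum_subtractf[symmetric]
    by (intro sum.cong refl) (simp add: insert.prems(1) cvs.scale_left_diff_distrib)
  also have "\<dots> = (\<Sum>c\<in>C. cscale (c - c0) (y c))"
    using insert.hyps by simp
  finally have eq: "D ?z - cscale c0 ?z = (\<Sum>c\<in>C. cscale (c - c0) (y c))" .
  have "D ?z - cscale c0 ?z \<in> U"
    by (intro cvs.subspace_diff[OF assms(2)] cvs.subspace_scale[OF assms(2)] assms(4) insert.prems(2))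
  then have sum: "(\<Sum>c\<in>C. cscale (c - c0) (y c)) \<in> U" unfolding eq .
  have yC: "y d \<in> U" if "d \<in> C" for d
  proof -
    have "cscale (d - c0) (y d) \<in> U"
      using sum that insert.prems(1)
      by (intro insert.IH[of "\<lambda>c. cscale (c - c0) (y c)" d])
        (simp_all add: clinear_cscale[OF assms(3)] mult.commute)
    then have "cscale (1 / (d - c0)) (cscale (d - c0) (y d)) \<in> U"
      by (rule cvs.subspace_scale[OF assms(2)])
    moreover have "d \<noteq> c0" using that insert.hyps by auto
    ultimately show ?thesis by simp
  qed
  have "y c0 = ?z - (\<Sum>c\<in>C. y c)" using insert.hyps by simp
  also have "\<dots> \<in> U"
    by (intro cvs.subspace_diff[OF assms(2)] cvs.subspace_sum[OF assms(2)] insert.prems(2) yC)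
  finally show ?case using yC insert.prems(3) by auto
qed simp

definition component :: "('a \<Rightarrow> complex) \<Rightarrow> complex \<Rightarrow> ('a \<Rightarrow>\<^sub>0 complex) \<Rightarrow> ('a \<Rightarrow>\<^sub>0 complex)"
  where "component w c = diag (\<lambda>x. if w x = c then 1 else 0)"

lemma sum_component: "(\<Sum>c\<in>w ` Poly_Mapping.keys v. component w c v) = v"
proof (rule poly_mapping_eqI)
  fix x
  have "Poly_Mapping.lookup (\<Sum>c\<in>w ` Poly_Mapping.keys v. component w c v) x
    = (\<Sum>c\<in>w ` Poly_Mapping.keys v. if c = w x then Poly_Mapping.lookup v x else 0)"
    unfolding lookup_sum component_def lookup_diag by (intro sum.cong) auto
  also have "\<dots> = Poly_Mapping.lookup v x"
    by (auto simp: in_keys_iff)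
  finally show "Poly_Mapping.lookup (\<Sum>c\<in>w ` Poly_Mapping.keys v. component w c v) x = Poly_Mapping.lookup v x" .
qed

lemma component_closed:
  assumes "cvs.subspace U" "\<And>x. x \<in> U \<Longrightarrow> diag w x \<in> U" "v \<in> U" "c \<in> w ` Poly_Mapping.keys v"
  shows "component w c v \<in> U"
proof (rule eigencomponents_closed[OF _ assms(1) clinear_diag assms(2), where C = "w ` Poly_Mapping.keys v"])
  show "diag w (component w c v) = cscale c (component w c v)" for c
    by (auto simp: diag_eq_scale_iff component_def in_keys_iff lookup_diag split: if_splits)
qed (simp_all add: sum_component assms)

lemma half_vertex_closed:
  assumes "s = 1 \<or> s = - 1" "cvs.subspace Y" "\<And>k y. y \<in> Y \<Longrightarrow> heis k y \<in> Y" "v \<in> Y"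
  shows "half_vertex c s a v \<in> Y"
proof (cases "a < 0")
  case False
  then show ?thesis
  proof (induction "nat a" arbitrary: a rule: less_induct)
    case less
    show ?case
    proof (cases "a = 0")
      case True
      with assms(4) show ?thesis by (simp add: half_vertex_def)
    next
      case False
      have "half_vertex c s (a - int j) v \<in> Y" if "j \<in> {1..nat a}" for j
        using that by (intro less.hyps) auto
      then have "cscale (of_int a) (half_vertex c s a v) \<in> Y"
        using less.prems assms(1)
        by (subst half_vertex_recursion)
          (auto intro!: cvs.subspace_scale[OF assms(2)] cvs.subspace_sum[OF assms(2)] assms(3))
      then have "cscale (1 / of_int a) (cscale (of_int a) (half_vertex c s a v)) \<in> Y"
        by (rule cvs.subspace_scale[OF assms(2)])
      with False show ?thesis by simp
    qed
  qed
qed (simp add: half_vertex_def cvs.subspace_0[OF assms(2)])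

text \<open>\<Pi>(0) forces the lattice charge to equal the fermionic charge, so F embeds as x
  \<otimes> e^(p\<beta>) on its part of charge p. The image consists of the vectors of \<Pi>(0)
  without Heisenberg excitations.\<close>

definition fock_embed :: "fock \<Rightarrow> space"
  where "fock_embed = lin_ext (\<lambda>S. ket (S, label_charge S, {#}))"

lemma clinear_fock_embed: "clinear fock_embed"
  by (simp add: fock_embed_def linear_lin_ext)

lemma fock_embed_ket [simp]: "fock_embed (ket S) = ket (S, label_charge S, {#})"
  by (simp add: fock_embed_def)

lemma fock_embed_homogeneous:
  assumes "\<And>S. S \<in> Poly_Mapping.keys x \<Longrightarrow> label_charge S = p"
  shows "fock_embed x = tensor x (ket (p, {#}))"
  by (rule clinear_eq_on_keys[OF clinear_fock_embed tensor_linear_left]) (simp add: assms tensor_ket)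

lemma lookup_tensor_heis_annihilation:
  "Poly_Mapping.lookup (tensor_op id (heis (int (Suc j))) w) (S, q, N)
    = - of_nat (Suc j) * of_nat (Suc (count N j)) * Poly_Mapping.lookup w (S, q, add_mset j N)"
proof -
  have "Poly_Mapping.lookup (tensor_op id (heis (int (Suc j))) w) (S, q, N)
    = (\<Sum>x\<in>Poly_Mapping.keys w. if x = (S, q, add_mset j N)
        then - of_nat (Suc j) * of_nat (Suc (count N j)) * Poly_Mapping.lookup w x else 0)"
    unfolding tensor_op_def lookup_lin_ext
    by (intro sum.cong refl)
      (auto simp: lookup_tensor lookup_ket lookup_heis_annihilation simp del: of_nat_Suc split: if_splits)
  then show ?thesis by (simp add: in_keys_iff del: of_nat_Suc)
qed

context
  fixes lam mu :: complex and W :: "space set"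
  assumes W: "cvs.subspace W" "W \<subseteq> Pi_zero" "\<And>u w. w \<in> W \<Longrightarrow> E_action lam mu u w \<in> W"
begin

lemma submodule_basis_action:
  assumes "w \<in> W"
  shows "E_basis_action lam mu x w \<in> W"
  using W(3)[OF assms, of "ket x"] by simp

lemma submodule_heis:
  assumes "w \<in> W"
  shows "tensor_op id (heis k) w \<in> W"
proof -
  let ?c = "if k = 0 then cscale (lam - mu) w else 0"
  have "?c \<in> W" using assms W(1) by (simp add: cvs.subspace_scale cvs.subspace_0)
  then have "cscale (- 1 / 2) (E_basis_action lam mu (Loop Sl2_h k) w - ?c) \<in> W"
    by (intro cvs.subspace_scale[OF W(1)] cvs.subspace_diff[OF W(1)] submodule_basis_action assms)
  then show ?thesis by simp
qed

text \<open>\<beta>(j + 1) removes a part j from a largest Heisenberg multiset with a nonzero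
  coefficient, so after finitely many steps a nonzero vector without Heisenberg excitations is
  reached.\<close>

lemma submodule_contains_fock_vector:
  assumes "w \<in> W" "w \<noteq> 0" "\<And>S p M. (S, p, M) \<in> Poly_Mapping.keys w \<Longrightarrow> size M \<le> n"
  shows "\<exists>x. x \<noteq> 0 \<and> fock_embed x \<in> W"
  using assms
proof (induction n arbitrary: w)
  case 0
  let ?x = "lin_ext (\<lambda>(S, p, M). ket S) w"
  have "w = fock_embed ?x"
  proof (rule clinear_eq_on_keys[OF clinear_id(1) clinear_comp[OF clinear_fock_embed linear_lin_ext]])
    fix y assume y: "y \<in> Poly_Mapping.keys w"
    obtain S p M where y': "y = (S, p, M)" by (cases y) auto
    have "w \<in> Pi_zero" using 0(1) W(2) by blast
    then have "label_charge S = p" "M = {#}" using y 0(3)[of S p M] by (auto simp: Pi_zero_iff y')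
    then show "ket y = fock_embed (lin_ext (\<lambda>(S, p, M). ket S) (ket y))" by (simp add: y')
  qed
  then show ?case using 0(1,2) clinear_0[OF clinear_fock_embed] by (intro exI[of _ ?x]) auto
next
  case (Suc n)
  show ?case
  proof (cases "\<exists>S p M. (S, p, M) \<in> Poly_Mapping.keys w \<and> size M = Suc n")
    case False
    then have "size M \<le> n" if "(S, p, M) \<in> Poly_Mapping.keys w" for S p M
      using Suc.prems(3)[OF that] that by (metis le_Suc_eq)
    then show ?thesis using Suc by blast
  next
    case True
    then obtain S p M where *: "(S, p, M) \<in> Poly_Mapping.keys w" "size M = Suc n" by blast
    then obtain j N where M: "M = add_mset j N" by (metis size_eq_Suc_imp_eq_union)
    let ?v = "tensor_op id (heis (int (Suc j))) w"
    have "Poly_Mapping.lookup ?v (S, p, N) \<noteq> 0"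
      using * unfolding lookup_tensor_heis_annihilation by (simp add: M in_keys_iff del: of_nat_Suc)
    then have "?v \<noteq> 0" by auto
    moreover have "size M' \<le> n" if "(S', p', M') \<in> Poly_Mapping.keys ?v" for S' p' M'
    proof -
      have "Poly_Mapping.lookup w (S', p', add_mset j M') \<noteq> 0"
        using that unfolding in_keys_iff lookup_tensor_heis_annihilation by auto
      then show ?thesis using Suc.prems(3)[of S' p' "add_mset j M'"] by (simp add: in_keys_iff)
    qed
    ultimately show ?thesis using Suc.IH submodule_heis[OF Suc.prems(1)] by blast
  qed
qed

text \<open>For fixed x the vectors y with x \<otimes> y in W form a subspace stable under all
  \<beta>(k), hence under the coefficients of the exponential.\<close>

lemma submodule_E_minus:
  assumes "tensor x y \<in> W"
  shows "tensor x (E_minus m a y) \<in> W"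
proof -
  let ?Y = "{y. tensor x y \<in> W}"
  have "cvs.subspace ?Y"
    by (rule cvs.subspaceI)
      (simp_all add: clinear_add[OF tensor_linear_right] clinear_cscale[OF tensor_linear_right]
        cvs.subspace_0[OF W(1)] cvs.subspace_add[OF W(1)] cvs.subspace_scale[OF W(1)])
  moreover have "heis k z \<in> ?Y" if "z \<in> ?Y" for k z
    using submodule_heis[of "tensor x z" k] that by (simp add: tensor_op_tensor clinear_id clinear_heis)
  ultimately have "E_minus m a y \<in> ?Y"
    unfolding E_minus_def using assms by (intro half_vertex_closed) auto
  then show ?thesis by simp
qed

text \<open>
  On \<open>x \<otimes> e\<^sup>p\<^sup>\<beta>\<close> the mode \<open>e(n + 1 + p)\<close> gives \<open>(\<lambda> - n - 1) \<Psi>\<^sup>+\<^sub>n x \<otimes> e\<^sup>(\<^sup>p\<^sup>+\<^sup>1\<^sup>)\<^sup>\<beta>\<close> plus Heisenberg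
  descendants of vectors \<open>\<Psi>\<^sup>+\<^sub>k x \<otimes> e\<^sup>(\<^sup>p\<^sup>+\<^sup>1\<^sup>)\<^sup>\<beta>\<close> with \<open>k > n\<close>; as \<open>\<lambda>\<close> is not an integer, downward
  induction on \<open>n\<close> applies.
\<close>

lemma submodule_fermion_mode:
  fixes a :: "int fset modes"
  assumes a: "is_field a" "\<And>n S T. T \<in> Poly_Mapping.keys (a n (ket S)) \<Longrightarrow> label_charge T = label_charge S + s"
    and c: "c \<notin> \<int>" "\<And>m w. w \<in> W \<Longrightarrow> field_sum c a (lattice_mode s) m w \<in> W"
    and x: "\<And>S. S \<in> Poly_Mapping.keys x \<Longrightarrow> label_charge S = p" "fock_embed x \<in> W"
  shows "fock_embed (a n x) \<in> W"
proof -
  have "label_charge T = p + s" if "T \<in> Poly_Mapping.keys (a n x)" for T n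
  proof -
    have "T \<in> Poly_Mapping.keys (lin_ext (\<lambda>S. a n (ket S)) x)"
      using that clinear_eq_lin_ext[OF field_linear[OF a(1)], of n x] by simp
    then obtain S where "S \<in> Poly_Mapping.keys x" "T \<in> Poly_Mapping.keys (a n (ket S))"
      by (rule keys_lin_ext)
    then show ?thesis using a(2) x(1) by auto
  qed
  then have embed: "fock_embed (a n x) = tensor (a n x) (ket (p + s, {#}))" for n
    by (rule fock_embed_homogeneous)
  obtain N where N: "\<And>n. n \<ge> N \<Longrightarrow> a n x = 0"
    using a(1) unfolding is_field_def by meson
  show ?thesis
  proof (induction "nat (N - n)" arbitrary: n rule: less_induct)
    case less
    show ?case
    proof (cases "n \<ge> N")
      case True
      then show ?thesis by (simp add: N clinear_0[OF clinear_fock_embed] cvs.subspace_0[OF W(1)])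
    next
      case False
      \<comment> \<open>This m gives the summand i = n + 1 the trivial index 0 of
        \<open>E_minus\<close>. Summands with i <= n vanish by a negative index, and those with i >
        n + 1 lie in W by the induction hypothesis.\<close>
      define m where "m = n + 1 + s * p"
      define f where "f i = cscale (c - of_int i) (tensor (a (i - 1) x) (E_minus s (i - n - 1) (ket (p + s, {#}))))" for i
      define g where "g i = (if i = n + 1 then 0 else f i)" for i
      have f_eq: "f = (\<lambda>i. cscale (c - of_int i) (tensor (a (i - 1) x) (lattice_mode s (m - i - 1) (ket (p, {#})))))"
      proof
        fix i
        have "s * p - (m - i - 1) - 1 = i - n - 1" by (simp add: m_def)
        then show "f i = cscale (c - of_int i) (tensor (a (i - 1) x) (lattice_mode s (m - i - 1) (ket (p, {#}))))"
          by (simp only: f_def lattice_mode_vacuum)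
      qed
      have fin: "finite {i. f i \<noteq> 0}"
        unfolding f_eq by (intro finite_tensor_field a is_field_lattice_mode)
      have "field_sum c a (lattice_mode s) m (fock_embed x) \<in> W" by (rule c(2)[OF x(2)])
      then have sum_f: "Sum_any f \<in> W"
        by (simp only: fock_embed_homogeneous[OF x(1)] field_sum_tensor[OF a(1) is_field_lattice_mode] f_eq)
      have "g i \<in> W" for i
      proof (cases "i > n + 1")
        case True
        then have "fock_embed (a (i - 1) x) \<in> W" using False by (intro less.hyps) auto
        then have "f i \<in> W"
          unfolding f_def embed by (intro cvs.subspace_scale[OF W(1)] submodule_E_minus)
        then show ?thesis by (simp add: g_def cvs.subspace_0[OF W(1)])
      next
        case False
        then have "g i = 0" by (auto simp: g_def f_def)
        then show ?thesis by (simp add: cvs.subspace_0[OF W(1)])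
      qed
      then have sum_g: "Sum_any g \<in> W" by (rule subspace_Sum_any[OF W(1)])
      have "finite {i. g i \<noteq> 0}" by (rule finite_subset[OF _ fin]) (auto simp: g_def)
      then have "Sum_any f - Sum_any g = Sum_any (\<lambda>i. f i - g i)" by (rule Sum_any_diff[OF fin])
      also have "\<dots> = Sum_any (\<lambda>i. if i = n + 1 then f i else 0)" by (intro Sum_any.cong) (auto simp: g_def)
      also have "\<dots> = f (n + 1)" by simp
      also have "\<dots> = cscale (c - of_int (n + 1)) (fock_embed (a n x))"
        by (simp add: f_def embed)
      finally have "cscale (c - of_int (n + 1)) (fock_embed (a n x)) \<in> W"
        using cvs.subspace_diff[OF W(1) sum_f sum_g] by simp
      then have "cscale (1 / (c - of_int (n + 1))) (cscale (c - of_int (n + 1)) (fock_embed (a n x))) \<in> W"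
        by (rule cvs.subspace_scale[OF W(1)])
      moreover have "c \<noteq> of_int (n + 1)" using c(1) by auto
      ultimately show ?thesis by simp
    qed
  qed
qed

text \<open>\<open>submodule_fermion_mode\<close> needs a vector of one charge, because the mode of
  e(m) to be used depends on p. Since \<beta>(0) acts on W, the charge components of a vector in the
  preimage \<open>?U\<close> stay in \<open>?U\<close>, so \<open>?U\<close> is a nonzero Clifford
  submodule of F and hence all of F. The modes \<beta>(-k) then reach every basis vector of
  \<Pi>(0).\<close>

lemma submodule_eq_Pi_zero:
  assumes "lam \<notin> \<int>" "mu \<notin> \<int>" "W \<noteq> {0}"
  shows "W = Pi_zero"
proof -
  let ?U = "{x. fock_embed x \<in> W}"
  have U: "cvs.subspace ?U"
    by (rule cvs.subspaceI)
      (simp_all add: clinear_0[OF clinear_fock_embed] clinear_add[OF clinear_fock_embed] clinear_cscale[OF clinear_fock_embed]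
        cvs.subspace_0[OF W(1)] cvs.subspace_add[OF W(1)] cvs.subspace_scale[OF W(1)])
  let ?w = "\<lambda>S. - of_int (label_charge S) :: complex"
  have diag: "diag ?w x \<in> ?U" if "x \<in> ?U" for x
  proof -
    have "fock_embed (diag ?w x) = tensor_op id (heis 0) (fock_embed x)"
    proof (rule clinear_ext[where A = "\<lambda>x. fock_embed (diag ?w x)"])
      show "clinear (\<lambda>x. fock_embed (diag ?w x))" "clinear (\<lambda>x. tensor_op id (heis 0) (fock_embed x))"
        by (rule clinear_comp[OF clinear_fock_embed clinear_diag] clinear_comp[OF clinear_tensor_op clinear_fock_embed])+
      show "fock_embed (diag ?w (ket S)) = tensor_op id (heis 0) (fock_embed (ket S))" for S
        by (simp add: clinear_cscale[OF clinear_fock_embed] clinear_minus[OF clinear_fock_embed] tensor_op_ket heis_ket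
            tensor_minus clinear_cscale[OF tensor_linear_right] tensor_ket)
    qed
    then show ?thesis using that submodule_heis by simp
  qed
  have mode: "a n x \<in> ?U"
    if a: "is_field a" "\<And>n S T. T \<in> Poly_Mapping.keys (a n (ket S)) \<Longrightarrow> label_charge T = label_charge S + s"
    and c: "c \<notin> \<int>" "\<And>m w. w \<in> W \<Longrightarrow> field_sum c a (lattice_mode s) m w \<in> W"
    and x: "x \<in> ?U" for a s c n x
  proof -
    have "a n (component ?w d x) \<in> ?U" if d: "d \<in> ?w ` Poly_Mapping.keys x" for d
    proof -
      obtain S0 where S0: "d = - of_int (label_charge S0)" using d by blast
      have "label_charge S = label_charge S0" if "S \<in> Poly_Mapping.keys (component ?w d x)" for S
        using that S0 by (auto simp: component_def in_keys_iff lookup_diag split: if_splits)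
      moreover have "fock_embed (component ?w d x) \<in> W"
        using component_closed[OF U diag x d] by simp
      ultimately show ?thesis using submodule_fermion_mode[OF a c] by simp
    qed
    then have "(\<Sum>d\<in>?w ` Poly_Mapping.keys x. a n (component ?w d x)) \<in> ?U"
      by (rule cvs.subspace_sum[OF U])
    then show ?thesis
      by (simp only: clinear_sum[OF field_linear[OF a(1)], symmetric] sum_component)
  qed
  obtain w where w: "w \<in> W" "w \<noteq> 0" using assms(3) cvs.subspace_0[OF W(1)] by blast
  have "size M \<le> Max ((\<lambda>(S, p, M). size M) ` Poly_Mapping.keys w)" if "(S, p, M) \<in> Poly_Mapping.keys w" for S p M
    using that by (intro Max_ge) force+
  then obtain x where "x \<noteq> 0" "x \<in> ?U" using submodule_contains_fock_vector[OF w] by blast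
  then have "?U \<noteq> {0}" by blast
  then have "?U = UNIV"
  proof (rule fock_irreducible[OF U])
    show "psi_plus n x \<in> ?U" if "x \<in> ?U" for n x
      using submodule_basis_action[of _ "Loop Sl2_e _", unfolded E_basis_action_field_sum] keys_psi_plus(1)
      by (intro mode[OF is_field_psi(1) _ assms(1) _ that, where s = 1]) auto
    show "psi_minus n x \<in> ?U" if "x \<in> ?U" for n x
      using submodule_basis_action[of _ "Loop Sl2_f _", unfolded E_basis_action_field_sum] keys_psi_minus(1)
      by (intro mode[OF is_field_psi(2) _ assms(2) _ that, where s = "- 1"]) auto
  qed
  then have "fock_embed (ket S) \<in> W" for S by blast
  then have vac: "ket (S, label_charge S, {#}) \<in> W" for S by simp
  have ket: "ket (S, label_charge S, M) \<in> W" for S M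
  proof (induction M)
    case (add j M)
    have "ket (S, label_charge S, add_mset j M) = tensor_op id (heis (- int (Suc j))) (ket (S, label_charge S, M))"
      by (simp add: tensor_op_ket heis_ket nat_add_distrib tensor_ket)
    then show ?case using submodule_heis[OF add.IH] by simp
  qed (rule vac)
  have "v \<in> W" if "v \<in> Pi_zero" for v
  proof -
    have "ket y \<in> W" if "y \<in> Poly_Mapping.keys v" for y
      using that \<open>v \<in> Pi_zero\<close> ket by (cases y) (auto simp: Pi_zero_iff)
    then show ?thesis by (rule clinear_span_closed[OF clinear_id(1) W(1), of v])
  qed
  then show ?thesis using W(2) by blast
qed

end

lemma irreducible_E:
  assumes "lam \<notin> \<int>" "mu \<notin> \<int>"
  shows "irreducible_aff_module Pi_zero (E_action lam mu)"
  unfolding irreducible_aff_module_def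
proof (intro conjI allI impI)
  have "ket ({||}, 0, {#}) \<in> Pi_zero" by (simp add: Pi_zero_iff ket_def label_charge_def)
  moreover have "ket ({||}, 0, {#}) \<noteq> (0 :: space)"
    using lookup_ket[of "({||}, 0, {#}) :: space_basis" "({||}, 0, {#})"] by auto
  ultimately show "Pi_zero \<noteq> {0}" by blast
  fix W
  assume "cvs.subspace W \<and> W \<subseteq> Pi_zero \<and> (\<forall>u. \<forall>w\<in>W. E_action lam mu u w \<in> W)"
  then show "W = {0} \<or> W = Pi_zero"
    using submodule_eq_Pi_zero[of W lam mu] assms by blast
qed (rule aff_module_E)


section \<open>Counting partitions\<close>

text \<open>The number of partitions of n into parts of size at most k; the recursion asks whether a
  part k + 1 occurs. By conjugation it also counts partitions with at most k parts, the form needed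
  for the fermions.\<close>

fun bounded_partitions :: "nat \<Rightarrow> nat \<Rightarrow> nat" where
  "bounded_partitions 0 n = (if n = 0 then 1 else 0)"
| "bounded_partitions (Suc k) n = bounded_partitions k n
    + (if n \<ge> Suc k then bounded_partitions (Suc k) (n - Suc k) else 0)"

declare bounded_partitions.simps(2) [simp del]

lemma bounded_partitions_stable:
  assumes "n \<le> k"
  shows "bounded_partitions k n = bounded_partitions n n"
  using assms
proof (induction k rule: dec_induct)
  case (step k)
  then have "bounded_partitions (Suc k) n = bounded_partitions k n"
    by (subst bounded_partitions.simps(2)) simp
  with step show ?case by simp
qed simp

text \<open>The part j + 1 is stored as j, as in the Heisenberg basis.\<close>

definition weighted_msets :: "nat \<Rightarrow> nat \<Rightarrow> nat multiset set"
  where "weighted_msets k n = {M. set_mset M \<subseteq> {..<k} \<and> (\<Sum>j\<in>#M. j + 1) = n}"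

lemma weighted_msets_Suc:
  "weighted_msets (Suc k) n = weighted_msets k n \<union>
    (if n \<ge> Suc k then add_mset k ` weighted_msets (Suc k) (n - Suc k) else {})"
proof (intro set_eqI iffI)
  fix M assume M: "M \<in> weighted_msets (Suc k) n"
  show "M \<in> weighted_msets k n \<union>
    (if n \<ge> Suc k then add_mset k ` weighted_msets (Suc k) (n - Suc k) else {})"
  proof (cases "k \<in># M")
    case True
    then obtain N where N: "M = add_mset k N" by (metis multi_member_split)
    then have "n \<ge> Suc k" "N \<in> weighted_msets (Suc k) (n - Suc k)"
      using M by (auto simp: weighted_msets_def)
    then show ?thesis by (simp add: N)
  next
    case False
    have "j < k" if "j \<in># M" for j
    proof -
      have "j < Suc k" "j \<noteq> k" using M that False by (auto simp: weighted_msets_def)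
      then show ?thesis by simp
    qed
    then show ?thesis using M by (auto simp: weighted_msets_def)
  qed
qed (auto simp: weighted_msets_def split: if_splits)

lemma card_weighted_msets:
  "finite (weighted_msets k n) \<and> card (weighted_msets k n) = bounded_partitions k n"
proof (induction k n rule: bounded_partitions.induct)
  case (1 n)
  have "weighted_msets 0 n = (if n = 0 then {{#}} else {})"
    by (auto simp: weighted_msets_def)
  then show ?case by simp
next
  case (2 k n)
  have disj: "weighted_msets k n \<inter> add_mset k ` X = {}" for X
    by (auto simp: weighted_msets_def)
  have "inj_on (add_mset k) X" for X by (simp add: inj_on_def)
  then show ?case
    using 2 unfolding weighted_msets_Suc[of k n] bounded_partitions.simps(2)[of k n]
    by (cases "n \<ge> Suc k") (simp_all add: card_Un_disjoint[OF _ _ disj] card_image)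
qed

text \<open>Subtracting the staircase 0, 1, ..., k - 1 from the increasing sequence of the elements
  leaves a partition of n with at most k parts. Doubling avoids the division in k (k - 1)/2.\<close>

definition weighted_subsets :: "nat \<Rightarrow> nat \<Rightarrow> nat set set"
  where "weighted_subsets k n = {A. finite A \<and> card A = k \<and> 2 * \<Sum>A = k * (k - 1) + 2 * n}"

text \<open>Among k + 1 distinct natural numbers the maximum is at least k; removing it is the
  induction step.\<close>

lemma sum_ge_triangle:
  assumes "finite A"
  shows "card A * (card A - 1) \<le> 2 * \<Sum>(A :: nat set)"
  using assms
proof (induction "card A" arbitrary: A)
  case (Suc k)
  define m where "m = Max A"
  have "A \<noteq> {}" using Suc.hyps(2) by auto
  then have m: "m \<in> A" unfolding m_def using Suc.prems by (intro Max_in)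
  have "A \<subseteq> {..m}" unfolding m_def using Suc.prems by auto
  then have "card A \<le> Suc m" using card_mono[of "{..m}" A] by simp
  then have "k \<le> m" using Suc.hyps(2) by simp
  have A: "card (A - {m}) = k" using m Suc.hyps(2) Suc.prems by simp
  have "k * (k - 1) \<le> 2 * \<Sum>(A - {m})"
    using Suc.hyps(1)[of "A - {m}"] A Suc.prems by simp
  moreover have "\<Sum>A = m + \<Sum>(A - {m})" using m Suc.prems by (simp add: sum.remove)
  moreover have "Suc k * k = k * (k - 1) + 2 * k" by (cases k) simp_all
  ultimately have "Suc k * k \<le> 2 * \<Sum>A" using \<open>k \<le> m\<close> by linarith
  then show ?case using Suc.hyps(2) by (metis diff_Suc_1)
qed simp

lemma sum_Suc_image:
  assumes "finite A"
  shows "\<Sum>(Suc ` A) = \<Sum>A + card A"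
proof -
  have "\<Sum>(Suc ` A) = (\<Sum>a\<in>A. a + 1)" by (subst sum.reindex) simp_all
  then show ?thesis by (simp only: sum.distrib) simp
qed

text \<open>A set containing 0 corresponds to a partition with a part 0, which is dropped; otherwise
  lowering all k + 1 elements by 1 takes the first column off the partition. These are the two cases
  of \<open>bounded_partitions\<close>.\<close>

lemma weighted_subsets_Suc:
  "weighted_subsets (Suc k) n = (\<lambda>A. insert 0 (Suc ` A)) ` weighted_subsets k n \<union>
    (if n \<ge> Suc k then (`) Suc ` weighted_subsets (Suc k) (n - Suc k) else {})"
    (is "_ = ?L \<union> ?R")
proof (intro set_eqI iffI)
  have tri: "Suc k * (Suc k - 1) = k * (k - 1) + 2 * k" by (cases k) simp_all
  fix A
  show "A \<in> weighted_subsets (Suc k) n" if "A \<in> ?L \<union> ?R"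
    using that tri
    by (auto simp: weighted_subsets_def sum_Suc_image card_image split: if_splits)
  assume A: "A \<in> weighted_subsets (Suc k) n"
  define B where "B = {a. Suc a \<in> A}"
  have "Suc ` B = A - {0}"
  proof (intro set_eqI iffI)
    show "x \<in> Suc ` B" if "x \<in> A - {0}" for x using that by (cases x) (auto simp: B_def)
  qed (auto simp: B_def)
  moreover have "finite A" using A by (simp add: weighted_subsets_def)
  ultimately have B: "Suc ` B = A - {0}" "finite B"
    using finite_imageD[of Suc B] by auto
  have sum: "\<Sum>A = \<Sum>B + card B"
    using sum_Suc_image[OF B(2)] B(1) \<open>finite A\<close> by (simp add: sum_diff1_nat split: if_splits)
  have card: "card (A - {0}) = card B" unfolding B(1)[symmetric] by (simp add: card_image)
  show "A \<in> ?L \<union> ?R"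
  proof (cases "0 \<in> A")
    case True
    then have "card B = k" using card A \<open>finite A\<close> by (simp add: weighted_subsets_def)
    then have "B \<in> weighted_subsets k n"
      using A sum tri B(2) by (auto simp: weighted_subsets_def)
    moreover have "A = insert 0 (Suc ` B)" using True B(1) by auto
    ultimately show ?thesis by blast
  next
    case False
    then have cB: "card B = Suc k" and AB: "A = Suc ` B" using card A B(1) by (auto simp: weighted_subsets_def)
    have "2 * \<Sum>B + 2 * Suc k = Suc k * (Suc k - 1) + 2 * n"
      using A sum cB by (simp add: weighted_subsets_def)
    \<comment> \<open>This lower bound forces n to be at least k + 1, so that the subtraction of
      natural numbers is genuine.\<close>
    moreover have "Suc k * (Suc k - 1) \<le> 2 * \<Sum>B" using sum_ge_triangle[OF B(2)] cB by simp
    ultimately have "n \<ge> Suc k" "B \<in> weighted_subsets (Suc k) (n - Suc k)"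
      using cB B(2) by (auto simp: weighted_subsets_def)
    then show ?thesis using AB by auto
  qed
qed

lemma card_weighted_subsets:
  "finite (weighted_subsets k n) \<and> card (weighted_subsets k n) = bounded_partitions k n"
proof (induction k n rule: bounded_partitions.induct)
  case (1 n)
  have "weighted_subsets 0 n = (if n = 0 then {{}} else {})"
    by (auto simp: weighted_subsets_def)
  then show ?case by simp
next
  case (2 k n)
  have disj: "(\<lambda>A. insert 0 (Suc ` A)) ` X \<inter> (`) Suc ` Y = {}" for X Y by auto
  have "inj_on (\<lambda>A. insert 0 (Suc ` A)) X" for X
  proof (rule inj_onI)
    fix A B :: "nat set"
    assume "insert 0 (Suc ` A) = insert 0 (Suc ` B)"
    then have "insert 0 (Suc ` A) - {0} = insert 0 (Suc ` B) - {0}" by simp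
    then have "Suc ` A = Suc ` B" by auto
    then show "A = B" by (simp add: inj_image_eq_iff)
  qed
  moreover have "inj_on ((`) Suc) X" for X by (auto simp: inj_on_def inj_image_eq_iff)
  ultimately show ?case
    using 2 unfolding weighted_subsets_Suc[of k n] bounded_partitions.simps(2)[of k n]
    by (cases "n \<ge> Suc k") (simp_all add: card_Un_disjoint[OF _ _ disj] card_image)
qed


section \<open>Evaluation of the product formula\<close>

definition geometric :: "nat \<Rightarrow> 'a \<Rightarrow> 'a :: comm_ring_1 fps"
  where "geometric d c = Abs_fps (\<lambda>m. if d dvd m then c ^ (m div d) else 0)"

lemma geometric_inverse:
  assumes "d > 0"
  shows "(1 - fps_X ^ d * fps_const c) * geometric d c = 1"
proof (rule fps_ext)
  fix m
  have "fps_nth ((1 - fps_X ^ d * fps_const c) * geometric d c) m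
    = fps_nth (geometric d c) m - (if m < d then 0 else c * fps_nth (geometric d c) (m - d))"
    unfolding left_diff_distrib mult.assoc fps_sub_nth fps_X_power_mult_nth by simp
  also have "\<dots> = fps_nth 1 m"
  proof (cases "m < d")
    case True
    then show ?thesis using assms by (auto simp: geometric_def dest: dvd_imp_le)
  next
    case False
    then have "m div d = Suc ((m - d) div d)" using assms by (simp add: le_div_geq)
    moreover have "d dvd m - d \<longleftrightarrow> d dvd m" using False by (simp add: dvd_minus_self)
    ultimately show ?thesis using False assms by (simp add: geometric_def)
  qed
  finally show "fps_nth ((1 - fps_X ^ d * fps_const c) * geometric d c) m = fps_nth 1 m" .
qed

lemma q_inverse_geometric: "q_inverse (1 - q_pow (Suc n) * fps_const c) = geometric (Suc n) c"
proof -
  let ?A = "1 - q_pow (Suc n) * fps_const c"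
  have "fps_nth ?A 0 = 1" by (simp add: q_pow_def)
  then have inv: "?A * q_inverse ?A = 1" by (rule q_inverse)
  have "?A * geometric (Suc n) c = 1" unfolding q_pow_def by (rule geometric_inverse) simp
  then have "q_inverse ?A = (?A * geometric (Suc n) c) * q_inverse ?A" by simp
  also have "\<dots> = geometric (Suc n) c * (?A * q_inverse ?A)" by (simp only: mult_ac)
  finally show ?thesis by (simp add: inv)
qed

text \<open>Euler's product: by the recursion of \<open>bounded_partitions\<close>, multiplication
  by 1 - q^(k+1) turns the series for k + 1 into the one for k.\<close>

lemma prod_bounded_partitions:
  "(\<Prod>i<k. geometric (Suc i) (1 :: complex)) = Abs_fps (\<lambda>n. of_nat (bounded_partitions k n))"
proof (induction k)
  case 0
  show ?case by (rule fps_ext) simp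
next
  case (Suc k)
  let ?P = "\<lambda>k. Abs_fps (\<lambda>n. of_nat (bounded_partitions k n)) :: complex fps"
  have "(1 - fps_X ^ Suc k * fps_const 1) * ?P (Suc k) = ?P k"
  proof (rule fps_ext)
    fix m
    show "fps_nth ((1 - fps_X ^ Suc k * fps_const 1) * ?P (Suc k)) m = fps_nth (?P k) m"
      unfolding left_diff_distrib mult.assoc fps_sub_nth fps_X_power_mult_nth
      by (simp add: bounded_partitions.simps(2)[of k m] del: power_Suc)
  qed
  then have "geometric (Suc k) 1 * ?P k = (1 - fps_X ^ Suc k * fps_const 1) * geometric (Suc k) 1 * ?P (Suc k)"
    by (simp only: mult_ac)
  also have "\<dots> = ?P (Suc k)" by (subst geometric_inverse) simp_all
  finally show ?case using Suc.IH by (simp add: mult.commute)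
qed

text \<open>The factor B n is 1 modulo q^(n+1), so coefficient k is settled once the factors 0, ...,
  k have been multiplied.\<close>

lemma prodinf_nth:
  fixes B :: "nat \<Rightarrow> laurent fps"
  assumes "\<And>n. \<exists>G. B n = 1 + q_pow (Suc n) * G"
  shows "fps_nth (prodinf B) k = fps_nth (\<Prod>i\<le>k. B i) k"
proof -
  obtain G where G: "\<And>n. B n = 1 + q_pow (Suc n) * G n" using assms by metis
  have B_mult: "fps_nth (A * B n) k = fps_nth A k" if "k \<le> n" for A n k
  proof -
    have "A * B n = A + fps_X ^ Suc n * (A * G n)"
      unfolding G q_pow_def by (simp only: distrib_left mult_1_right mult.left_commute)
    then show ?thesis using that by (simp add: fps_X_power_mult_nth del: power_Suc)
  qed
  have stable: "fps_nth (\<Prod>i\<le>n. B i) k = fps_nth (\<Prod>i\<le>k. B i) k" if "k \<le> n" for n k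
    using that
  proof (induction n rule: dec_induct)
    case (step n)
    then show ?case using B_mult[of k "Suc n" "\<Prod>i\<le>n. B i"] by simp
  qed simp
  define L where "L = Abs_fps (\<lambda>k. fps_nth (\<Prod>i\<le>k. B i) k)"
  have lim: "(\<lambda>n. \<Prod>i\<le>n. B i) \<longlonglongrightarrow> L"
  proof (rule tendsto_fpsI)
    fix k
    show "\<forall>\<^sub>F n in sequentially. fps_nth (\<Prod>i\<le>n. B i) k = fps_nth L k"
      using eventually_ge_at_top[of k] by eventually_elim (unfold L_def fps_nth_Abs_fps, rule stable)
  qed
  have "fps_nth (B i) 0 = 1" for i by (simp add: G q_pow_def)
  then have B_nz: "B i \<noteq> 0" for i by (metis fps_zero_nth zero_neq_one)
  have "fps_nth L 0 = 1" by (simp add: L_def G q_pow_def)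
  then have "L \<noteq> 0" by (metis fps_zero_nth zero_neq_one)
  with lim have has: "B has_prod L" by (simp add: has_prod_def raw_has_prod_def)
  \<comment> \<open>\<open>has_prod\<close> also admits the value 0 when a factor vanishes. No
    factor does here, so every value is the limit of the partial products.\<close>
  have "p = L" if "B has_prod p" for p
    using that B_nz LIMSEQ_unique[OF _ lim, of p] by (auto simp: has_prod_def raw_has_prod_def)
  with has have "prodinf B = L" unfolding prodinf_def by (rule the_equality)
  then show ?thesis by (simp add: L_def)
qed

section \<open>Evaluation at z = 1 and even powers of z\<close>

definition eval_one :: "laurent \<Rightarrow> complex"
  where "eval_one f = (\<Sum>j\<in>Poly_Mapping.keys f. Poly_Mapping.lookup f j)"

lemma eval_one_superset:
  assumes "finite S" "Poly_Mapping.keys f \<subseteq> S"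
  shows "eval_one f = (\<Sum>j\<in>S. Poly_Mapping.lookup f j)"
  unfolding eval_one_def using assms by (intro sum.mono_neutral_left) (auto simp: in_keys_iff)

lemma eval_one_add: "eval_one (f + g) = eval_one f + eval_one g"
proof -
  let ?S = "Poly_Mapping.keys f \<union> Poly_Mapping.keys g"
  have "Poly_Mapping.keys (f + g) \<subseteq> ?S" by (rule Poly_Mapping.keys_add)
  then show ?thesis by (simp add: eval_one_superset[of ?S] lookup_add sum.distrib)
qed

lemma eval_one_0 [simp]: "eval_one 0 = 0"
  by (simp add: eval_one_def)

lemma eval_one_sum: "eval_one (sum f I) = (\<Sum>i\<in>I. eval_one (f i))"
  by (induction I rule: infinite_finite_induct) (simp_all add: eval_one_add)

lemma eval_one_single [simp]: "eval_one (Poly_Mapping.single j x) = x"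
  by (simp add: eval_one_def)

lemma laurent_expand: "f = (\<Sum>j\<in>Poly_Mapping.keys f. Poly_Mapping.single j (Poly_Mapping.lookup f j))"
  by (rule poly_mapping_eqI) (auto simp: lookup_sum lookup_single when_def in_keys_iff)

lemma eval_one_mult: "eval_one (f * g) = eval_one f * eval_one g"
proof -
  have "f * g = (\<Sum>i\<in>Poly_Mapping.keys f. \<Sum>j\<in>Poly_Mapping.keys g.
      Poly_Mapping.single (i + j) (Poly_Mapping.lookup f i * Poly_Mapping.lookup g j))"
    by (subst laurent_expand[of f], subst laurent_expand[of g])
      (simp add: sum_product mult_single)
  then show ?thesis by (simp add: eval_one_sum eval_one_def[of f] eval_one_def[of g] sum_product)
qed

lemma eval_one_1 [simp]: "eval_one 1 = 1"
  using eval_one_single[of 0 1] by (simp only: single_one)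

lemma eval_one_z_pow: "eval_one (z_pow k ^ n) = 1"
  by (induction n) (simp_all add: eval_one_mult z_pow_def)

definition fps_eval_one :: "laurent fps \<Rightarrow> complex fps"
  where "fps_eval_one A = Abs_fps (\<lambda>k. eval_one (fps_nth A k))"

lemma fps_eval_one_mult: "fps_eval_one (A * B) = fps_eval_one A * fps_eval_one B"
  by (rule fps_ext) (simp add: fps_eval_one_def fps_mult_nth eval_one_sum eval_one_mult)

lemma fps_eval_one_prod: "fps_eval_one (prod B I) = (\<Prod>i\<in>I. fps_eval_one (B i))"
proof -
  have "fps_eval_one 1 = 1" by (rule fps_ext) (simp add: fps_eval_one_def)
  then show ?thesis
    by (induction I rule: infinite_finite_induct) (simp_all add: fps_eval_one_mult)
qed

lemma fps_eval_one_geometric: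
  assumes "\<And>n. eval_one (c ^ n) = 1"
  shows "fps_eval_one (geometric d c) = geometric d 1"
  by (rule fps_ext) (simp add: fps_eval_one_def geometric_def assms)

definition even_laurent :: "laurent \<Rightarrow> bool"
  where "even_laurent f \<longleftrightarrow> (\<forall>j\<in>Poly_Mapping.keys f. even j)"

lemma even_laurent_0: "even_laurent 0" and even_laurent_1: "even_laurent 1"
  by (simp_all add: even_laurent_def)

lemma even_laurent_add:
  assumes "even_laurent f" "even_laurent g"
  shows "even_laurent (f + g)"
  using assms Poly_Mapping.keys_add[of f g] by (auto simp: even_laurent_def)

lemma even_laurent_sum:
  assumes "\<And>i. i \<in> I \<Longrightarrow> even_laurent (f i)"
  shows "even_laurent (sum f I)"
  using assms
  by (induction I rule: infinite_finite_induct) (simp_all add: even_laurent_0 even_laurent_add)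

lemma even_laurent_mult:
  assumes "even_laurent f" "even_laurent g"
  shows "even_laurent (f * g)"
  using assms keys_mult[of f g] by (fastforce simp: even_laurent_def)

lemma even_laurent_power: "even_laurent f \<Longrightarrow> even_laurent (f ^ n)"
  by (induction n) (simp_all add: even_laurent_1 even_laurent_mult)

lemma even_laurent_fps_mult:
  assumes "\<And>k. even_laurent (fps_nth A k)" "\<And>k. even_laurent (fps_nth B k)"
  shows "even_laurent (fps_nth (A * B) k)"
  unfolding fps_mult_nth by (intro even_laurent_sum even_laurent_mult assms)

lemma even_laurent_fps_prod:
  assumes "\<And>i k. even_laurent (fps_nth (B i) k)"
  shows "even_laurent (fps_nth (prod B I) k)"
proof (induction I arbitrary: k rule: infinite_finite_induct)
  case (insert i I)
  then show ?case by (simp add: even_laurent_fps_mult assms)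
qed (simp_all add: even_laurent_0 even_laurent_1 fps_one_nth)

text \<open>As z^(2l) delta(z^2) = delta(z^2), an even Laurent polynomial in front of delta(z^2) may
  be replaced by its value at z = 1.\<close>

lemma qz_mult_delta:
  assumes "even_laurent (fps_nth A n)"
  shows "qz_mult A delta_z2 n \<nu> = (if \<exists>k::int. \<nu> = of_int (2 * k) then eval_one (fps_nth A n) else 0)"
proof -
  let ?P = "\<lambda>\<nu> :: complex. \<exists>k::int. \<nu> = of_int (2 * k)"
  have shift: "?P (\<nu> - of_int j) \<longleftrightarrow> ?P \<nu>" if "even j" for j
  proof -
    obtain l where j: "j = 2 * l" using \<open>even j\<close> by blast
    show ?thesis
    proof
      assume "?P (\<nu> - of_int j)"
      then obtain k where "\<nu> - of_int j = of_int (2 * k)" by blast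
      then have "\<nu> = of_int (2 * (k + l))" by (simp add: j algebra_simps)
      then show "?P \<nu>" by blast
    next
      assume "?P \<nu>"
      then obtain k where "\<nu> = of_int (2 * k)" by blast
      then have "\<nu> - of_int j = of_int (2 * (k - l))" by (simp add: j algebra_simps)
      then show "?P (\<nu> - of_int j)" by blast
    qed
  qed
  have "qz_mult A delta_z2 n \<nu> = (\<Sum>k\<le>n. if k = n then \<Sum>j\<in>Poly_Mapping.keys (fps_nth A k).
      Poly_Mapping.lookup (fps_nth A k) j * (if ?P (\<nu> - of_int j) then 1 else 0) else 0)"
    unfolding qz_mult_def delta_z2_def by (intro sum.cong refl) auto
  also have "\<dots> = (\<Sum>j\<in>Poly_Mapping.keys (fps_nth A n).
      Poly_Mapping.lookup (fps_nth A n) j * (if ?P (\<nu> - of_int j) then 1 else 0))"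
    by simp
  also have "\<dots> = (\<Sum>j\<in>Poly_Mapping.keys (fps_nth A n).
      Poly_Mapping.lookup (fps_nth A n) j * (if ?P \<nu> then 1 else 0))"
    using assms shift by (intro sum.cong refl) (simp add: even_laurent_def)
  finally show ?thesis by (simp add: eval_one_def)
qed

text \<open>It is used with c = z^2, d = z^(-2) and with c = d = 1, the two products of the
  character formula. At z = 1 both become the product of (1 - q^n)^(-2), whose coefficients count
  pairs of partitions.\<close>

lemma eval_product:
  assumes c: "\<And>n. eval_one (c ^ n) = 1" "even_laurent c" and d: "\<And>n. eval_one (d ^ n) = 1" "even_laurent d"
  defines "A \<equiv> prodinf (\<lambda>n. geometric (Suc n) c * geometric (Suc n) d)"
  shows "even_laurent (fps_nth A n)"
    and "eval_one (fps_nth A n) = (\<Sum>i\<le>n. of_nat (bounded_partitions i i * bounded_partitions (n - i) (n - i)))"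
proof -
  let ?B = "\<lambda>n. geometric (Suc n) c * geometric (Suc n) d"
  have geom: "\<exists>G. geometric (Suc n) c = 1 + q_pow (Suc n) * G" for n and c :: laurent
    using geometric_inverse[of "Suc n" c]
    by (intro exI[of _ "fps_const c * geometric (Suc n) c"]) (simp add: q_pow_def algebra_simps)
  have "\<exists>G. ?B n = 1 + q_pow (Suc n) * G" for n
  proof -
    obtain G G' where "geometric (Suc n) c = 1 + q_pow (Suc n) * G" "geometric (Suc n) d = 1 + q_pow (Suc n) * G'"
      using geom by metis
    then show ?thesis
      by (intro exI[of _ "G + G' + q_pow (Suc n) * (G * G')"]) (simp add: algebra_simps)
  qed
  then have nth: "fps_nth A n = fps_nth (\<Prod>i\<le>n. ?B i) n"
    unfolding A_def by (rule prodinf_nth)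
  have "even_laurent (fps_nth (geometric m c) k)" "even_laurent (fps_nth (geometric m d) k)" for m k
    using c(2) d(2) by (simp_all add: geometric_def even_laurent_power even_laurent_0)
  then show "even_laurent (fps_nth A n)"
    unfolding nth by (intro even_laurent_fps_prod even_laurent_fps_mult)
  have "eval_one (fps_nth A n) = fps_nth (fps_eval_one (\<Prod>i\<le>n. ?B i)) n"
    by (simp add: nth fps_eval_one_def)
  also have "fps_eval_one (\<Prod>i\<le>n. ?B i) = (\<Prod>i<Suc n. geometric (Suc i) 1) * (\<Prod>i<Suc n. geometric (Suc i) 1)"
    by (simp only: fps_eval_one_prod fps_eval_one_mult fps_eval_one_geometric[OF c(1)] fps_eval_one_geometric[OF d(1)]
        prod.distrib lessThan_Suc_atMost)
  also have "fps_nth \<dots> n = (\<Sum>i=0..n. of_nat (bounded_partitions (Suc n) i) * of_nat (bounded_partitions (Suc n) (n - i)))"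
    unfolding prod_bounded_partitions fps_mult_nth fps_nth_Abs_fps ..
  also have "\<dots> = (\<Sum>i\<le>n. of_nat (bounded_partitions i i * bounded_partitions (n - i) (n - i)))"
    unfolding atLeast0AtMost
    by (intro sum.cong refl) (simp add: bounded_partitions_stable[of _ "Suc n"])
  finally show "eval_one (fps_nth A n)
    = (\<Sum>i\<le>n. of_nat (bounded_partitions i i * bounded_partitions (n - i) (n - i)))" .
qed


section \<open>Fermionic states and partitions\<close>

text \<open>
  If all labels of \<open>S\<close> are below \<open>N\<close>, then \<open>fermion_subset N S\<close> is the set of positions, counted
  downwards from \<open>N - 1\<close>, of the particles of the Maya diagram that has the particles \<open>j < 0\<close>,
  \<open>j \<in> S\<close>, and the particles \<open>j \<ge> 0\<close>, \<open>j \<notin> S\<close>.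
\<close>

definition fermion_subset :: "nat \<Rightarrow> int fset \<Rightarrow> nat set"
  where "fermion_subset N S = {a. (int N - 1 - int a |\<in>| S) \<noteq> (a < N)}"

text \<open>The set is the symmetric difference of {0, ..., N - 1} with the positions N - 1 - j of
  the labels j: a label j < 0 adds a position, a label j >= 0 removes one.\<close>

lemma sum_fermion_subset:
  fixes f :: "nat \<Rightarrow> int"
  assumes "\<And>j. j |\<in>| S \<Longrightarrow> j < int N"
  shows "finite (fermion_subset N S)"
    and "(\<Sum>a\<in>fermion_subset N S. f a) = (\<Sum>a<N. f a)
      + (\<Sum>j\<in>fset S. (if j < 0 then 1 else - 1) * f (nat (int N - 1 - j)))"
proof -
  define T where "T = {a. int N - 1 - int a |\<in>| S}"
  have S: "fset S = (\<lambda>a. int N - 1 - int a) ` T"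
  proof (intro set_eqI iffI)
    fix j assume j: "j \<in> fset S"
    then have "j = int N - 1 - int (nat (int N - 1 - j))" using assms[of j] by simp
    with j show "j \<in> (\<lambda>a. int N - 1 - int a) ` T" by (intro image_eqI[of _ _ "nat (int N - 1 - j)"]) (auto simp: T_def)
  qed (auto simp: T_def)
  have inj: "inj_on (\<lambda>a. int N - 1 - int a) T" by (auto simp: inj_on_def)
  have T: "finite T" using finite_imageD[OF _ inj] by (simp flip: S)
  let ?U = "T \<union> {..<N}"
  have A: "a \<in> fermion_subset N S \<longleftrightarrow> (a \<in> T) \<noteq> (a < N)" for a by (simp add: fermion_subset_def T_def)
  then have sub: "fermion_subset N S \<subseteq> ?U" by auto
  then show "finite (fermion_subset N S)" by (rule finite_subset) (simp add: T)
  have "(\<Sum>j\<in>fset S. (if j < 0 then 1 else - 1) * f (nat (int N - 1 - j)))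
    = (\<Sum>a\<in>T. (if a < N then - 1 else 1) * f a)"
    unfolding S by (subst sum.reindex[OF inj]) (auto intro!: sum.cong)
  also have "\<dots> = (\<Sum>a\<in>?U. if a \<in> T then (if a < N then - 1 else 1) * f a else 0)"
    using T by (intro sum.mono_neutral_cong_left) auto
  finally have "(\<Sum>a<N. f a) + (\<Sum>j\<in>fset S. (if j < 0 then 1 else - 1) * f (nat (int N - 1 - j)))
    = (\<Sum>a\<in>?U. if a < N then f a else 0) + (\<Sum>a\<in>?U. if a \<in> T then (if a < N then - 1 else 1) * f a else 0)"
    using T by (intro arg_cong2[where f = "(+)"] sum.mono_neutral_cong_left) auto
  also have "\<dots> = (\<Sum>a\<in>?U. if a \<in> fermion_subset N S then f a else 0)"
    unfolding sum.distrib[symmetric] by (intro sum.cong refl) (auto simp: A)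
  also have "\<dots> = (\<Sum>a\<in>fermion_subset N S. f a)"
    using T sub by (intro sum.mono_neutral_cong_right) auto
  finally show "(\<Sum>a\<in>fermion_subset N S. f a) = (\<Sum>a<N. f a)
      + (\<Sum>j\<in>fset S. (if j < 0 then 1 else - 1) * f (nat (int N - 1 - j)))" ..
qed

lemma sum_lessThan_double: "(\<Sum>a<N. 2 * int a) = int N * (int N - 1)"
  by (induction N) (simp_all add: algebra_simps)

text \<open>Twice a position is 2 (N - 1 - j), so with its sign a label contributes (2N - 1) times
  its charge plus |2j + 1|. Together with N (N - 1) from the reference set this is k (k - 1) +
  energy - charge^2.\<close>

lemma fermion_subset_card_sum:
  assumes "\<And>j. j |\<in>| S \<Longrightarrow> j < int N"
  defines "k \<equiv> int N + label_charge S"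
  shows "int (card (fermion_subset N S)) = k"
    and "2 * int (\<Sum>(fermion_subset N S)) = k * (k - 1) + (label_energy S - label_charge S * label_charge S)"
proof -
  show "int (card (fermion_subset N S)) = k"
    using sum_fermion_subset(2)[OF assms(1), where f = "\<lambda>_. 1"] by (simp add: k_def label_charge_def)
  have "2 * int (\<Sum>(fermion_subset N S)) = (\<Sum>a\<in>fermion_subset N S. 2 * int a)"
    by (simp add: sum_distrib_left)
  also have "\<dots> = int N * (int N - 1)
      + (\<Sum>j\<in>fset S. (if j < 0 then 1 else - 1) * (2 * int (nat (int N - 1 - j))))"
    by (simp only: sum_fermion_subset(2)[OF assms(1)] sum_lessThan_double)
  also have "(\<Sum>j\<in>fset S. (if j < 0 then 1 else - 1) * (2 * int (nat (int N - 1 - j))))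
    = (\<Sum>j\<in>fset S. (2 * int N - 1) * (if j < 0 then 1 else - 1) + \<bar>2 * j + 1\<bar>)"
  proof (intro sum.cong refl)
    fix j assume "j \<in> fset S"
    then have "j < int N" by (rule assms(1))
    then show "(if j < 0 then 1 else - 1) * (2 * int (nat (int N - 1 - j)))
      = (2 * int N - 1) * (if j < 0 then 1 else - 1) + \<bar>2 * j + 1\<bar>"
      by (cases "j < 0") simp_all
  qed
  also have "\<dots> = (2 * int N - 1) * label_charge S + label_energy S"
    by (simp only: sum.distrib sum_distrib_left label_charge_def label_energy_def)
  finally show "2 * int (\<Sum>(fermion_subset N S)) = k * (k - 1) + (label_energy S - label_charge S * label_charge S)"
    by (simp add: k_def algebra_simps)
qed

lemma fset_int_bound: "\<exists>N::nat. \<forall>j. j |\<in>| S \<longrightarrow> j < int N"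
proof (intro exI allI impI)
  fix j assume "j |\<in>| S"
  then have "\<bar>j\<bar> \<le> (\<Sum>j\<in>fset S. \<bar>j\<bar>)" by (intro member_le_sum) auto
  then show "j < int (nat (\<Sum>j\<in>fset S. \<bar>j\<bar>) + 1)" by linarith
qed

text \<open>Non-negativity is \<open>sum_ge_triangle\<close> for the Maya diagram, and evenness
  holds because k (k - 1) is even. Thus fermions of charge p compensate the weight -p^2/2 of
  e^(p\<beta>), and L(0) has natural eigenvalues on \<Pi>(0).\<close>

lemma label_energy_excess: "\<exists>n::nat. label_energy S - label_charge S * label_charge S = 2 * int n"
proof -
  obtain N where N: "\<And>j. j |\<in>| S \<Longrightarrow> j < int N" using fset_int_bound by blast
  let ?A = "fermion_subset N S"
  define k where "k = card ?A"
  have "k * (k - 1) \<le> 2 * \<Sum>?A"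
    unfolding k_def by (intro sum_ge_triangle sum_fermion_subset(1) N)
  then obtain d where d: "2 * \<Sum>?A = k * (k - 1) + d" using le_Suc_ex by blast
  have "even (k * (k - 1))" by (cases "even k") simp_all
  then have "even d" using d by (metis dvd_add_right_iff dvd_triv_left)
  then obtain n where n: "d = 2 * n" by blast
  have "int (k * (k - 1)) = int k * (int k - 1)" by (cases k) (simp_all add: algebra_simps)
  then have "2 * int (\<Sum>?A) = int k * (int k - 1) + 2 * int n" using d n by linarith
  then show ?thesis using fermion_subset_card_sum[OF N] by (intro exI[of _ n]) (simp add: k_def)
qed

definition fermion_states :: "int \<Rightarrow> nat \<Rightarrow> int fset set"
  where "fermion_states p n = {S. label_charge S = p \<and> label_energy S - p * p = 2 * int n}"

text \<open>The counting form of the boson-fermion correspondence: above its ground state every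
  charge sector of F has as many states as there are partitions, independently of the
  charge.\<close>

lemma card_fermion_states:
  "finite (fermion_states p n) \<and> card (fermion_states p n) = bounded_partitions n n"
proof -
  \<comment> \<open>N exceeds all labels that a state of this charge and energy can contain, and k =
    N + p is at least n, so that allowing at most k parts is no restriction.\<close>
  define N where "N = nat (p * p + 2 * int n + \<bar>p\<bar>) + 1"
  have N: "int N = p * p + 2 * int n + \<bar>p\<bar> + 1" by (simp add: N_def)
  define k where "k = nat (int N + p)"
  have "int N + p \<ge> 0" unfolding N using zero_le_square[of p] by linarith
  then have k: "int k = int N + p" by (simp add: k_def)
  have kn: "n \<le> k"
  proof -
    have "int n \<le> int k" unfolding k N using zero_le_square[of p] by linarith
    then show ?thesis by simp
  qed
  have bound: "j < int N" if "S \<in> fermion_states p n" "j |\<in>| S" for S j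
  proof -
    have "\<bar>2 * j + 1\<bar> \<le> label_energy S"
      unfolding label_energy_def using that(2) by (intro member_le_sum) auto
    moreover have "label_energy S = p * p + 2 * int n" using that(1) by (simp add: fermion_states_def)
    ultimately show ?thesis unfolding N using zero_le_square[of p] by linarith
  qed
  have tri: "int (k * (k - 1)) = int k * (int k - 1)" by (cases k) (simp_all add: algebra_simps)
  have states_iff: "S \<in> fermion_states p n \<longleftrightarrow> fermion_subset N S \<in> weighted_subsets k n"
    if S: "\<And>j. j |\<in>| S \<Longrightarrow> j < int N" for S
  proof -
    let ?A = "fermion_subset N S"
    have card: "card ?A = k \<longleftrightarrow> label_charge S = p"
      using fermion_subset_card_sum(1)[of S N, OF S] k by linarith
    have "2 * \<Sum>?A = k * (k - 1) + 2 * n \<longleftrightarrow> label_energy S - p * p = 2 * int n" if "label_charge S = p"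
    proof -
      have "2 * int (\<Sum>?A) = int k * (int k - 1) + (label_energy S - p * p)"
        using fermion_subset_card_sum(2)[of S N, OF S] that k by simp
      then show ?thesis using tri by linarith
    qed
    then show ?thesis
      using card sum_fermion_subset(1)[of S N, OF S] by (auto simp: fermion_states_def weighted_subsets_def)
  qed
  have "bij_betw (fermion_subset N) (fermion_states p n) (weighted_subsets k n)"
  proof (rule bij_betwI')
    fix S S' assume S: "S \<in> fermion_states p n" "S' \<in> fermion_states p n"
    show "fermion_subset N S = fermion_subset N S' \<longleftrightarrow> S = S'"
    proof
      assume eq: "fermion_subset N S = fermion_subset N S'"
      \<comment> \<open>A symmetric difference with {0, ..., N - 1} is undone by taking it again,
        which recovers the labels from the positions.\<close>
      have mem: "j |\<in>| R \<longleftrightarrow> j < int N \<and> (nat (int N - 1 - j) \<in> fermion_subset N R \<longleftrightarrow> nat (int N - 1 - j) \<ge> N)"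
        if "R \<in> fermion_states p n" for R j
        using bound[OF that, of j] by (auto simp: fermion_subset_def)
      show "S = S'" by (rule fset_eqI) (simp only: mem[OF S(1)] mem[OF S(2)] eq)
    qed simp
  next
    show "fermion_subset N S \<in> weighted_subsets k n" if "S \<in> fermion_states p n" for S
      using states_iff[of S] bound[OF that] that by blast
  next
    fix B assume B: "B \<in> weighted_subsets k n"
    \<comment> \<open>The same inversion produces the preimage of B.\<close>
    let ?T = "{a. (a \<in> B) \<noteq> (a < N)}"
    have "finite ?T"
      by (rule finite_subset[of _ "B \<union> {..<N}"]) (use B in \<open>auto simp: weighted_subsets_def\<close>)
    then have fin: "finite ((\<lambda>a. int N - 1 - int a) ` ?T)" by simp
    define S where "S = Abs_fset ((\<lambda>a. int N - 1 - int a) ` ?T)"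
    have S: "fset S = (\<lambda>a. int N - 1 - int a) ` ?T"
      unfolding S_def using fin by (simp add: Abs_fset_inverse)
    have "int N - 1 - int a |\<in>| S \<longleftrightarrow> a \<in> ?T" for a
      unfolding S by (auto simp: image_iff)
    then have A: "fermion_subset N S = B" by (auto simp: fermion_subset_def)
    have "j < int N" if "j |\<in>| S" for j using that unfolding S by auto
    then have "S \<in> fermion_states p n" using states_iff[of S] A B by blast
    then show "\<exists>S\<in>fermion_states p n. B = fermion_subset N S" using A by blast
  qed
  then show ?thesis
    using bij_betw_finite bij_betw_same_card card_weighted_subsets[of k n] bounded_partitions_stable[OF kn] by metis
qed

lemma card_lattice_weight:
  "finite {M. lattice_weight (p, M) = n} \<and> card {M. lattice_weight (p, M) = n} = bounded_partitions n n"
proof -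
  have "{M. lattice_weight (p, M) = n} = weighted_msets n n"
  proof (intro set_eqI iffI)
    fix M assume M: "M \<in> {M. lattice_weight (p, M) = n}"
    have "j < n" if j: "j \<in># M" for j
    proof -
      obtain N where "M = add_mset j N" using j by (metis multi_member_split)
      then show ?thesis using M by (auto simp: lattice_weight_def)
    qed
    then show "M \<in> weighted_msets n n" using M by (auto simp: weighted_msets_def lattice_weight_def)
  qed (auto simp: weighted_msets_def lattice_weight_def)
  then show ?thesis using card_weighted_msets by simp
qed


section \<open>The character\<close>

lemma span_ket:
  fixes B :: "'a set"
  shows "cvs.span (ket ` B) = {v. \<forall>x\<in>Poly_Mapping.keys v. x \<in> B}"
proof
  show "cvs.span (ket ` B) \<subseteq> {v. \<forall>x\<in>Poly_Mapping.keys v. x \<in> B}"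
    by (rule cvs.span_minimal[OF _ subspace_keys]) (auto simp: ket_def)
  show "{v. \<forall>x\<in>Poly_Mapping.keys v. x \<in> B} \<subseteq> cvs.span (ket ` B)"
  proof clarify
    fix v :: "'a \<Rightarrow>\<^sub>0 complex"
    assume "\<forall>x\<in>Poly_Mapping.keys v. x \<in> B"
    then show "v \<in> cvs.span (ket ` B)"
      by (subst ket_expand) (intro cvs.span_sum cvs.span_scale cvs.span_base, blast)
  qed
qed

lemma inj_ket: "inj_on ket B"
proof (rule inj_onI)
  fix a b :: 'a assume "ket a = ket b"
  then have "Poly_Mapping.lookup (ket a) b = Poly_Mapping.lookup (ket b) b" by simp
  then show "a = b" by (simp add: lookup_ket split: if_splits)
qed

lemma dim_keys:
  assumes "finite B"
  shows "cvs.dim {v. \<forall>x\<in>Poly_Mapping.keys v. x \<in> B} = card B"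
proof -
  have "cvs.independent (ket ` B)"
  proof (rule cvs.independent_if_scalars_zero)
    fix f x assume sum: "(\<Sum>x\<in>ket ` B. cscale (f x) x) = 0" and x: "x \<in> ket ` B"
    obtain b where b: "b \<in> B" "x = ket b" using x by blast
    have "0 = Poly_Mapping.lookup (\<Sum>x\<in>ket ` B. cscale (f x) x) b" using sum by simp
    also have "\<dots> = (\<Sum>a\<in>B. if a = b then f (ket a) else 0)"
      unfolding sum.reindex[OF inj_ket] lookup_sum by (intro sum.cong) (auto simp: lookup_ket)
    finally show "f x = 0" using assms b by simp
  qed (use assms in simp)
  then have "cvs.dim {v. \<forall>x\<in>Poly_Mapping.keys v. x \<in> B} = card (ket ` B)"
    by (intro cvs.dim_eq_card) (simp_all add: span_ket[symmetric] cvs.span_span)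
  then show ?thesis by (simp add: card_image inj_ket)
qed

text \<open>The parameter a stands for \<lambda> - \<mu>; as \<beta>(0) = -p, the operator h(0) has
  the eigenvalue 2p + a.\<close>

definition weight_basis :: "complex \<Rightarrow> nat \<Rightarrow> complex \<Rightarrow> space_basis set"
  where "weight_basis a n \<nu> =
    {(S, p, M). label_charge S = p \<and> energy (S, p, M) = of_nat n \<and> 2 * of_int p + a = \<nu>}"

lemma h_zero_diag: "E_basis_action lam mu (Loop Sl2_h 0) v = diag (\<lambda>(S, p, M). 2 * of_int p + (lam - mu)) v"
proof (rule clinear_ext[OF clinear_E_basis_action clinear_diag])
  fix x :: space_basis
  show "E_basis_action lam mu (Loop Sl2_h 0) (ket x) = diag (\<lambda>(S, p, M). 2 * of_int p + (lam - mu)) (ket x)"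
    by (cases x) (simp add: tensor_op_ket heis_ket tensor_minus clinear_cscale[OF tensor_linear_right] tensor_ket
        cvs.scale_left_distrib)
qed

text \<open>H(0), L(0) and h(0) are all diagonal in the tensor basis, so their joint eigenspaces are
  spanned by basis vectors and dimensions become cardinalities.\<close>

lemma weight_space_E:
  "weight_space Pi_zero (E_action lam mu) n \<nu>
    = {v. \<forall>x\<in>Poly_Mapping.keys v. x \<in> weight_basis (lam - mu) n \<nu>}"
  unfolding weight_space_def energy_space_def E_action_ket h_zero_diag
  by (auto simp: virasoro_diag diag_eq_scale_iff Pi_zero_iff weight_basis_def)

lemma energy_excess:
  assumes "label_energy S - p * p = 2 * int i"
  shows "energy (S, p, M) = of_nat (i + lattice_weight (p, M))"
  unfolding energy_def prod.case assms by simp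

text \<open>\<nu> fixes the charge p. The energy n splits into the fermionic excess i and the
  Heisenberg weight n - i, each counted by partitions, so the answer is the same for every
  p.\<close>

lemma card_weight_basis:
  "finite (weight_basis a n \<nu>)"
  "card (weight_basis a n \<nu>) = (if \<exists>k::int. \<nu> - a = of_int (2 * k)
      then \<Sum>i\<le>n. bounded_partitions i i * bounded_partitions (n - i) (n - i) else 0)"
proof -
  have "finite (weight_basis a n \<nu>) \<and> card (weight_basis a n \<nu>) = (if \<exists>k::int. \<nu> - a = of_int (2 * k)
      then \<Sum>i\<le>n. bounded_partitions i i * bounded_partitions (n - i) (n - i) else 0)"
  proof (cases "\<exists>k::int. \<nu> - a = of_int (2 * k)")
    case True
    then obtain p :: int where p: "\<nu> - a = of_int (2 * p)" by blast
    have p_iff: "2 * of_int q + a = \<nu> \<longleftrightarrow> q = p" for q :: int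
    proof -
      have "2 * of_int q + a = \<nu> \<longleftrightarrow> (of_int (2 * q) :: complex) = of_int (2 * p)"
        unfolding p[symmetric] by (auto simp: algebra_simps)
      then show ?thesis by (simp only: of_int_eq_iff) simp
    qed
    let ?X = "\<lambda>i. (\<lambda>(S, M). (S, p, M)) ` (fermion_states p i \<times> {M. lattice_weight (p, M) = n - i})"
    have basis: "weight_basis a n \<nu> = (\<Union>i\<in>{..n}. ?X i)"
    proof (intro set_eqI iffI)
      fix x assume x: "x \<in> weight_basis a n \<nu>"
      then obtain S M where x': "x = (S, p, M)" and S: "label_charge S = p" and en: "energy (S, p, M) = of_nat n"
        by (auto simp: weight_basis_def p_iff)
      obtain i where i: "label_energy S - p * p = 2 * int i" using label_energy_excess[of S] S by auto
      have "i + lattice_weight (p, M) = n"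
        using en unfolding energy_excess[OF i] of_nat_eq_iff .
      then have "i \<le> n" "lattice_weight (p, M) = n - i" by auto
      then show "x \<in> (\<Union>i\<in>{..n}. ?X i)" using S i by (auto simp: x' fermion_states_def)
    next
      fix x assume "x \<in> (\<Union>i\<in>{..n}. ?X i)"
      then obtain i S M where x': "x = (S, p, M)" and i: "i \<le> n" "label_charge S = p" "label_energy S - p * p = 2 * int i"
        "lattice_weight (p, M) = n - i"
        by (auto simp: fermion_states_def)
      then show "x \<in> weight_basis a n \<nu>" by (simp add: weight_basis_def p_iff energy_excess[OF i(3)])
    qed
    have fin: "finite (?X i)" for i using card_fermion_states card_lattice_weight by (intro finite_imageI finite_cartesian_product) auto
    have inj: "inj_on (\<lambda>(S, M). (S, p, M)) Y" for Y :: "(int fset \<times> nat multiset) set"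
      by (auto simp: inj_on_def)
    have "card (weight_basis a n \<nu>) = (\<Sum>i\<le>n. card (?X i))"
      unfolding basis
    proof (rule card_UN_disjoint)
      show "\<forall>i\<in>{..n}. \<forall>j\<in>{..n}. i \<noteq> j \<longrightarrow> ?X i \<inter> ?X j = {}" by (auto simp: fermion_states_def)
    qed (use fin in auto)
    then have "card (weight_basis a n \<nu>) = (\<Sum>i\<le>n. bounded_partitions i i * bounded_partitions (n - i) (n - i))"
      by (simp only: card_image[OF inj] card_cartesian_product conjunct2[OF card_fermion_states] conjunct2[OF card_lattice_weight])
    moreover have "finite (weight_basis a n \<nu>)" unfolding basis using fin by blast
    ultimately show ?thesis using True by simp
  next
    case False
    have "x \<notin> weight_basis a n \<nu>" for x
    proof
      assume "x \<in> weight_basis a n \<nu>"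
      then obtain p :: int where "2 * of_int p + a = \<nu>" by (auto simp: weight_basis_def)
      then have "\<nu> - a = of_int (2 * p)" by auto
      then show False using False by blast
    qed
    then have "weight_basis a n \<nu> = {}" by blast
    then show ?thesis using False by simp
  qed
  then show "finite (weight_basis a n \<nu>)"
    "card (weight_basis a n \<nu>) = (if \<exists>k::int. \<nu> - a = of_int (2 * k)
      then \<Sum>i\<le>n. bounded_partitions i i * bounded_partitions (n - i) (n - i) else 0)" by blast+
qed

lemma ket_weight_space:
  assumes "v \<in> Pi_zero" "x \<in> Poly_Mapping.keys v"
  obtains n \<nu> where "ket x \<in> weight_space Pi_zero (E_action lam mu) n \<nu>"
proof -
  obtain S p M where x: "x = (S, p, M)" by (cases x) auto
  have S: "label_charge S = p" using assms by (auto simp: Pi_zero_iff x)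
  obtain i where i: "label_energy S - p * p = 2 * int i" using label_energy_excess[of S] S by auto
  show thesis
    by (rule that[of "i + lattice_weight (p, M)" "2 * of_int p + (lam - mu)"])
      (simp add: weight_space_E ket_def weight_basis_def x S energy_excess[OF i])
qed

text \<open>Stated for any X between the weight spaces and \<Pi>(0), since it serves both the
  character and the grading, where X is the union of the larger energy spaces.\<close>

lemma Pi_zero_span:
  assumes "\<And>n \<nu>. weight_space Pi_zero (E_action lam mu) n \<nu> \<subseteq> X" "X \<subseteq> Pi_zero"
  shows "Pi_zero = cvs.span X"
proof
  show "cvs.span X \<subseteq> Pi_zero" by (rule cvs.span_minimal[OF assms(2) subspace_Pi_zero])
  show "Pi_zero \<subseteq> cvs.span X"
  proof
    fix v assume v: "v \<in> Pi_zero"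
    have "ket x \<in> cvs.span X" if "x \<in> Poly_Mapping.keys v" for x
      using ket_weight_space[OF v that, of lam mu] assms(1) by (metis cvs.span_base subsetD)
    then show "v \<in> cvs.span X"
      by (subst ket_expand) (intro cvs.span_sum cvs.span_scale)
  qed
qed

lemma has_character_E: "has_character Pi_zero (E_action lam mu)"
  unfolding has_character_def
proof (intro conjI allI)
  show "Pi_zero = cvs.span (\<Union>n \<nu>. weight_space Pi_zero (E_action lam mu) n \<nu>)"
    by (rule Pi_zero_span) (auto simp: weight_space_def energy_space_def)
  show "\<exists>B. finite B \<and> weight_space Pi_zero (E_action lam mu) n \<nu> \<subseteq> cvs.span B" for n \<nu>
    by (rule exI[of _ "ket ` weight_basis (lam - mu) n \<nu>"]) (simp add: card_weight_basis(1) weight_space_E span_ket)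
qed

lemma nonneg_graded_E: "nonneg_graded Pi_zero (E_action lam mu)"
  unfolding nonneg_graded_def
proof (intro conjI allI ballI)
  show "Pi_zero = cvs.span (\<Union>n::nat. energy_space Pi_zero (E_action lam mu) (of_nat n))"
    by (rule Pi_zero_span[of lam mu]) (auto simp: weight_space_def energy_space_def)
  fix x m s v
  assume "v \<in> energy_space Pi_zero (E_action lam mu) s"
  then have v: "v \<in> Pi_zero" "diag energy v = cscale s v"
    by (simp_all add: energy_space_def virasoro_diag)
  have "diag energy (E_basis_action lam mu (Loop x m) v)
    = cscale (s - of_int m) (E_basis_action lam mu (Loop x m) v)"
    unfolding energy_E_basis_action v(2) clinear_cscale[OF clinear_E_basis_action]
    by (simp add: loop_shift_def cvs.scale_left_diff_distrib)
  then show "E_action lam mu (ket (Loop x m)) v \<in> energy_space Pi_zero (E_action lam mu) (s - of_int m)"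
    using E_basis_action_Pi_zero[OF v(1)] by (simp add: energy_space_def virasoro_diag del: E_basis_action.simps(1-3))
qed

theorem corollary9p1:
  fixes lam mu :: complex
  assumes "lam \<notin> \<int>" and "mu \<notin> \<int>"
  shows "irreducible_aff_module Pi_zero (E_action lam mu) \<and>
    nonneg_graded Pi_zero (E_action lam mu) \<and>
    has_character Pi_zero (E_action lam mu) \<and>
    trace_character Pi_zero (E_action lam mu)
      = z_shift (lam - mu) (qz_mult
          (prodinf (\<lambda>n. q_inverse (1 - q_pow (Suc n) * fps_const (z_pow 2))
               * q_inverse (1 - q_pow (Suc n) * fps_const (z_pow (- 2)))))
          delta_z2) \<and>
    z_shift (lam - mu) (qz_mult
          (prodinf (\<lambda>n. q_inverse (1 - q_pow (Suc n) * fps_const (z_pow 2))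
               * q_inverse (1 - q_pow (Suc n) * fps_const (z_pow (- 2)))))
          delta_z2)
      = z_shift (lam - mu) (qz_mult (prodinf (\<lambda>n. q_inverse (1 - q_pow (Suc n)) ^ 2)) delta_z2)"
proof -
  let ?c = "\<lambda>n. \<Sum>i\<le>n. of_nat (bounded_partitions i i * bounded_partitions (n - i) (n - i)) :: complex"
  have z: "eval_one (z_pow j ^ n) = 1" "even_laurent (z_pow 2)" "even_laurent (z_pow (- 2))"
    "eval_one (1 ^ n) = 1" for j n
    by (rule eval_one_z_pow) (simp_all add: even_laurent_def z_pow_def)
  have one: "q_inverse (1 - q_pow (Suc n)) ^ 2 = geometric (Suc n) 1 * geometric (Suc n) 1" for n
    using q_inverse_geometric[of n 1] by (simp add: power2_eq_square)
  \<comment> \<open>A normal form common to both product formulas and the trace: the convolution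
    \<open>?c\<close> of partition numbers on the even integers shifted by \<lambda> -
    \<mu>.\<close>
  have shift: "z_shift (lam - mu) (qz_mult A delta_z2)
    = (\<lambda>n \<nu>. if \<exists>k::int. \<nu> - (lam - mu) = of_int (2 * k) then ?c n else 0)"
    if "\<And>n. even_laurent (fps_nth A n)" "\<And>n. eval_one (fps_nth A n) = ?c n" for A
    by (rule ext)+ (simp only: z_shift_def qz_mult_delta[OF that(1)] that(2))
  have trace: "trace_character Pi_zero (E_action lam mu)
    = (\<lambda>n \<nu>. if \<exists>k::int. \<nu> - (lam - mu) = of_int (2 * k) then ?c n else 0)"
    by (rule ext)+ (simp only: trace_character_def weight_space_E dim_keys[OF card_weight_basis(1)] card_weight_basis(2)
        if_distrib[of of_nat] of_nat_sum of_nat_0)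
  show ?thesis
    unfolding q_inverse_geometric one trace
      shift[OF eval_product[OF z(1) z(2) z(1) z(3)]] shift[OF eval_product[OF z(4) even_laurent_1 z(4) even_laurent_1]]
    using irreducible_E[OF assms] nonneg_graded_E has_character_E by blast
qed

end
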